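(* Let $(M^{4n},Q,\omega)$, $n>1$, be an almost quaternionic skew-Hermitian manifold, let $H=\{J_1,J_2,J_3\}$ be a (local) admissible basis of $Q$, and let $\gamma_1,\gamma_2,\gamma_3$ be the local 1-forms such that $\nabla^{Q,\omega}_XJ_a=\gamma_c(X)J_b-\gamma_b(X)J_c$ for every vector field $X$ and every cyclic permutation $(a,b,c)$ of $(1,2,3)$. Then the adapted connections $\nabla^{H,\omega}$ and $\nabla^{Q,\omega}$ are related by $$\nabla^{H,\omega}_X=\nabla^{Q,\omega}_X-\frac12\sum_{a=1}^3\gamma_a(X)J_a-\frac23\,\pi_S\Big(\omega\otimes\big(\textstyle\sum_{a=1}^3\gamma_a\circ J_a\big)^T\Big)(X).$$ Their torsions $T^{H,\omega}$, $T^{Q,\omega}$ satisfy $$T^{H,\omega}(X,Y)=T^{Q,\omega}(X,Y)+\frac12\sum_{a=1}^3\big(\gamma_a(Y)J_aX-\gamma_a(X)J_aY\big)-\frac23\Big\{\pi_S\big(\omega\otimes(\textstyle\sum_a\gamma_a\circ J_a)^T\big)(X,Y)-\pi_S\big(\omega\otimes(\textstyle\sum_a\gamma_a\circ J_a)^T\big)(Y,X)\Big\}.$$ Moreover, the part of $T^{H,\omega}(X,Y)$ in the torsion component $\mathcal X_6$ is $$\frac16\sum_{\mathrm{cycl}}\big(\psi_a(X)J_bY+\psi_a(J_aX)J_cY-\psi_a(Y)J_bX-\psi_a(J_aY)J_cX\big),$$ where the sum is over cyclic permutations $(a,b,c)$ of $(1,2,3)$ and $\psi_a:=\gamma_c\circ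 J_a-\gamma_b$.
   Context: An almost quaternionic structure on $M^{4n}$ ($n>1$) is a rank-3 subbundle $Q\subset\mathrm{End}(TM)$ locally spanned by an admissible basis $J_1,J_2,J_3$, i.e. $J_a^2=-\mathrm{Id}$, $J_1J_2=J_3=-J_2J_1$. An almost quaternionic skew-Hermitian (qs-H) manifold $(M^{4n},Q,\omega)$ is such a manifold with a non-degenerate 2-form $\omega$ satisfying $\omega(J_aX,J_aY)=\omega(X,Y)$ for every admissible basis. Locally, $(H=\{J_a\},\omega)$ is then an almost hypercomplex skew-Hermitian structure. Connections. $N_J(X,Y)=[JX,JY]-J[JX,Y]-J[X,JY]-[X,Y]$. The Obata connection $\nabla^H$ of $H=\{J_a\}$ is the unique connection with $\nabla^HJ_a=0$ ($a=1,2,3$) and torsion $T^H=\frac16\sum_aN_{J_a}$. With $\mathrm{vol}=\omega^{2n}$, the unimodular Oproiu connection $\nabla^{Q,\mathrm{vol}}$ is the unique connection preserving $Q$ and $\mathrm{vol}$ whose torsion is, for any admissible basis, $T^Q=T^H+\sum_a\partial(\tau_a\otimes J_a)$, where $\tau_a(X)=\frac1{4n-2}\mathrm{tr}(J_aT^H_X)$ and $\partial(\tau\otimes J)(X,Y)=\tau(X)JY-\tau(Y)JX$. The adapted connections are $\nabla^{H,\omega}=\nabla^H+A^H$ and $\nabla^{Q,\omega}=\nabla^{Q,\mathrm{vol}}+A^Q$, where $\omega(A^H(X,Y),Z)=\frac12(\nabla^H_X\omega)(Y,Z)$ and $\omega(A^Q(X,Y),Z)=\frac12(\nabla^{Q,\mathrm{vol}}_X\omega)(Y,Z)$.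 Both preserve $\omega$; the first preserves each $J_a$, the second preserves $Q$. Their torsions are denoted $T^{H,\omega}$ and $T^{Q,\omega}$. Notation. $\gamma_a\circ J_a$ is the 1-form $Z\mapsto\gamma_a(J_aZ)$. For a 1-form $\zeta$, $\zeta^T$ is the vector field with $\omega(\zeta^T,Y)=\zeta(Y)$ for all $Y$. For a vector field $Z$, $\omega\otimes Z$ is the $\mathrm{End}(TM)$-valued 1-form $X\mapsto(Y\mapsto\omega(X,Y)Z)$, and $\pi_S(\omega\otimes Z)$ is obtained by projecting the endomorphism $\omega(X,\cdot)Z$ equivariantly onto $\mathfrak{so}^*(2n)$ (the endomorphisms commuting with all $J_a$ and skew with respect to $\omega$); explicitly $$\pi_S(\omega\otimes Z)(X,Y)=\pi_S(\omega\otimes Z)(X)Y=\tfrac18\Big(\omega(X,Y)Z-\sum_a\omega(X,J_aY)J_aZ+\omega(Z,Y)X-\sum_a\omega(Z,J_aY)J_aX\Big).$$ Write $E=\mathbb C^{2n}$ and $\mathsf H=\mathbb C^2$ for the standard representations of $\mathrm{SO}^*(2n)$ and $\mathrm{Sp}(1)$, so that $T_xM$ is the real form $[E\otimes\mathsf H]$. $\mathcal X_6$ is the $\mathrm{SO}^*(2n)\mathrm{Sp}(1)$-submodule of $\Lambda^2T^*M\otimes TM$ of type $[E\otimes S^3\mathsf H]$ (it occurs with multiplicity one); the part of $T^{H,\omega}$ in $\mathcal X_6$ is the corresponding equivariant projection.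
   Formalization: For n=2 the type [E⊗S³H] occurs twice in Λ²T*M⊗TM (Λ³E≅E), so 𝒳₆ is not determined by its type; it is taken to be the copy with zero total skew-symmetrisation, and the projection is required to kill totally skew tensors (automatic for n>2). *)

theory Defs
  imports "HOL-Analysis.Analysis"
begin

section \<open>Smooth manifolds, functions and vector fields\<close>

text \<open>Class \<open>C\<^sup>k\<close> on an open set \<open>S\<close>.\<close>

primrec ck_on :: "nat \<Rightarrow> ('a::real_normed_vector \<Rightarrow> 'b::real_normed_vector) \<Rightarrow> 'a set \<Rightarrow> bool" where
  "ck_on 0 f S \<longleftrightarrow> continuous_on S f"
| "ck_on (Suc k) f S \<longleftrightarrow>
     (\<forall>x\<in>S. f differentiable (at x)) \<and> (\<forall>v. ck_on k (\<lambda>x. frechet_derivative f (at x) v) S)"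

definition smooth_on :: "('a::real_normed_vector \<Rightarrow> 'b::real_normed_vector) \<Rightarrow> 'a set \<Rightarrow> bool" where
  "smooth_on f S \<longleftrightarrow> (\<forall>k. ck_on k f S)"

type_synonym ('p, 'a) chart = "'p set \<times> ('p \<Rightarrow> 'a)"

record ('p, 'a) manifold =
  mtop :: "'p topology"
  atlas :: "('p, 'a) chart set"

definition chart_inv :: "('p, 'a) chart \<Rightarrow> 'a \<Rightarrow> 'p" where
  "chart_inv c = inv_into (fst c) (snd c)"

definition coord_change :: "('p, 'a) chart \<Rightarrow> ('p, 'a) chart \<Rightarrow> 'a \<Rightarrow> 'a" where
  "coord_change c d = (\<lambda>x. snd d (chart_inv c x))"

definition is_chart :: "'p topology \<Rightarrow> ('p, 'a::euclidean_space) chart \<Rightarrow> bool" where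
  "is_chart T c \<longleftrightarrow> openin T (fst c) \<and> open (snd c ` fst c) \<and>
     homeomorphic_map (subtopology T (fst c)) (top_of_set (snd c ` fst c)) (snd c)"

definition smooth_manifold :: "('p, 'a::euclidean_space) manifold \<Rightarrow> bool" where
  "smooth_manifold M \<longleftrightarrow>
     Hausdorff_space (mtop M) \<and> second_countable (mtop M) \<and>
     (\<forall>c\<in>atlas M. is_chart (mtop M) c) \<and> \<Union> (fst ` atlas M) = topspace (mtop M) \<and>
     (\<forall>c\<in>atlas M. \<forall>d\<in>atlas M. smooth_on (coord_change c d) (snd c ` (fst c \<inter> fst d)))"

text \<open>The tangent space at \<open>p\<close> is the model space \<open>'a\<close>, read through the chart \<open>chart_at M p\<close>
  chosen once and for all at \<open>p\<close>. Hence pointwise tensors at \<open>p\<close> are ordinary multilinear maps on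
  \<open>'a\<close>, while smoothness and derivatives of fields are expressed in a fixed chart around \<open>p\<close>,
  into which \<open>vec_in_chart\<close> transports tangent vectors.\<close>

definition chart_at :: "('p, 'a) manifold \<Rightarrow> 'p \<Rightarrow> ('p, 'a) chart" where
  "chart_at M p = (SOME c. c \<in> atlas M \<and> p \<in> fst c)"

definition vec_in_chart ::
  "('p, 'a::euclidean_space) manifold \<Rightarrow> ('p, 'a) chart \<Rightarrow> 'p \<Rightarrow> 'a \<Rightarrow> 'a" where
  "vec_in_chart M c p v =
     frechet_derivative (coord_change (chart_at M p) c) (at (snd (chart_at M p) p)) v"

definition fun_rep :: "('p, 'a) chart \<Rightarrow> ('p \<Rightarrow> real) \<Rightarrow> 'a \<Rightarrow> real" where
  "fun_rep c f = (\<lambda>x. f (chart_inv c x))"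

definition vf_rep ::
  "('p, 'a::euclidean_space) manifold \<Rightarrow> ('p, 'a) chart \<Rightarrow> ('p \<Rightarrow> 'a) \<Rightarrow> 'a \<Rightarrow> 'a" where
  "vf_rep M c X = (\<lambda>x. vec_in_chart M c (chart_inv c x) (X (chart_inv c x)))"

text \<open>Smooth functions and smooth vector fields on the open set \<open>V\<close> (empty if \<open>V\<close> is not open).\<close>

definition CF :: "('p, 'a::euclidean_space) manifold \<Rightarrow> 'p set \<Rightarrow> ('p \<Rightarrow> real) set" where
  "CF M V = {f. openin (mtop M) V \<and>
                (\<forall>c\<in>atlas M. smooth_on (fun_rep c f) (snd c ` (V \<inter> fst c)))}"

definition VF :: "('p, 'a::euclidean_space) manifold \<Rightarrow> 'p set \<Rightarrow> ('p \<Rightarrow> 'a) set" where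
  "VF M V = {X. openin (mtop M) V \<and>
                (\<forall>c\<in>atlas M. smooth_on (vf_rep M c X) (snd c ` (V \<inter> fst c)))}"

definition dir_deriv :: "('p, 'a::euclidean_space) manifold \<Rightarrow> 'p \<Rightarrow> 'a \<Rightarrow> ('p \<Rightarrow> real) \<Rightarrow> real" where
  "dir_deriv M p v f =
     frechet_derivative (fun_rep (chart_at M p) f) (at (snd (chart_at M p) p)) v"

definition bracket ::
  "('p, 'a::euclidean_space) manifold \<Rightarrow> ('p \<Rightarrow> 'a) \<Rightarrow> ('p \<Rightarrow> 'a) \<Rightarrow> 'p \<Rightarrow> 'a" where
  "bracket M X Y p =
     (let c = chart_at M p; x = snd c p in
        frechet_derivative (vf_rep M c Y) (at x) (X p)
      - frechet_derivative (vf_rep M c X) (at x) (Y p))"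

section \<open>Tensor fields and connections\<close>

definition one_form_field ::
  "('p, 'a::euclidean_space) manifold \<Rightarrow> 'p set \<Rightarrow> ('p \<Rightarrow> 'a \<Rightarrow> real) \<Rightarrow> bool" where
  "one_form_field M U \<zeta> \<longleftrightarrow>
     (\<forall>p\<in>U. linear (\<zeta> p)) \<and> (\<forall>V\<subseteq>U. \<forall>X\<in>VF M V. (\<lambda>p. \<zeta> p (X p)) \<in> CF M V)"

definition endo_field ::
  "('p, 'a::euclidean_space) manifold \<Rightarrow> 'p set \<Rightarrow> ('p \<Rightarrow> 'a \<Rightarrow> 'a) \<Rightarrow> bool" where
  "endo_field M U S \<longleftrightarrow>
     (\<forall>p\<in>U. linear (S p)) \<and> (\<forall>V\<subseteq>U. \<forall>X\<in>VF M V. (\<lambda>p. S p (X p)) \<in> VF M V)"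

definition two_form_field ::
  "('p, 'a::euclidean_space) manifold \<Rightarrow> 'p set \<Rightarrow> ('p \<Rightarrow> 'a \<Rightarrow> 'a \<Rightarrow> real) \<Rightarrow> bool" where
  "two_form_field M U \<omega> \<longleftrightarrow>
     (\<forall>p\<in>U. bilinear (\<omega> p) \<and> (\<forall>x y. \<omega> p x y = - \<omega> p y x)) \<and>
     (\<forall>V\<subseteq>U. \<forall>X\<in>VF M V. \<forall>Y\<in>VF M V. (\<lambda>p. \<omega> p (X p) (Y p)) \<in> CF M V)"

text \<open>\<open>D p v Y\<close> is the covariant derivative at \<open>p\<close> of a field \<open>Y\<close> in the direction of the tangent
  vector \<open>v\<close>. A connection acts on the smooth fields defined on any open part of \<open>U\<close>, and its value
  at \<open>p\<close> only depends on the field near \<open>p\<close>.\<close>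

type_synonym ('p, 'a) conn = "'p \<Rightarrow> 'a \<Rightarrow> ('p \<Rightarrow> 'a) \<Rightarrow> 'a"

definition is_connection ::
  "('p, 'a::euclidean_space) manifold \<Rightarrow> 'p set \<Rightarrow> ('p, 'a) conn \<Rightarrow> bool" where
  "is_connection M U D \<longleftrightarrow> openin (mtop M) U \<and>
     (\<forall>V\<subseteq>U. \<forall>Y\<in>VF M V.
        (\<forall>p\<in>V. linear (\<lambda>v. D p v Y)) \<and>
        (\<forall>X\<in>VF M V. (\<lambda>p. D p (X p) Y) \<in> VF M V) \<and>
        (\<forall>Z\<in>VF M V. \<forall>p\<in>V. \<forall>v. D p v (\<lambda>q. Y q + Z q) = D p v Y + D p v Z) \<and>
        (\<forall>f\<in>CF M V. \<forall>p\<in>V. \<forall>v.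
            D p v (\<lambda>q. f q *\<^sub>R Y q) = dir_deriv M p v f *\<^sub>R Y p + f p *\<^sub>R D p v Y) \<and>
        (\<forall>Z\<in>VF M V. (\<forall>q\<in>V. Z q = Y q) \<longrightarrow> (\<forall>p\<in>V. \<forall>v. D p v Z = D p v Y)))"

definition cov_endo :: "('p, 'a::real_vector) conn \<Rightarrow> ('p \<Rightarrow> 'a \<Rightarrow> 'a) \<Rightarrow> 'p \<Rightarrow> 'a \<Rightarrow> ('p \<Rightarrow> 'a) \<Rightarrow> 'a" where
  "cov_endo D S p v Y = D p v (\<lambda>q. S q (Y q)) - S p (D p v Y)"

definition cov_form ::
  "('p, 'a::euclidean_space) manifold \<Rightarrow> ('p, 'a) conn \<Rightarrow> ('p \<Rightarrow> 'a \<Rightarrow> 'a \<Rightarrow> real) \<Rightarrow>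
   'p \<Rightarrow> 'a \<Rightarrow> ('p \<Rightarrow> 'a) \<Rightarrow> ('p \<Rightarrow> 'a) \<Rightarrow> real" where
  "cov_form M D \<omega> p v Y Z =
     dir_deriv M p v (\<lambda>q. \<omega> q (Y q) (Z q)) - \<omega> p (D p v Y) (Z p) - \<omega> p (Y p) (D p v Z)"

definition torsion_tensor ::
  "('p, 'a::euclidean_space) manifold \<Rightarrow> 'p set \<Rightarrow> ('p, 'a) conn \<Rightarrow> ('p \<Rightarrow> 'a \<Rightarrow> 'a \<Rightarrow> 'a) \<Rightarrow> bool" where
  "torsion_tensor M U D T \<longleftrightarrow> (\<forall>p\<in>U. bilinear (T p)) \<and>
     (\<forall>V\<subseteq>U. \<forall>X\<in>VF M V. \<forall>Y\<in>VF M V. \<forall>p\<in>V.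
        T p (X p) (Y p) = D p (X p) Y - D p (Y p) X - bracket M X Y p)"

definition nijenhuis ::
  "('p, 'a::euclidean_space) manifold \<Rightarrow> ('p \<Rightarrow> 'a \<Rightarrow> 'a) \<Rightarrow> ('p \<Rightarrow> 'a) \<Rightarrow> ('p \<Rightarrow> 'a) \<Rightarrow> 'p \<Rightarrow> 'a" where
  "nijenhuis M J X Y p =
     bracket M (\<lambda>q. J q (X q)) (\<lambda>q. J q (Y q)) p - J p (bracket M (\<lambda>q. J q (X q)) Y p)
     - J p (bracket M X (\<lambda>q. J q (Y q)) p) - bracket M X Y p"

definition lin_trace :: "('a::euclidean_space \<Rightarrow> 'a) \<Rightarrow> real" where
  "lin_trace f = (\<Sum>b\<in>Basis. f b \<bullet> b)"

section \<open>Almost quaternionic skew-Hermitian structures\<close>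

text \<open>Bases are indexed by \<open>{1..3} :: nat set\<close>; the value of \<open>J\<close> at other indices is irrelevant.\<close>

definition cyclic3 :: "(nat \<times> nat \<times> nat) set" where
  "cyclic3 = {(1, 2, 3), (2, 3, 1), (3, 1, 2)}"

definition almost_hypercomplex ::
  "('p, 'a::euclidean_space) manifold \<Rightarrow> 'p set \<Rightarrow> (nat \<Rightarrow> 'p \<Rightarrow> 'a \<Rightarrow> 'a) \<Rightarrow> bool" where
  "almost_hypercomplex M V J \<longleftrightarrow> openin (mtop M) V \<and>
     (\<forall>a\<in>{1..3}. endo_field M V (J a)) \<and>
     (\<forall>p\<in>V. \<forall>x. (\<forall>a\<in>{1..3}. J a p (J a p x) = - x) \<and>
                 J 1 p (J 2 p x) = J 3 p x \<and> J 2 p (J 1 p x) = - J 3 p x)"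

text \<open>That \<open>Q\<close> is a smooth subbundle of rank 3 follows from the local smooth bases \<open>J\<close>, which the
  quaternionic relations make linearly independent.\<close>

definition admissible_basis ::
  "('p, 'a::euclidean_space) manifold \<Rightarrow> ('p \<Rightarrow> ('a \<Rightarrow> 'a) set) \<Rightarrow> 'p set \<Rightarrow>
   (nat \<Rightarrow> 'p \<Rightarrow> 'a \<Rightarrow> 'a) \<Rightarrow> bool" where
  "admissible_basis M Q V J \<longleftrightarrow> almost_hypercomplex M V J \<and>
     (\<forall>p\<in>V. Q p = {\<lambda>x. \<Sum>a=1..3. r a *\<^sub>R J a p x | r. True})"

definition almost_quaternionic ::
  "('p, 'a::euclidean_space) manifold \<Rightarrow> ('p \<Rightarrow> ('a \<Rightarrow> 'a) set) \<Rightarrow> bool" where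
  "almost_quaternionic M Q \<longleftrightarrow> smooth_manifold M \<and>
     (\<forall>p\<in>topspace (mtop M). \<exists>V J. p \<in> V \<and> admissible_basis M Q V J)"

definition almost_qsH ::
  "('p, 'a::euclidean_space) manifold \<Rightarrow> ('p \<Rightarrow> ('a \<Rightarrow> 'a) set) \<Rightarrow> ('p \<Rightarrow> 'a \<Rightarrow> 'a \<Rightarrow> real) \<Rightarrow> bool" where
  "almost_qsH M Q \<omega> \<longleftrightarrow> almost_quaternionic M Q \<and>
     two_form_field M (topspace (mtop M)) \<omega> \<and>
     (\<forall>p\<in>topspace (mtop M). \<forall>x. (\<forall>y. \<omega> p x y = 0) \<longrightarrow> x = 0) \<and>
     (\<forall>V J. admissible_basis M Q V J \<longrightarrow>
        (\<forall>p\<in>V. \<forall>a\<in>{1..3}. \<forall>x y. \<omega> p (J a p x) (J a p y) = \<omega> p x y))"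

section \<open>The Obata, the unimodular Oproiu and the adapted connections\<close>

definition obata_connection ::
  "('p, 'a::euclidean_space) manifold \<Rightarrow> 'p set \<Rightarrow> (nat \<Rightarrow> 'p \<Rightarrow> 'a \<Rightarrow> 'a) \<Rightarrow> ('p, 'a) conn \<Rightarrow>
   ('p \<Rightarrow> 'a \<Rightarrow> 'a \<Rightarrow> 'a) \<Rightarrow> bool" where
  "obata_connection M V J D T \<longleftrightarrow> is_connection M V D \<and> torsion_tensor M V D T \<and>
     (\<forall>W\<subseteq>V. \<forall>Y\<in>VF M W. \<forall>p\<in>W. \<forall>v. \<forall>a\<in>{1..3}. cov_endo D (J a) p v Y = 0) \<and>
     (\<forall>W\<subseteq>V. \<forall>X\<in>VF M W. \<forall>Y\<in>VF M W. \<forall>p\<in>W.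
        T p (X p) (Y p) = (1/6) *\<^sub>R (\<Sum>a=1..3. nijenhuis M (J a) X Y p))"

text \<open>The \<open>k\<close>-th exterior power of a 2-form: the sum over permutations for the wedge product
  normalised by \<open>(\<alpha> \<and> \<beta>)(x, y) = \<alpha>(x) \<beta>(y) - \<alpha>(y) \<beta>(x)\<close> on 1-forms.\<close>

definition form_power :: "('a \<Rightarrow> 'a \<Rightarrow> real) \<Rightarrow> nat \<Rightarrow> (nat \<Rightarrow> 'a) \<Rightarrow> real" where
  "form_power w k x =
     (\<Sum>\<sigma> | \<sigma> permutes {..<2*k}.
        of_int (sign \<sigma>) * (\<Prod>i<k. w (x (\<sigma> (2*i))) (x (\<sigma> (2*i+1))))) / 2^k"

definition preserves_form_power ::
  "('p, 'a::euclidean_space) manifold \<Rightarrow> ('p \<Rightarrow> 'a \<Rightarrow> 'a \<Rightarrow> real) \<Rightarrow> nat \<Rightarrow> ('p, 'a) conn \<Rightarrow> bool" where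
  "preserves_form_power M \<omega> k D \<longleftrightarrow>
     (\<forall>V\<subseteq>topspace (mtop M). \<forall>Y. (\<forall>i<2*k. Y i \<in> VF M V) \<longrightarrow> (\<forall>p\<in>V. \<forall>v.
        dir_deriv M p v (\<lambda>q. form_power (\<omega> q) k (\<lambda>i. Y i q)) =
        (\<Sum>i<2*k. form_power (\<omega> p) k ((\<lambda>j. Y j p)(i := D p v (Y i))))))"

definition preserves_bundle ::
  "('p, 'a::euclidean_space) manifold \<Rightarrow> ('p \<Rightarrow> ('a \<Rightarrow> 'a) set) \<Rightarrow> ('p, 'a) conn \<Rightarrow> bool" where
  "preserves_bundle M Q D \<longleftrightarrow>
     (\<forall>V\<subseteq>topspace (mtop M). openin (mtop M) V \<longrightarrow>
        (\<forall>S. endo_field M V S \<and> (\<forall>q\<in>V. S q \<in> Q q) \<longrightarrow> (\<forall>p\<in>V. \<forall>v. \<exists>K\<in>Q p.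
           \<forall>W\<subseteq>V. p \<in> W \<longrightarrow> (\<forall>Y\<in>VF M W. cov_endo D S p v Y = K (Y p)))))"

definition oproiu_tau ::
  "nat \<Rightarrow> (nat \<Rightarrow> 'p \<Rightarrow> 'a::euclidean_space \<Rightarrow> 'a) \<Rightarrow> ('p \<Rightarrow> 'a \<Rightarrow> 'a \<Rightarrow> 'a) \<Rightarrow> nat \<Rightarrow> 'p \<Rightarrow> 'a \<Rightarrow> real" where
  "oproiu_tau n J T a p x = lin_trace (\<lambda>y. J a p (T p x y)) / (4 * real n - 2)"

definition oproiu_connection ::
  "nat \<Rightarrow> ('p, 'a::euclidean_space) manifold \<Rightarrow> ('p \<Rightarrow> ('a \<Rightarrow> 'a) set) \<Rightarrow>
   ('p \<Rightarrow> 'a \<Rightarrow> 'a \<Rightarrow> real) \<Rightarrow> ('p, 'a) conn \<Rightarrow> bool" where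
  "oproiu_connection n M Q \<omega> D \<longleftrightarrow> is_connection M (topspace (mtop M)) D \<and>
     preserves_bundle M Q D \<and> preserves_form_power M \<omega> (2*n) D \<and>
     (\<forall>V J D' T. admissible_basis M Q V J \<and> obata_connection M V J D' T \<longrightarrow>
        torsion_tensor M V D
          (\<lambda>p x y. T p x y + (\<Sum>a=1..3. oproiu_tau n J T a p x *\<^sub>R J a p y
                                       - oproiu_tau n J T a p y *\<^sub>R J a p x)))"

text \<open>\<open>D' = D + A\<close> on \<open>U\<close>, where \<open>\<omega>(A(X, Y), Z)\<close> is half of the covariant derivative
  of \<open>\<omega>\<close> by \<open>D\<close>.\<close>

definition adapted_connection ::
  "('p, 'a::euclidean_space) manifold \<Rightarrow> 'p set \<Rightarrow> ('p \<Rightarrow> 'a \<Rightarrow> 'a \<Rightarrow> real) \<Rightarrow>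
   ('p, 'a) conn \<Rightarrow> ('p, 'a) conn \<Rightarrow> bool" where
  "adapted_connection M U \<omega> D D' \<longleftrightarrow>
     (\<exists>A. (\<forall>p\<in>U. bilinear (A p)) \<and>
          (\<forall>V\<subseteq>U. \<forall>Y\<in>VF M V. \<forall>p\<in>V. \<forall>v.
             (\<forall>Z\<in>VF M V. \<omega> p (A p v (Y p)) (Z p) = (1/2) * cov_form M D \<omega> p v Y Z) \<and>
             D' p v Y = D p v Y + A p v (Y p)))"

section \<open>Algebra at a point\<close>

text \<open>Below, \<open>J\<close> and \<open>w\<close> are the values of an admissible basis and of the 2-form at a point.\<close>

definition sharp :: "('a \<Rightarrow> 'a \<Rightarrow> real) \<Rightarrow> ('a \<Rightarrow> real) \<Rightarrow> 'a" where
  "sharp w \<zeta> = (THE z. \<forall>y. w z y = \<zeta> y)"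

definition pi_S ::
  "(nat \<Rightarrow> 'a::real_vector \<Rightarrow> 'a) \<Rightarrow> ('a \<Rightarrow> 'a \<Rightarrow> real) \<Rightarrow> 'a \<Rightarrow> 'a \<Rightarrow> 'a \<Rightarrow> 'a" where
  "pi_S J w z x y = (1/8) *\<^sub>R
     (w x y *\<^sub>R z - (\<Sum>a=1..3. w x (J a y) *\<^sub>R J a z)
      + w z y *\<^sub>R x - (\<Sum>a=1..3. w z (J a y) *\<^sub>R J a x))"

definition torsion_space :: "('a::real_vector \<Rightarrow> 'a \<Rightarrow> 'a) set" where
  "torsion_space = {T. bilinear T \<and> (\<forall>x y. T x y = - T y x)}"

definition SO_star :: "(nat \<Rightarrow> 'a::real_vector \<Rightarrow> 'a) \<Rightarrow> ('a \<Rightarrow> 'a \<Rightarrow> real) \<Rightarrow> ('a \<Rightarrow> 'a) set" where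
  "SO_star J w = {A. linear A \<and> bij A \<and> (\<forall>a\<in>{1..3}. \<forall>x. A (J a x) = J a (A x)) \<and>
                     (\<forall>x y. w (A x) (A y) = w x y)}"

text \<open>Unit quaternions \<open>q 0 + q 1 i + q 2 j + q 3 k\<close>, with their action on the tangent space (where
  \<open>i, j, k\<close> act by \<open>J 1, J 2, J 3\<close>) and on the standard representation \<open>\<bbbC>\<^sup>2\<close>, through the
  matrices of determinant 1 with rows \<open>(\<alpha>, \<beta>)\<close> and \<open>(-cnj \<beta>, cnj \<alpha>)\<close>.\<close>

definition Sp1 :: "(nat \<Rightarrow> real) set" where
  "Sp1 = {q. (\<Sum>i=0..3. (q i)\<^sup>2) = 1}"

definition Sp1_tangent :: "(nat \<Rightarrow> 'a::real_vector \<Rightarrow> 'a) \<Rightarrow> (nat \<Rightarrow> real) \<Rightarrow> 'a \<Rightarrow> 'a" where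
  "Sp1_tangent J q x = q 0 *\<^sub>R x + (\<Sum>a=1..3. q a *\<^sub>R J a x)"

definition Sp1_C2 :: "(nat \<Rightarrow> real) \<Rightarrow> complex \<times> complex \<Rightarrow> complex \<times> complex" where
  "Sp1_C2 q h = (let \<alpha> = Complex (q 0) (q 1); \<beta> = Complex (q 2) (q 3) in
     (\<alpha> * fst h + \<beta> * snd h, - cnj \<beta> * fst h + cnj \<alpha> * snd h))"

definition act_torsion ::
  "(nat \<Rightarrow> 'a::real_vector \<Rightarrow> 'a) \<Rightarrow> ('a \<Rightarrow> 'a) \<Rightarrow> (nat \<Rightarrow> real) \<Rightarrow> ('a \<Rightarrow> 'a \<Rightarrow> 'a) \<Rightarrow> 'a \<Rightarrow> 'a \<Rightarrow> 'a" where
  "act_torsion J A q T =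
     (let g = A \<circ> Sp1_tangent J q in (\<lambda>x y. g (T (inv g x) (inv g y))))"

text \<open>The real representation \<open>[E \<otimes> S\<^sup>3H]\<close>. The complex representation \<open>E\<close> of \<open>SO_star J w\<close> is the
  tangent space with complex structure \<open>J 1\<close> and invariant quaternionic structure \<open>J 2\<close>. Since the
  representation \<open>H = \<bbbC>\<^sup>2\<close> is self-dual, \<open>E \<otimes> S\<^sup>3H\<close> consists of the symmetric complex trilinear maps
  from \<open>H\<close> to \<open>E\<close>. The real structure combines \<open>J 2\<close> with the invariant quaternionic
  structure \<open>jH\<close> of \<open>H\<close>.\<close>

definition C_mult :: "(nat \<Rightarrow> 'a::real_vector \<Rightarrow> 'a) \<Rightarrow> complex \<Rightarrow> 'a \<Rightarrow> 'a" where
  "C_mult J z x = Re z *\<^sub>R x + Im z *\<^sub>R J 1 x"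

definition jH :: "complex \<times> complex \<Rightarrow> complex \<times> complex" where
  "jH h = (- cnj (snd h), cnj (fst h))"

definition ES3H ::
  "(nat \<Rightarrow> 'a::real_vector \<Rightarrow> 'a) \<Rightarrow>
   (complex \<times> complex \<Rightarrow> complex \<times> complex \<Rightarrow> complex \<times> complex \<Rightarrow> 'a) set" where
  "ES3H J = {t.
     (\<forall>h h' k l. t (h + h') k l = t h k l + t h' k l) \<and>
     (\<forall>z h k l. t (z * fst h, z * snd h) k l = C_mult J z (t h k l)) \<and>
     (\<forall>h k l. t h k l = t k h l \<and> t h k l = t h l k) \<and>
     (\<forall>h k l. t (jH h) (jH k) (jH l) = J 2 (t h k l))}"

definition act_ES3H ::
  "('a \<Rightarrow> 'a) \<Rightarrow> (nat \<Rightarrow> real) \<Rightarrow> (complex \<times> complex \<Rightarrow> complex \<times> complex \<Rightarrow> complex \<times> complex \<Rightarrow> 'a) \<Rightarrow>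
   complex \<times> complex \<Rightarrow> complex \<times> complex \<Rightarrow> complex \<times> complex \<Rightarrow> 'a" where
  "act_ES3H A q t =
     (let r = inv (Sp1_C2 q) in (\<lambda>h k l. A (t (r h) (r k) (r l))))"

definition of_type_ES3H ::
  "(nat \<Rightarrow> 'a::real_vector \<Rightarrow> 'a) \<Rightarrow> ('a \<Rightarrow> 'a \<Rightarrow> real) \<Rightarrow> ('a \<Rightarrow> 'a \<Rightarrow> 'a) set \<Rightarrow> bool" where
  "of_type_ES3H J w X \<longleftrightarrow> (\<exists>\<Phi>. bij_betw \<Phi> X (ES3H J) \<and>
     (\<forall>S\<in>X. \<forall>T\<in>X. \<Phi> (\<lambda>x y. S x y + T x y) = (\<lambda>h k l. \<Phi> S h k l + \<Phi> T h k l)) \<and>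
     (\<forall>r. \<forall>T\<in>X. \<Phi> (\<lambda>x y. r *\<^sub>R T x y) = (\<lambda>h k l. r *\<^sub>R \<Phi> T h k l)) \<and>
     (\<forall>A\<in>SO_star J w. \<forall>q\<in>Sp1. \<forall>T\<in>X. \<Phi> (act_torsion J A q T) = act_ES3H A q (\<Phi> T)))"

text \<open>\<open>P\<close> is an equivariant projection of \<open>\<Lambda>\<^sup>2T\<^sup>*M \<otimes> TM\<close> onto a submodule of type \<open>[E \<otimes> S\<^sup>3H]\<close>.
  The last two conditions say that the submodule lies in the kernel of the total
  skew-symmetrisation of \<open>w (T x y) z\<close> and that the totally skew tensors lie in the kernel
  of \<open>P\<close>. They are automatic in real dimension \<open>4n > 8\<close>. For \<open>n = 2\<close> the
  submodule \<open>[\<Lambda>\<^sup>3E \<otimes> S\<^sup>3H]\<close> of the totally skew tensors is isomorphic to \<open>[E \<otimes> S\<^sup>3H]\<close> by the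
  Hodge star on \<open>E\<close>, and the conditions separate it from the component meant here.\<close>

definition X6_projection ::
  "(nat \<Rightarrow> 'a::real_vector \<Rightarrow> 'a) \<Rightarrow> ('a \<Rightarrow> 'a \<Rightarrow> real) \<Rightarrow>
   (('a \<Rightarrow> 'a \<Rightarrow> 'a) \<Rightarrow> ('a \<Rightarrow> 'a \<Rightarrow> 'a)) \<Rightarrow> bool" where
  "X6_projection J w P \<longleftrightarrow>
     (\<forall>T\<in>torsion_space. P T \<in> torsion_space \<and> P (P T) = P T) \<and>
     (\<forall>S\<in>torsion_space. \<forall>T\<in>torsion_space.
        P (\<lambda>x y. S x y + T x y) = (\<lambda>x y. P S x y + P T x y)) \<and>
     (\<forall>r. \<forall>T\<in>torsion_space. P (\<lambda>x y. r *\<^sub>R T x y) = (\<lambda>x y. r *\<^sub>R P T x y)) \<and>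
     (\<forall>A\<in>SO_star J w. \<forall>q\<in>Sp1. \<forall>T\<in>torsion_space.
        P (act_torsion J A q T) = act_torsion J A q (P T)) \<and>
     of_type_ES3H J w (P ` torsion_space) \<and>
     (\<forall>T\<in>torsion_space. \<forall>x y z.
        w (P T x y) z + w (P T y z) x + w (P T z x) y = 0) \<and>
     (\<forall>T\<in>torsion_space. (\<forall>x y z. w (T x y) z = - w (T x z) y) \<longrightarrow> P T = (\<lambda>x y. 0))"

end

theory Submission
  imports Defs
begin

text \<open>
  At a point, the difference of the Obata and the Oproiu connection is determined by the forms
  \<open>\<gamma>\<^sub>a\<close> up to a tensor with values in \<open>\<g>\<l>(n, \<bbbH>)\<close>. The torsion condition forces this tensor into the
  first prolongation of \<open>\<g>\<l>(n, \<bbbH>) \<oplus> \<s>\<p>(1)\<close>, that is, into a family parametrised by one covector,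
  and the covector is read off from \<open>\<Sum> \<tau>\<^sub>a \<circ> J\<^sub>a = 0\<close>, an identity for the traces of the Obata
  torsion. Passing to the adapted connections takes the \<open>\<omega>\<close>-skew part of the difference.

  For the component \<open>\<X>\<^sub>6\<close>, the Casimir operator of \<open>\<s>\<p>(1)\<close> shows that an equivariant projection onto
  a module of type \<open>[E \<otimes> S\<^sup>3H]\<close> sees only the Obata torsion, on which the Casimir operator of
  \<open>\<s>\<o>\<^sup>*(2n)\<close> is a constant plus the total skew-symmetrisation plus the trace part
  \<open>\<partial>(\<Sum> \<tau>\<^sub>a \<otimes> J\<^sub>a)\<close>. Comparing it with its constant value on \<open>E\<close> gives the projection up to the
  value on the trace part, where it is the identity by a count of dimensions. In terms of \<open>\<gamma>\<close>, the
  trace part is minus the expression in the \<open>\<psi>\<^sub>a\<close>.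
\<close>

text \<open>The projection onto X6 is known only to be linear and equivariant under the two groups,
  together with an unspecified isomorphism of its image with \<open>ES3H\<close>. Two obstacles
  shape the argument. The infinitesimal action has to be reached without limits, since no continuity
  of \<open>P\<close> or \<open>\<Phi>\<close> is at hand; it is written as a finite linear
  combination of group elements. And the torsion space is never decomposed into irreducible modules:
  a Casimir operator is evaluated twice, through the isomorphism, where it is a scalar, and on
  tensors, where it is an explicit expression. For sp(1) the scalar is -15 on the S^3 type and -3 on
  the type of a single factor H, so \<open>P\<close> kills the latter. For so*(2n) the comparison
  yields the factor 8 / \<open>cas_const\<close> = -1 / (4n - 2) in front of the trace part. Up to
  sign this is the normalisation of the forms in the Oproiu connection, which is why the component
  becomes minus the Oproiu correction.\<close>

declare One_nat_def [simp del]

section \<open>Fields and connections in charts\<close>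

lemma ck_on_cong:
  assumes "open S" "\<And>x. x \<in> S \<Longrightarrow> f x = g x"
  shows "ck_on k f S \<longleftrightarrow> ck_on k g S"
  using assms(2)
proof (induction k arbitrary: f g)
  case 0
  then show ?case by (auto cong: continuous_on_cong)
next
  case (Suc k)
  have ev: "eventually (\<lambda>y. f y = g y) (nhds x)" if "x \<in> S" for x
    using eventually_nhds Suc.prems assms(1) that by blast
  have deriv: "(f has_derivative D) (at x) \<longleftrightarrow> (g has_derivative D) (at x)" if "x \<in> S" for x D
    by (metis Suc.prems assms(1) has_derivative_transform_within_open that)
  then have "f differentiable (at x) \<longleftrightarrow> g differentiable (at x)" if "x \<in> S" for x
    using that by (simp add: differentiable_def)
  moreover have "frechet_derivative f (at x) = frechet_derivative g (at x)" if "x \<in> S" for x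
    unfolding frechet_derivative_def using deriv[OF that] by simp
  moreover have "ck_on k (\<lambda>x. frechet_derivative f (at x) v) S \<longleftrightarrow>
      ck_on k (\<lambda>x. frechet_derivative g (at x) v) S" for v
    by (rule Suc.IH) (use calculation(2) in simp)
  ultimately show ?case by simp
qed

lemma ck_on_SucD: "ck_on (Suc k) f S \<Longrightarrow> ck_on k f S"
proof (induction k arbitrary: f)
  case 0
  then show ?case
    using differentiable_at_imp_differentiable_on differentiable_imp_continuous_on by force
next
  case (Suc k)
  then show ?case by simp
qed

lemma ck_on_frechet:
  assumes "ck_on (Suc k) f S" shows "ck_on k (\<lambda>x. frechet_derivative f (at x) v) S"
  using assms by simp

lemma ck_on_SucI:
  assumes "open S" "\<And>x. x \<in> S \<Longrightarrow> (f has_derivative D x) (at x)" "\<And>v. ck_on k (\<lambda>x. D x v) S"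
  shows "ck_on (Suc k) f S"
proof -
  have "frechet_derivative f (at x) = D x" if "x \<in> S" for x
    using assms(2)[OF that] by (metis frechet_derivative_at)
  then have "ck_on k (\<lambda>x. frechet_derivative f (at x) v) S" for v
    using assms(3)[of v] ck_on_cong[OF assms(1), of "\<lambda>x. frechet_derivative f (at x) v" "\<lambda>x. D x v" k]
    by simp
  then show ?thesis using assms(2) by (auto simp: differentiable_def)
qed

lemma ck_on_SucE:
  assumes "ck_on (Suc k) f S" "x \<in> S"
  shows "(f has_derivative frechet_derivative f (at x)) (at x)"
  using assms by (simp add: frechet_derivative_works)

lemma ck_on_const: "open S \<Longrightarrow> ck_on k (\<lambda>x. c) S"
proof (induction k arbitrary: c)
  case (Suc k)
  show ?case
    by (rule ck_on_SucI[where D="\<lambda>_ _. 0"]) (use Suc in auto)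
qed simp

lemma ck_on_add:
  assumes "open S" shows "ck_on k f S \<Longrightarrow> ck_on k g S \<Longrightarrow> ck_on k (\<lambda>x. f x + g x) S"
proof (induction k arbitrary: f g)
  case 0
  then show ?case by (simp add: continuous_on_add)
next
  case (Suc k)
  show ?case
  proof (rule ck_on_SucI[OF assms has_derivative_add[OF ck_on_SucE ck_on_SucE]])
    show "ck_on k (\<lambda>x. frechet_derivative f (at x) v + frechet_derivative g (at x) v) S" for v
      by (rule Suc.IH; rule ck_on_frechet; rule Suc.prems)
  qed (rule Suc.prems | assumption)+
qed

lemma ck_on_sum:
  assumes "open S" "finite I" "\<And>i. i \<in> I \<Longrightarrow> ck_on k (f i) S"
  shows "ck_on k (\<lambda>x. \<Sum>i\<in>I. f i x) S"
  using assms(2,3)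
  by (induction I) (auto intro: ck_on_const ck_on_add assms(1))

lemma ck_on_scaleR:
  assumes "open S" shows "ck_on k f S \<Longrightarrow> ck_on k g S \<Longrightarrow> ck_on k (\<lambda>x. f x *\<^sub>R g x) S"
proof (induction k arbitrary: f g)
  case 0
  then show ?case by (simp add: continuous_on_scaleR)
next
  case (Suc k)
  show ?case
  proof (rule ck_on_SucI[OF assms has_derivative_scaleR[OF ck_on_SucE ck_on_SucE]])
    show "ck_on k (\<lambda>x. f x *\<^sub>R frechet_derivative g (at x) v +
        frechet_derivative f (at x) v *\<^sub>R g x) S" for v
      by (rule ck_on_add[OF assms]; rule Suc.IH; rule ck_on_SucD ck_on_frechet; rule Suc.prems)
  qed (rule Suc.prems | assumption)+
qed

lemma ck_on_inner:
  assumes "open S" shows "ck_on k f S \<Longrightarrow> ck_on k (\<lambda>x. f x \<bullet> b) S"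
proof (induction k arbitrary: f)
  case 0
  then show ?case by (simp add: continuous_on_inner)
next
  case (Suc k)
  show ?case
  proof (rule ck_on_SucI[OF assms has_derivative_inner_left[OF ck_on_SucE]])
    show "ck_on k (\<lambda>x. frechet_derivative f (at x) v \<bullet> b) S" for v
      by (rule Suc.IH; rule ck_on_frechet; rule Suc.prems)
  qed (rule Suc.prems | assumption)+
qed

text \<open>The recursion of \<open>ck_on\<close> knows derivatives in fixed directions only,
  whereas the chain rule differentiates \<open>f\<close> in the moving direction given by the
  derivative of \<open>g\<close>. Expanding that direction in the basis leaves a finite sum of
  products, and the induction hypothesis applies to the partial derivatives of
  \<open>f\<close>.\<close>

lemma ck_on_compose:
  fixes g :: "'a::euclidean_space \<Rightarrow> 'b::euclidean_space"
  assumes "open S" "open R" "g ` R \<subseteq> S"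
  shows "ck_on k f S \<Longrightarrow> ck_on k g R \<Longrightarrow> ck_on k (\<lambda>x. f (g x)) R"
proof (induction k arbitrary: f)
  case 0
  then show ?case using continuous_on_compose2 assms(3) by auto
next
  case (Suc k)
  show ?case
  proof (rule ck_on_SucI[where D="\<lambda>x v. \<Sum>b\<in>Basis.
        (frechet_derivative g (at x) v \<bullet> b) *\<^sub>R frechet_derivative f (at (g x)) b"])
    fix x assume x: "x \<in> R"
    note df = ck_on_SucE[OF Suc.prems(1), of "g x"]
    have lin: "linear (frechet_derivative f (at (g x)))"
      using df assms(3) x by (meson has_derivative_linear image_subset_iff)
    have "((\<lambda>x. f (g x)) has_derivative
        (\<lambda>v. frechet_derivative f (at (g x)) (frechet_derivative g (at x) v))) (at x)"
      using has_derivative_compose[OF ck_on_SucE[OF Suc.prems(2) x]] df assms(3) x by auto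
    moreover have "frechet_derivative f (at (g x)) (frechet_derivative g (at x) v) =
        (\<Sum>b\<in>Basis. (frechet_derivative g (at x) v \<bullet> b) *\<^sub>R frechet_derivative f (at (g x)) b)" for v
      using arg_cong[OF euclidean_representation[of "frechet_derivative g (at x) v"],
          of "frechet_derivative f (at (g x))"]
      by (simp add: linear_sum[OF lin] linear_scale[OF lin])
    ultimately show "((\<lambda>x. f (g x)) has_derivative (\<lambda>v. \<Sum>b\<in>Basis.
        (frechet_derivative g (at x) v \<bullet> b) *\<^sub>R frechet_derivative f (at (g x)) b)) (at x)"
      by simp
  next
    fix v
    show "ck_on k (\<lambda>x. \<Sum>b\<in>Basis.
        (frechet_derivative g (at x) v \<bullet> b) *\<^sub>R frechet_derivative f (at (g x)) b) R"
      by (intro ck_on_sum ck_on_scaleR ck_on_inner assms(2) finite_Basis Suc.IH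
          ck_on_SucD[OF Suc.prems(2)] ck_on_frechet[OF Suc.prems(1)] ck_on_frechet[OF Suc.prems(2)])
  qed (rule assms)
qed

lemma smooth_on_cong:
  "open S \<Longrightarrow> (\<And>x. x \<in> S \<Longrightarrow> f x = g x) \<Longrightarrow> smooth_on f S \<longleftrightarrow> smooth_on g S"
  using ck_on_cong unfolding smooth_on_def by metis

lemma smooth_on_compose:
  fixes g :: "'a::euclidean_space \<Rightarrow> 'b::euclidean_space"
  assumes "open S" "open R" "g ` R \<subseteq> S" "smooth_on f S" "smooth_on g R"
  shows "smooth_on (\<lambda>x. f (g x)) R"
  using assms ck_on_compose unfolding smooth_on_def by blast

lemma smooth_on_frechet: "smooth_on f S \<Longrightarrow> smooth_on (\<lambda>x. frechet_derivative f (at x) v) S"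
  unfolding smooth_on_def using ck_on_frechet by blast

lemma smooth_on_has_derivative:
  "smooth_on f S \<Longrightarrow> x \<in> S \<Longrightarrow> (f has_derivative frechet_derivative f (at x)) (at x)"
  using ck_on_SucE unfolding smooth_on_def by blast

lemma ck_on_subset: "ck_on k f S \<Longrightarrow> R \<subseteq> S \<Longrightarrow> ck_on k f R"
proof (induction k arbitrary: f)
  case 0
  then show ?case using continuous_on_subset by auto
qed auto

lemma smooth_on_subset: "smooth_on f S \<Longrightarrow> R \<subseteq> S \<Longrightarrow> smooth_on f R"
  using ck_on_subset unfolding smooth_on_def by blast

section \<open>Vector fields, charts and transition maps\<close>

lemma VF_openin: "X \<in> VF M V \<Longrightarrow> openin (mtop M) V"
  by (simp add: VF_def)

lemma VF_subset: "X \<in> VF M V \<Longrightarrow> W \<subseteq> V \<Longrightarrow> openin (mtop M) W \<Longrightarrow> X \<in> VF M W"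
  unfolding VF_def by (blast intro: smooth_on_subset)

lemma endo_field_VF:
  "endo_field M U S \<Longrightarrow> V \<subseteq> U \<Longrightarrow> X \<in> VF M V \<Longrightarrow> (\<lambda>p. S p (X p)) \<in> VF M V"
  unfolding endo_field_def by blast

context
  fixes M :: "('p, 'a::euclidean_space) manifold"
  assumes M: "smooth_manifold M"
begin

lemma chart_image_open:
  assumes "c \<in> atlas M" "openin (mtop M) V" shows "open (snd c ` (V \<inter> fst c))"
proof -
  have c: "openin (mtop M) (fst c)" "open (snd c ` fst c)"
    "homeomorphic_map (subtopology (mtop M) (fst c)) (top_of_set (snd c ` fst c)) (snd c)"
    using M assms(1) by (auto simp: smooth_manifold_def is_chart_def)
  have "openin (subtopology (mtop M) (fst c)) (V \<inter> fst c)"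
    using assms(2) by (auto simp: openin_subtopology)
  then have "openin (top_of_set (snd c ` fst c)) (snd c ` (V \<inter> fst c))"
    using homeomorphic_imp_open_map[OF c(3)] by (simp add: open_map_def)
  then show ?thesis using c(2) openin_open_eq by blast
qed

lemma openin_chart: "c \<in> atlas M \<Longrightarrow> openin (mtop M) (fst c)"
  using M by (auto simp: smooth_manifold_def is_chart_def)

lemma chart_inv_chart:
  assumes "c \<in> atlas M" "q \<in> fst c" shows "chart_inv c (snd c q) = q"
proof -
  have h: "homeomorphic_map (subtopology (mtop M) (fst c)) (top_of_set (snd c ` fst c)) (snd c)"
    and "fst c \<subseteq> topspace (mtop M)"
    using M assms(1) by (auto simp: smooth_manifold_def is_chart_def openin_subset)
  then have "inj_on (snd c) (fst c)"
    using homeomorphic_imp_injective_map[OF h]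
    by (simp add: topspace_subtopology Int_absorb1)
  then show ?thesis using assms(2) by (simp add: chart_inv_def)
qed

lemma chart_at_props:
  assumes "q \<in> topspace (mtop M)" shows "chart_at M q \<in> atlas M" "q \<in> fst (chart_at M q)"
proof -
  have "\<exists>c. c \<in> atlas M \<and> q \<in> fst c"
    using M assms unfolding smooth_manifold_def by blast
  then show "chart_at M q \<in> atlas M" "q \<in> fst (chart_at M q)"
    unfolding chart_at_def by (metis (mono_tags, lifting) someI_ex)+
qed

lemma coord_change_smooth:
  "c \<in> atlas M \<Longrightarrow> d \<in> atlas M \<Longrightarrow> smooth_on (coord_change c d) (snd c ` (fst c \<inter> fst d))"
  using M by (auto simp: smooth_manifold_def)

lemma coord_change_open:
  "c \<in> atlas M \<Longrightarrow> d \<in> atlas M \<Longrightarrow> open (snd c ` (fst c \<inter> fst d))"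
  using chart_image_open[of c "fst d"] openin_chart[of d] by (simp add: Int_commute)

lemma coord_change_has_derivative:
  assumes "c \<in> atlas M" "d \<in> atlas M" "q \<in> fst c" "q \<in> fst d"
  shows "(coord_change c d has_derivative frechet_derivative (coord_change c d) (at (snd c q)))
           (at (snd c q))"
  using smooth_on_has_derivative[OF coord_change_smooth] assms by blast

text \<open>Transition maps form a cocycle near the image of \<open>q\<close>, hence so do their
  derivatives. This makes the chart chosen at each point, in which tangent vectors are stored,
  immaterial for fields read in another chart.\<close>

lemma coord_change_chain:
  assumes c: "c \<in> atlas M" "q \<in> fst c" and d: "d \<in> atlas M" "q \<in> fst d"
    and e: "e \<in> atlas M" "q \<in> fst e"
  shows "frechet_derivative (coord_change d e) (at (snd d q))
           (frechet_derivative (coord_change c d) (at (snd c q)) v) =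
         frechet_derivative (coord_change c e) (at (snd c q)) v"
proof -
  let ?O = "snd c ` ((fst d \<inter> fst e) \<inter> fst c)"
  have O: "open ?O" "snd c q \<in> ?O"
    using chart_image_open[OF c(1)] openin_chart d e c by blast+
  have eq: "coord_change d e (coord_change c d x) = coord_change c e x" if "x \<in> ?O" for x
    using that c d e by (auto simp: coord_change_def chart_inv_chart)
  have q: "coord_change c d (snd c q) = snd d q"
    using c d by (simp add: coord_change_def chart_inv_chart)
  have "((\<lambda>x. coord_change d e (coord_change c d x)) has_derivative
     (\<lambda>v. frechet_derivative (coord_change d e) (at (snd d q))
           (frechet_derivative (coord_change c d) (at (snd c q)) v))) (at (snd c q))"
    using has_derivative_compose[OF coord_change_has_derivative[of c d q]]
      coord_change_has_derivative[of d e q] assms q by metis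
  then have "(coord_change c e has_derivative
     (\<lambda>v. frechet_derivative (coord_change d e) (at (snd d q))
           (frechet_derivative (coord_change c d) (at (snd c q)) v))) (at (snd c q))"
    using has_derivative_transform_within_open O eq by blast
  then show ?thesis by (metis frechet_derivative_at)
qed

lemma coord_change_self:
  assumes "c \<in> atlas M" "q \<in> fst c"
  shows "frechet_derivative (coord_change c c) (at (snd c q)) v = v"
proof -
  have O: "open (snd c ` (fst c \<inter> fst c))" "snd c q \<in> snd c ` (fst c \<inter> fst c)"
    using coord_change_open[OF assms(1) assms(1)] assms by auto
  have "(coord_change c c has_derivative (\<lambda>v. v)) (at (snd c q))"
    by (rule has_derivative_transform_within_open[OF has_derivative_ident O])
      (use assms in \<open>auto simp: coord_change_def chart_inv_chart\<close>)
  then show ?thesis by (metis frechet_derivative_at)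
qed

text \<open>The witness is the field that is constant in the chart at \<open>p\<close>.\<close>

lemma vector_extends:
  assumes U: "openin (mtop M) U" and p: "p \<in> U"
  obtains V where "V \<subseteq> U" "p \<in> V" "openin (mtop M) V"
    "\<And>v. \<exists>X\<in>VF M V. X p = v"
proof
  define c where "c = chart_at M p"
  have ptop: "p \<in> topspace (mtop M)" using U p openin_subset by blast
  have c: "c \<in> atlas M" "p \<in> fst c"
    unfolding c_def using chart_at_props[OF ptop] by auto
  let ?V = "U \<inter> fst c"
  show V: "?V \<subseteq> U" "p \<in> ?V" "openin (mtop M) ?V"
    using U p c openin_chart[OF c(1)] by auto
  show "\<exists>X\<in>VF M ?V. X p = v" for v
  proof
    define X where
      "X = (\<lambda>q. frechet_derivative (coord_change c (chart_at M q)) (at (snd c q)) v)"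
    show "X p = v"
      unfolding X_def using coord_change_self[OF c] by (simp flip: c_def)
    have "smooth_on (vf_rep M d X) (snd d ` (?V \<inter> fst d))" if d: "d \<in> atlas M" for d
    proof -
      let ?R = "snd d ` (?V \<inter> fst d)"
      have R: "open ?R" using chart_image_open[OF d V(3)] .
      have S: "open (snd c ` (fst c \<inter> fst d))" using coord_change_open[OF c(1) d] .
      have img: "coord_change d c ` ?R \<subseteq> snd c ` (fst c \<inter> fst d)"
        using d by (auto simp: coord_change_def chart_inv_chart)
      have sm: "smooth_on (\<lambda>x. frechet_derivative (coord_change c d) (at (coord_change d c x)) v) ?R"
        by (rule smooth_on_compose[OF S R img smooth_on_frechet[OF coord_change_smooth[OF c(1) d]]])
          (rule smooth_on_subset[OF coord_change_smooth[OF d c(1)]], auto)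
      \<comment> \<open>\<open>X\<close> and \<open>vf_rep\<close> both pass through the chart
        chosen at \<open>q\<close>, which need not depend on \<open>q\<close> in any regular way;
        the chain rule cancels it.\<close>
      have eq: "vf_rep M d X x = frechet_derivative (coord_change c d) (at (coord_change d c x)) v"
        if x: "x \<in> ?R" for x
      proof -
        obtain q where q: "q \<in> ?V" "q \<in> fst d" "x = snd d q" using x by auto
        have "q \<in> topspace (mtop M)" using q(1) V(3) openin_subset by blast
        note cq = chart_at_props[OF this]
        show ?thesis
          using q c d coord_change_chain[OF c(1) _ cq d, of v]
          by (simp add: vf_rep_def vec_in_chart_def X_def coord_change_def[of d c] chart_inv_chart)
      qed
      show ?thesis by (subst smooth_on_cong[OF R eq]) (simp_all add: sm)
    qed
    then show "X \<in> VF M ?V" using V(3) by (simp add: VF_def)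
  qed
qed

text \<open>Serves the skew-symmetry of the covariant derivative of \<open>\<omega>\<close>. The two
  functions are related on \<open>V\<close> only, so the comparison of derivatives is made on an
  open chart image.\<close>

lemma dir_deriv_uminus:
  assumes "f \<in> CF M V" "p \<in> V" and g: "\<And>q. q \<in> V \<Longrightarrow> g q = - f q"
  shows "dir_deriv M p v g = - dir_deriv M p v f"
proof -
  have V: "openin (mtop M) V" using assms by (simp add: CF_def)
  then have p: "p \<in> topspace (mtop M)" using assms openin_subset by blast
  let ?c = "chart_at M p"
  note c = chart_at_props[OF p]
  let ?O = "snd ?c ` (V \<inter> fst ?c)"
  have O: "open ?O" "snd ?c p \<in> ?O"
    using chart_image_open[OF c(1) V] assms c by auto
  have "smooth_on (fun_rep ?c f) ?O" using assms c by (simp add: CF_def)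
  from has_derivative_minus[OF smooth_on_has_derivative[OF this O(2)]]
  have "(fun_rep ?c g has_derivative (\<lambda>v. - frechet_derivative (fun_rep ?c f) (at (snd ?c p)) v))
      (at (snd ?c p))"
    by (rule has_derivative_transform_within_open[OF _ O])
      (use c in \<open>auto simp: fun_rep_def chart_inv_chart g\<close>)
  then show ?thesis
    unfolding dir_deriv_def by (simp add: frechet_derivative_at[symmetric])
qed

end

section \<open>Skew-Hermitian quaternionic linear algebra\<close>

lemma sum_1_3: "(\<Sum>a=1..3. f a) = f 1 + f 2 + f (3::nat)"
proof -
  have "{1..3::nat} = {1, 2, 3}" by auto
  then show ?thesis by (simp add: add.assoc)
qed

lemmas bilinear_simps = bilinear_ladd bilinear_radd bilinear_lmul bilinear_rmul bilinear_lneg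
  bilinear_rneg bilinear_lsub bilinear_rsub bilinear_lzero bilinear_rzero

lemma lin_trace_comm:
  fixes f g :: "'a::euclidean_space \<Rightarrow> 'a"
  assumes "linear f" "linear g"
  shows "lin_trace (\<lambda>x. f (g x)) = lin_trace (\<lambda>x. g (f x))"
proof -
  have eq: "lin_trace (\<lambda>x. f (g x)) = (\<Sum>b\<in>Basis. \<Sum>c\<in>Basis. (g b \<bullet> c) * (f c \<bullet> b))"
    if "linear f" "linear g" for f g :: "'a \<Rightarrow> 'a"
  proof -
    have "f (g b) \<bullet> b = (\<Sum>c\<in>Basis. (g b \<bullet> c) * (f c \<bullet> b))" for b
      using arg_cong[OF euclidean_representation[of "g b"], of "\<lambda>u. f u \<bullet> b"] that
      by (simp add: linear_sum linear_scale inner_sum_left)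
    then show ?thesis by (simp add: lin_trace_def)
  qed
  show ?thesis
    unfolding eq[OF assms] eq[OF assms(2,1)]
    by (subst sum.swap) (simp add: mult.commute)
qed

lemma lin_trace_add: "lin_trace (\<lambda>x. f x + g x) = lin_trace f + lin_trace g"
  by (simp add: lin_trace_def inner_add_left sum.distrib)

lemma lin_trace_minus: "lin_trace (\<lambda>x. - f x) = - lin_trace f"
  by (simp add: lin_trace_def sum_negf)

lemma lin_trace_scaleR: "lin_trace (\<lambda>x. r *\<^sub>R f x) = r * lin_trace f"
  by (simp add: lin_trace_def sum_distrib_left)

section \<open>The algebra of \<open>J\<close> and \<open>w\<close> on one tangent space\<close>

locale skew_hermitian =
  fixes J :: "nat \<Rightarrow> 'a::euclidean_space \<Rightarrow> 'a" and w :: "'a \<Rightarrow> 'a \<Rightarrow> real"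
  assumes linear_J: "a \<in> {1..3} \<Longrightarrow> linear (J a)"
    and J_square: "a \<in> {1..3} \<Longrightarrow> J a (J a x) = - x"
    and J_12: "J 1 (J 2 x) = J 3 x" and J_21: "J 2 (J 1 x) = - J 3 x"
    and bilinear_w: "bilinear w" and w_skew: "w x y = - w y x"
    and w_nondegenerate: "(\<And>y. w x y = 0) \<Longrightarrow> x = 0"
    and w_J: "a \<in> {1..3} \<Longrightarrow> w (J a x) (J a y) = w x y"
begin

lemma linear_J123 [simp]: "linear (J 1)" "linear (J 2)" "linear (J 3)"
  using linear_J by auto

lemmas J_linear [simp] =
  linear_J123[THEN linear_add] linear_J123[THEN linear_scale] linear_J123[THEN linear_neg]
  linear_J123[THEN linear_diff] linear_J123[THEN linear_0]

lemma J_mult [simp]: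
  "J 1 (J 1 x) = - x" "J 2 (J 2 x) = - x" "J 3 (J 3 x) = - x"
  "J 1 (J 2 x) = J 3 x" "J 2 (J 1 x) = - J 3 x"
  "J 2 (J 3 x) = J 1 x" "J 3 (J 2 x) = - J 1 x"
  "J 3 (J 1 x) = J 2 x" "J 1 (J 3 x) = - J 2 x"
proof -
  have sq: "J 1 (J 1 x) = - x" "J 2 (J 2 x) = - x" "J 3 (J 3 x) = - x" for x
    using J_square by auto
  show "J 1 (J 1 x) = - x" "J 2 (J 2 x) = - x" "J 3 (J 3 x) = - x"
    "J 1 (J 2 x) = J 3 x" "J 2 (J 1 x) = - J 3 x"
    using sq J_12 J_21 by auto
  have c: "J 3 (J 2 x) = - J 1 x" for x using J_12[of "J 2 x"] sq(2)[of x] by simp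
  show "J 3 (J 2 x) = - J 1 x" by (fact c)
  have a: "J 2 (J 3 x) = J 1 x" for x
    using J_21[of "J 2 x"] c[of x] by (simp add: J_12)
  show "J 2 (J 3 x) = J 1 x" by (fact a)
  have b: "J 1 (J 3 x) = - J 2 x" for x using J_12[of x] sq(1)[of "J 2 x"] by simp
  show "J 1 (J 3 x) = - J 2 x" by (fact b)
  show "J 3 (J 1 x) = J 2 x" using J_12[of "J 1 x"] J_21[of x] b[of x] by simp
qed

lemmas w_linear [simp] = bilinear_simps[OF bilinear_w]

lemma w_J_left [simp]:
  "w (J 1 x) y = - w x (J 1 y)" "w (J 2 x) y = - w x (J 2 y)" "w (J 3 x) y = - w x (J 3 y)"
  using w_J[of 1 x "J 1 y"] w_J[of 2 x "J 2 y"] w_J[of 3 x "J 3 y"] by auto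

lemma w_sum_left: "w (\<Sum>i\<in>A. f i) y = (\<Sum>i\<in>A. w (f i) y)"
  using bilinear_w linear_sum[of "\<lambda>x. w x y"] by (simp add: bilinear_def)

lemma w_sum_right: "w y (\<Sum>i\<in>A. f i) = (\<Sum>i\<in>A. w y (f i))"
  using bilinear_w linear_sum[of "w y"] by (simp add: bilinear_def)

lemma w_eqI: "(\<And>z. w x z = w y z) \<Longrightarrow> x = y"
  using w_nondegenerate[of "x - y"] by simp

text \<open>By non-degeneracy the map sending \<open>z\<close> to the vector with coordinates
  \<open>w z b\<close> is injective, hence surjective in finite dimension. This legitimises the
  description operator in \<open>sharp\<close>.\<close>

lemma sharp_unique_existence:
  assumes "linear \<zeta>" shows "\<exists>!z. \<forall>y. w z y = \<zeta> y"
proof (rule ex_ex1I)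
  let ?f = "\<lambda>z. \<Sum>b\<in>Basis. w z b *\<^sub>R b"
  have "linear ?f"
    by (auto intro!: linearI simp: sum.distrib scaleR_add_left scaleR_sum_right)
  moreover have "inj ?f"
  proof (rule linear_injective_0[THEN iffD2, rule_format], fact)
    fix z assume "?f z = 0"
    then have "w z b = 0" if "b \<in> Basis" for b
      using inner_sum_left_Basis[OF that, of "w z"] by (simp only: inner_zero_left)
    then have "w z y = 0" for y
      using arg_cong[OF euclidean_representation[of y], of "w z"] by (simp add: w_sum_right)
    then show "z = 0" by (rule w_nondegenerate)
  qed
  ultimately have "surj ?f" by (rule linear_injective_imp_surjective) simp
  then obtain z where z: "(\<Sum>b\<in>Basis. \<zeta> b *\<^sub>R b) = ?f z" by (rule surjE)
  have "w z b = \<zeta> b" if "b \<in> Basis" for b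
    using arg_cong[OF z, of "\<lambda>u. u \<bullet> b"] by (simp only: inner_sum_left_Basis[OF that])
  then have "w z y = \<zeta> y" for y
    using arg_cong[OF euclidean_representation[of y], of "w z"]
      arg_cong[OF euclidean_representation[of y], of \<zeta>] assms
    by (simp add: w_sum_right linear_sum linear_scale)
  then show "\<exists>z. \<forall>y. w z y = \<zeta> y" by blast
next
  show "z = z'" if "\<forall>y. w z y = \<zeta> y" "\<forall>y. w z' y = \<zeta> y" for z z'
    using that by (intro w_eqI) simp
qed

lemma w_sharp: "linear \<zeta> \<Longrightarrow> w (sharp w \<zeta>) y = \<zeta> y"
  unfolding sharp_def using theI'[OF sharp_unique_existence] by blast

subsection \<open>Sums over a basis and its symplectic dual\<close>

text \<open>The Euclidean structure is auxiliary: \<open>w (dual b) y\<close> is the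
  \<open>b\<close>-coordinate of \<open>y\<close>, so the pairs (\<open>b\<close>,
  \<open>dual b\<close>) represent the inverse of \<open>w\<close>, and sums over them are
  basis-free contractions.\<close>

definition dual :: "'a \<Rightarrow> 'a" where
  "dual u = sharp w (\<lambda>y. u \<bullet> y)"

lemma w_dual [simp]: "w (dual u) y = u \<bullet> y"
  unfolding dual_def by (rule w_sharp) (simp add: bounded_linear.linear bounded_linear_inner_right)

lemma sum_w_dual: "(\<Sum>b\<in>Basis. w b x *\<^sub>R dual b) = - x"
proof (rule w_eqI)
  fix z
  have "w (\<Sum>b\<in>Basis. w b x *\<^sub>R dual b) z = (\<Sum>b\<in>Basis. (z \<bullet> b) * w b x)"
    by (simp add: w_sum_left inner_commute mult.commute)
  also have "\<dots> = w z x"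
    using arg_cong[OF euclidean_representation[of z], of "\<lambda>z. w z x"] by (simp add: w_sum_left)
  finally show "w (\<Sum>b\<in>Basis. w b x *\<^sub>R dual b) z = w (- x) z" using w_skew[of z x] by simp
qed

lemma sum_inner_basis: "(\<Sum>b\<in>Basis. (b \<bullet> x) *\<^sub>R b) = x"
  using euclidean_representation[of x] by (simp add: inner_commute)

lemma sum_dual_swap:
  fixes f :: "'a \<Rightarrow> 'a \<Rightarrow> 'b::real_vector"
  assumes f: "bilinear f"
  shows "(\<Sum>b\<in>Basis. f (dual b) b) = - (\<Sum>b\<in>Basis. f b (dual b))"
proof -
  have lin: "linear (f u)" "linear (\<lambda>x. f x u)" for u using f by (auto simp: bilinear_def)
  have 1: "f b (dual b) = (\<Sum>c\<in>Basis. (dual b \<bullet> c) *\<^sub>R f b c)" for b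
    using arg_cong[OF euclidean_representation[of "dual b"], of "f b"]
    by (simp add: linear_sum[OF lin(1)] linear_scale[OF lin(1)])
  have 2: "f (dual b) b = (\<Sum>c\<in>Basis. (dual b \<bullet> c) *\<^sub>R f c b)" for b
    using arg_cong[OF euclidean_representation[of "dual b"], of "\<lambda>x. f x b"]
    by (simp add: linear_sum[OF lin(2)] linear_scale[OF lin(2)])
  have skew: "dual b \<bullet> c = - (dual c \<bullet> b)" for b c
    using w_dual[of c "dual b"] w_dual[of b "dual c"] w_skew[of "dual b" "dual c"]
    by (simp add: inner_commute)
  show ?thesis
    unfolding 1 2 by (subst sum.swap, subst skew) (simp add: sum_negf)
qed

text \<open>Invariance of \<open>w\<close> under \<open>J a\<close> passes to its inverse. The
  coefficients of \<open>J a b\<close> are moved to the second slot, where the resulting vector is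
  recognised as \<open>dual c\<close> by testing it with \<open>w\<close>.\<close>

lemma sum_dual_J:
  fixes f :: "'a \<Rightarrow> 'a \<Rightarrow> 'b::real_vector"
  assumes f: "bilinear f" and a: "a \<in> {1..3}"
  shows "(\<Sum>b\<in>Basis. f (J a b) (J a (dual b))) = (\<Sum>b\<in>Basis. f b (dual b))"
proof -
  have lin: "linear (f u)" "linear (\<lambda>x. f x u)" for u using f by (auto simp: bilinear_def)
  note J = linear_J[OF a]
  have "f (J a b) (J a (dual b)) = (\<Sum>c\<in>Basis. f c ((J a b \<bullet> c) *\<^sub>R J a (dual b)))" for b
    using arg_cong[OF euclidean_representation[of "J a b"], of "\<lambda>x. f x (J a (dual b))"]
    by (simp add: linear_sum[OF lin(2)] linear_scale[OF lin(2)] linear_scale[OF lin(1)])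
  then have "(\<Sum>b\<in>Basis. f (J a b) (J a (dual b))) =
      (\<Sum>b\<in>Basis. \<Sum>c\<in>Basis. f c ((J a b \<bullet> c) *\<^sub>R J a (dual b)))" by simp
  also have "\<dots> = (\<Sum>c\<in>Basis. f c (\<Sum>b\<in>Basis. (J a b \<bullet> c) *\<^sub>R J a (dual b)))"
    by (subst sum.swap) (simp add: linear_sum[OF lin(1)])
  also have "\<dots> = (\<Sum>c\<in>Basis. f c (dual c))"
  proof (rule sum.cong[OF refl])
    fix c :: 'a
    have "w (\<Sum>b\<in>Basis. (J a b \<bullet> c) *\<^sub>R J a (dual b)) z = w (dual c) z" for z
    proof -
      have J_adj: "w (J a x) z = - w x (J a z)" for x z
        using w_J[OF a, of x "J a z"] J_square[OF a, of z] by simp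
      have "w (\<Sum>b\<in>Basis. (J a b \<bullet> c) *\<^sub>R J a (dual b)) z =
          - (\<Sum>b\<in>Basis. (J a z \<bullet> b) * (J a b \<bullet> c))"
        by (simp add: w_sum_left J_adj sum_negf inner_commute mult.commute)
      also have "\<dots> = - (J a (J a z) \<bullet> c)"
        using arg_cong[OF euclidean_representation[of "J a z"], of "\<lambda>x. J a x \<bullet> c"]
        by (simp add: linear_sum[OF J] linear_scale[OF J] inner_sum_left)
      also have "\<dots> = w (dual c) z" using J_square[OF a] by (simp add: inner_commute)
      finally show ?thesis .
    qed
    then have "(\<Sum>b\<in>Basis. (J a b \<bullet> c) *\<^sub>R J a (dual b)) = dual c" by (rule w_eqI)
    then show "f c (\<Sum>b\<in>Basis. (J a b \<bullet> c) *\<^sub>R J a (dual b)) = f c (dual c)" by simp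
  qed
  finally show ?thesis .
qed

text \<open>Exchanging each of the two contracted pairs costs a sign, and the signs cancel.\<close>

lemma sum_dual_swap2:
  fixes q :: "'a \<Rightarrow> 'a \<Rightarrow> 'a \<Rightarrow> 'a \<Rightarrow> 'b::real_vector"
  assumes "\<And>y v. bilinear (\<lambda>x u. q x y u v)" "\<And>x u. bilinear (\<lambda>y v. q x y u v)"
  shows "(\<Sum>b\<in>Basis. \<Sum>c\<in>Basis. q (dual b) (dual c) b c) =
    (\<Sum>b\<in>Basis. \<Sum>c\<in>Basis. q b c (dual b) (dual c))"
proof -
  have "(\<Sum>c\<in>Basis. q x (dual c) u c) = - (\<Sum>c\<in>Basis. q x c u (dual c))" for x u
    using sum_dual_swap[OF assms(2)[of x u]] .
  then have "(\<Sum>b\<in>Basis. \<Sum>c\<in>Basis. q (dual b) (dual c) b c) =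
      - (\<Sum>b\<in>Basis. \<Sum>c\<in>Basis. q (dual b) c b (dual c))" by (simp add: sum_negf)
  also have "\<dots> = - (\<Sum>c\<in>Basis. \<Sum>b\<in>Basis. q (dual b) c b (dual c))" by (subst sum.swap) simp
  also have "\<dots> = (\<Sum>c\<in>Basis. \<Sum>b\<in>Basis. q b c (dual b) (dual c))"
    using sum_dual_swap[OF assms(1)] by (simp add: sum_negf)
  also have "\<dots> = (\<Sum>b\<in>Basis. \<Sum>c\<in>Basis. q b c (dual b) (dual c))" by (rule sum.swap)
  finally show ?thesis .
qed

lemma lin_trace_dual: "linear L \<Longrightarrow> (\<Sum>b\<in>Basis. w b (L (dual b))) = - lin_trace L"
proof -
  assume L: "linear L"
  have "bilinear (\<lambda>u v. w u (L v))"
    using L by (auto simp: bilinear_def intro!: linearI simp: linear_add linear_scale)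
  from sum_dual_swap[OF this] show ?thesis
    by (simp add: lin_trace_def inner_commute)
qed

text \<open>Each \<open>J a\<close> is, up to the factor 2, a commutator of the other two.\<close>

lemma lin_trace_J [simp]: "lin_trace (J 1) = 0" "lin_trace (J 2) = 0" "lin_trace (J 3) = 0"
proof -
  have "lin_trace (\<lambda>x. J 2 (J 3 x)) = lin_trace (\<lambda>x. J 3 (J 2 x))" by (rule lin_trace_comm) auto
  then show "lin_trace (J 1) = 0" by (simp add: lin_trace_minus)
  have "lin_trace (\<lambda>x. J 3 (J 1 x)) = lin_trace (\<lambda>x. J 1 (J 3 x))" by (rule lin_trace_comm) auto
  then show "lin_trace (J 2) = 0" by (simp add: lin_trace_minus)
  have "lin_trace (\<lambda>x. J 1 (J 2 x)) = lin_trace (\<lambda>x. J 2 (J 1 x))" by (rule lin_trace_comm) auto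
  then show "lin_trace (J 3) = 0" by (simp add: lin_trace_minus)
qed


text \<open>Summing the rank-one map \<open>w u z *\<^sub>R v\<close> over the quaternion units
  makes it commute with every \<open>J a\<close>; the symmetrisation in \<open>so_op\<close> then
  makes it skew with respect to \<open>w\<close>.\<close>

definition so_half :: "'a \<Rightarrow> 'a \<Rightarrow> 'a \<Rightarrow> 'a" where
  "so_half u v z = w u z *\<^sub>R v + (\<Sum>a=1..3. w (J a u) z *\<^sub>R J a v)"

text \<open>These operators span \<open>\<s>\<o>\<^sup>*(2n)\<close>.\<close>

definition so_op :: "'a \<Rightarrow> 'a \<Rightarrow> 'a \<Rightarrow> 'a" where
  "so_op u v z = so_half u v z + so_half v u z"

lemmas so_op_expand = so_op_def so_half_def sum_1_3

lemma bilinear_so_op: "bilinear (\<lambda>u v. so_op u v z)"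
  by (auto simp: bilinear_def so_op_expand algebra_simps intro!: linearI)

lemma linear_so_op: "linear (so_op u v)"
  by (auto simp: so_op_expand algebra_simps intro!: linearI)

lemmas so_op_linear = linear_so_op[THEN linear_add] linear_so_op[THEN linear_diff]
  linear_so_op[THEN linear_neg] linear_so_op[THEN linear_scale] linear_so_op[THEN linear_sum]

lemma so_op_sym: "so_op u v z = so_op v u z"
  by (simp add: so_op_def)

lemma so_op_J: "a \<in> {1..3} \<Longrightarrow> so_op u v (J a z) = J a (so_op u v z)"
proof -
  assume "a \<in> {1..3}"
  then have "a = 1 \<or> a = 2 \<or> a = 3" by auto
  then show ?thesis by (auto simp: so_op_expand algebra_simps)
qed

lemma so_op_J_J: "a \<in> {1..3} \<Longrightarrow> so_op (J a u) (J a v) z = so_op u v z"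
proof -
  assume "a \<in> {1..3}"
  then have "a = 1 \<or> a = 2 \<or> a = 3" by auto
  then show ?thesis by (auto simp: so_op_expand algebra_simps)
qed

lemma w_J_sym: "w x (J 1 y) = w y (J 1 x)" "w x (J 2 y) = w y (J 2 x)" "w x (J 3 y) = w y (J 3 x)"
  using w_J_left[of y x] w_skew[of "J _ y" x] by auto

lemma w_so_op: "w (so_op u v z) y = - w z (so_op u v y)"
  by (simp add: so_op_expand algebra_simps w_skew[of z u] w_skew[of z v] w_J_sym[of z u] w_J_sym[of z v])

text \<open>\<open>so_op\<close> has eight summands, two halves with four quaternion units each. The
  symmetry of \<open>g\<close> and its invariance under the \<open>J a\<close> make all of them
  contribute the same contraction, whence the factor 8.\<close>

lemma sum_so_op_dual:
  fixes g :: "'a \<Rightarrow> 'a \<Rightarrow> 'a \<Rightarrow> 'b::real_vector"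
  assumes lin: "\<And>y z. linear (\<lambda>x. g x y z)" "\<And>x z. linear (\<lambda>y. g x y z)" "\<And>x y. linear (g x y)"
    and sym: "\<And>x y z. g x y z = g y x z"
    and inv: "\<And>a x y z. a \<in> {1..3} \<Longrightarrow> g (J a x) (J a y) z = g x y z"
  shows "(\<Sum>b\<in>Basis. \<Sum>c\<in>Basis. g b c (so_op (dual b) (dual c) x)) =
    8 *\<^sub>R (\<Sum>b\<in>Basis. g x b (dual b))"
proof -
  let ?r = "\<Sum>b\<in>Basis. g x b (dual b)"
  have g_sum: "(\<Sum>b\<in>Basis. (b \<bullet> u) *\<^sub>R g b y z) = g u y z" for u y z
    using arg_cong[OF sum_inner_basis[of u], of "\<lambda>x. g x y z"]
    by (simp add: linear_sum[OF lin(1)] linear_scale[OF lin(1)])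
  have one: "(\<Sum>b\<in>Basis. \<Sum>c\<in>Basis. w (dual b) x *\<^sub>R g b c (dual c)) = ?r"
    by (subst sum.swap) (simp add: g_sum)
  have Ja: "(\<Sum>b\<in>Basis. \<Sum>c\<in>Basis. w (J a (dual b)) x *\<^sub>R g b c (J a (dual c))) = ?r"
    if a: "a \<in> {1..3}" for a
  proof -
    have J_adj: "w (J a y) x = - w y (J a x)" for y
      using w_J[OF a, of y "J a x"] J_square[OF a, of x] by simp
    have "(\<Sum>b\<in>Basis. \<Sum>c\<in>Basis. w (J a (dual b)) x *\<^sub>R g b c (J a (dual c))) =
        - (\<Sum>c\<in>Basis. \<Sum>b\<in>Basis. (b \<bullet> J a x) *\<^sub>R g b c (J a (dual c)))"
      by (subst sum.swap) (simp add: J_adj sum_negf)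
    also have "\<dots> = - (\<Sum>c\<in>Basis. g (J a x) c (J a (dual c)))"
      by (simp add: g_sum)
    also have "\<dots> = - (\<Sum>c\<in>Basis. g (J a (J a x)) (J a c) (J a (dual c)))"
      by (simp add: inv[OF a])
    also have "\<dots> = (\<Sum>c\<in>Basis. g x (J a c) (J a (dual c)))"
      by (simp add: J_square[OF a] linear_neg[OF lin(1)] sum_negf)
    also have "\<dots> = ?r"
      by (rule sum_dual_J[OF _ a]) (simp add: bilinear_def lin)
    finally show ?thesis .
  qed
  have half: "(\<Sum>b\<in>Basis. \<Sum>c\<in>Basis. g b c (so_half (dual b) (dual c) x)) = 4 *\<^sub>R ?r"
  proof -
    have "(\<Sum>b\<in>Basis. \<Sum>c\<in>Basis. g b c (so_half (dual b) (dual c) x)) =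
      (\<Sum>b\<in>Basis. \<Sum>c\<in>Basis. w (dual b) x *\<^sub>R g b c (dual c)) +
      (\<Sum>b\<in>Basis. \<Sum>c\<in>Basis. w (J 1 (dual b)) x *\<^sub>R g b c (J 1 (dual c))) +
      (\<Sum>b\<in>Basis. \<Sum>c\<in>Basis. w (J 2 (dual b)) x *\<^sub>R g b c (J 2 (dual c))) +
      (\<Sum>b\<in>Basis. \<Sum>c\<in>Basis. w (J 3 (dual b)) x *\<^sub>R g b c (J 3 (dual c)))"
      by (simp only: so_half_def sum_1_3 linear_add[OF lin(3)] linear_scale[OF lin(3)]
          sum.distrib add.assoc)
    also have "\<dots> = ?r + ?r + ?r + ?r"
      using one Ja[of 1] Ja[of 2] Ja[of 3] by simp
    also have "\<dots> = (1 + 1 + 1 + 1) *\<^sub>R ?r" by (simp only: scaleR_add_left scaleR_one)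
    finally show ?thesis by simp
  qed
  have "(\<Sum>b\<in>Basis. \<Sum>c\<in>Basis. g b c (so_half (dual c) (dual b) x)) =
      (\<Sum>c\<in>Basis. \<Sum>b\<in>Basis. g c b (so_half (dual c) (dual b) x))"
    by (subst sum.swap) (simp add: sym)
  then have "(\<Sum>b\<in>Basis. \<Sum>c\<in>Basis. g b c (so_half (dual c) (dual b) x)) = 4 *\<^sub>R ?r"
    using half by simp
  with half show ?thesis
    by (simp add: so_op_def linear_add[OF lin(3)] sum.distrib flip: scaleR_add_left)
qed

text \<open>Half of the terms recombine through \<open>sum_w_dual\<close> into values of
  \<open>L\<close>; the other half contract \<open>L\<close> with the symplectic dual and leave
  traces. With \<open>L\<close> the identity this gives the Casimir constant, with \<open>L\<close>
  a partial evaluation of a torsion tensor the cross terms of \<open>casimir_S3\<close>.\<close>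

lemma w_sum_so_op_dual:
  assumes L: "linear L"
  shows "w (\<Sum>b\<in>Basis. so_op x b (L (dual b))) z = w (L z) x - (\<Sum>a=1..3. w (L (J a z)) (J a x))
    - lin_trace L * w x z + (\<Sum>a=1..3. lin_trace (\<lambda>y. J a (L y)) * w (J a x) z)"
proof -
  have wsum: "(\<Sum>b\<in>Basis. w b u *\<^sub>R w y (L (dual b))) = w (L u) y" for u y
  proof -
    have "w (L (\<Sum>b\<in>Basis. w b u *\<^sub>R dual b)) y = (\<Sum>b\<in>Basis. w b u *\<^sub>R w (L (dual b)) y)"
      by (simp add: linear_sum[OF L] linear_scale[OF L] w_sum_left)
    then show ?thesis
      by (simp add: sum_w_dual linear_neg[OF L] w_skew[of y] sum_negf)
  qed
  have J_trace: "(\<Sum>b\<in>Basis. w b (J a (L (dual b)))) = - lin_trace (\<lambda>y. J a (L y))"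
    if "a \<in> {1..3}" for a
    using lin_trace_dual[OF linear_compose[OF L linear_J[OF that]]] by (simp add: o_def)
  note J_trace' = J_trace[of 1] J_trace[of 2] J_trace[of 3]
  have 1: "w (\<Sum>b\<in>Basis. so_op x b (L (dual b))) z =
      (\<Sum>b\<in>Basis. w b z *\<^sub>R w x (L (dual b)))
    - (\<Sum>b\<in>Basis. w b (J 1 z) *\<^sub>R w (J 1 x) (L (dual b)))
    - (\<Sum>b\<in>Basis. w b (J 2 z) *\<^sub>R w (J 2 x) (L (dual b)))
    - (\<Sum>b\<in>Basis. w b (J 3 z) *\<^sub>R w (J 3 x) (L (dual b)))
    + (\<Sum>b\<in>Basis. w b (L (dual b))) * w x z
    - (\<Sum>b\<in>Basis. w b (J 1 (L (dual b)))) * w (J 1 x) z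
    - (\<Sum>b\<in>Basis. w b (J 2 (L (dual b)))) * w (J 2 x) z
    - (\<Sum>b\<in>Basis. w b (J 3 (L (dual b)))) * w (J 3 x) z"
    unfolding w_sum_left sum_distrib_right sum.distrib[symmetric] sum_subtractf[symmetric]
    by (rule sum.cong[OF refl]) (simp add: so_op_expand algebra_simps)
  show ?thesis
    unfolding 1 wsum lin_trace_dual[OF L] using J_trace' by (simp add: sum_1_3)
qed

text \<open>The scalar by which the Casimir element of so*(2n), normalised by \<open>so_op\<close>,
  acts on the tangent space; in real dimension 4n it is 8 (2 - 4n).\<close>

definition cas_const :: real where
  "cas_const = 8 * (2 - real DIM('a))"

lemma so_op_so_op_dual: "(\<Sum>b\<in>Basis. \<Sum>c\<in>Basis. so_op b c (so_op (dual b) (dual c) x)) = cas_const *\<^sub>R x"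
proof -
  have "(\<Sum>b\<in>Basis. \<Sum>c\<in>Basis. so_op b c (so_op (dual b) (dual c) x)) =
      8 *\<^sub>R (\<Sum>b\<in>Basis. so_op x b (dual b))"
    by (rule sum_so_op_dual)
      (use bilinear_so_op linear_so_op so_op_sym so_op_J_J in \<open>auto simp: bilinear_def\<close>)
  moreover have "(\<Sum>b\<in>Basis. so_op x b (dual b)) = (2 - real DIM('a)) *\<^sub>R x"
  proof (rule w_eqI)
    have id: "lin_trace (\<lambda>y::'a. y) = real DIM('a)" by (simp add: lin_trace_def)
    show "w (\<Sum>b\<in>Basis. so_op x b (dual b)) z = w ((2 - real DIM('a)) *\<^sub>R x) z" for z
      using w_sum_so_op_dual[of "\<lambda>y. y" x z] w_skew[of z x]
      by (simp add: id sum_1_3 algebra_simps linear_id[unfolded id_def])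
  qed
  ultimately show ?thesis by (simp add: cas_const_def)
qed

end

section \<open>Torsion tensors and Casimir operators\<close>

definition inf_act :: "('a::real_vector \<Rightarrow> 'a) \<Rightarrow> ('a \<Rightarrow> 'a \<Rightarrow> 'a) \<Rightarrow> 'a \<Rightarrow> 'a \<Rightarrow> 'a" where
  "inf_act D T x y = D (T x y) - T (D x) y - T x (D y)"

lemma inner_eqI: "(\<And>u. x \<bullet> u = y \<bullet> u) \<Longrightarrow> x = y" for x y :: "'a::real_inner"
  by (metis vector_eq_rdot)

lemma torsion_spaceD:
  assumes "T \<in> torsion_space"
  shows "bilinear T" "T x y = - T y x"
  using assms unfolding torsion_space_def by blast+

lemma torsion_spaceI: "bilinear T \<Longrightarrow> (\<And>x y. T x y = - T y x) \<Longrightarrow> T \<in> torsion_space"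
  unfolding torsion_space_def by blast

lemma inf_act_torsion: "linear D \<Longrightarrow> T \<in> torsion_space \<Longrightarrow> inf_act D T \<in> torsion_space"
proof -
  assume D: "linear D" and T: "T \<in> torsion_space"
  note [simp] = bilinear_simps[OF torsion_spaceD(1)[OF T]]
    linear_add[OF D] linear_diff[OF D] linear_scale[OF D]
  have "inf_act D T x y = - inf_act D T y x" for x y
    using torsion_spaceD(2)[OF T, of x y] torsion_spaceD(2)[OF T, of "D x" y]
      torsion_spaceD(2)[OF T, of x "D y"] linear_neg[OF D]
    by (simp add: inf_act_def)
  moreover have "bilinear (inf_act D T)"
    by (auto simp: bilinear_def inf_act_def algebra_simps intro!: linearI)
  ultimately show ?thesis by (intro torsion_spaceI)
qed

lemma torsion_add:
  assumes "S \<in> torsion_space" "T \<in> torsion_space"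
  shows "(\<lambda>x y. S x y + T x y) \<in> torsion_space"
proof -
  note [simp] = bilinear_simps[OF torsion_spaceD(1)[OF assms(1)]]
    bilinear_simps[OF torsion_spaceD(1)[OF assms(2)]]
  have "S x y + T x y = - (S y x + T y x)" for x y
    using torsion_spaceD(2)[OF assms(1), of x y] torsion_spaceD(2)[OF assms(2), of x y] by simp
  moreover have "bilinear (\<lambda>x y. S x y + T x y)"
    by (auto simp: bilinear_def algebra_simps intro!: linearI)
  ultimately show ?thesis by (intro torsion_spaceI)
qed

lemma torsion_scale:
  assumes "T \<in> torsion_space" shows "(\<lambda>x y. r *\<^sub>R T x y) \<in> torsion_space"
proof -
  note [simp] = bilinear_simps[OF torsion_spaceD(1)[OF assms]]
  have "r *\<^sub>R T x y = - (r *\<^sub>R T y x)" for x y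
    using torsion_spaceD(2)[OF assms, of x y] by simp
  moreover have "bilinear (\<lambda>x y. r *\<^sub>R T x y)"
    by (auto simp: bilinear_def algebra_simps intro!: linearI)
  ultimately show ?thesis by (intro torsion_spaceI)
qed

lemma torsion_zero: "(\<lambda>x y. 0) \<in> torsion_space"
  by (auto simp: torsion_space_def bilinear_def intro!: linearI)

lemma torsion_sum:
  assumes "finite I" "\<And>i. i \<in> I \<Longrightarrow> T i \<in> torsion_space"
  shows "(\<lambda>x y. \<Sum>i\<in>I. T i x y) \<in> torsion_space"
  using assms by (induction I) (auto intro: torsion_zero torsion_add)

context skew_hermitian
begin

text \<open>The generators \<open>so_op b c\<close> are paired with those built from the dual
  vectors. Being a double contraction, the operator does not depend on the basis.\<close>

definition casimir :: "('a \<Rightarrow> 'a \<Rightarrow> 'a) \<Rightarrow> 'a \<Rightarrow> 'a \<Rightarrow> 'a" where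
  "casimir T x y = (\<Sum>b\<in>Basis. \<Sum>c\<in>Basis.
     inf_act (so_op b c) (inf_act (so_op (dual b) (dual c)) T) x y)"

definition sp1_casimir :: "('a \<Rightarrow> 'a \<Rightarrow> 'a) \<Rightarrow> 'a \<Rightarrow> 'a \<Rightarrow> 'a" where
  "sp1_casimir T x y = (\<Sum>a=1..3. inf_act (J a) (inf_act (J a) T) x y)"

text \<open>Tensors of type \<open>S\<^sup>3H\<close> under \<open>Sp(1)\<close>: symmetric in each pair of the three factors \<open>H\<close>.\<close>

definition S3_type :: "('a \<Rightarrow> 'a \<Rightarrow> 'a) \<Rightarrow> bool" where
  "S3_type T \<longleftrightarrow> (\<forall>x y. (\<Sum>a=1..3. T (J a x) (J a y)) = - T x y) \<and>
     (\<forall>x y. (\<Sum>a=1..3. J a (T (J a x) y)) = T x y)"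

definition J_trace :: "('a \<Rightarrow> 'a \<Rightarrow> 'a) \<Rightarrow> nat \<Rightarrow> 'a \<Rightarrow> real" where
  "J_trace T a x = lin_trace (\<lambda>y. J a (T x y))"

definition alt_J :: "(nat \<Rightarrow> 'a \<Rightarrow> real) \<Rightarrow> 'a \<Rightarrow> 'a \<Rightarrow> 'a" where
  "alt_J \<tau> x y = (\<Sum>a=1..3. \<tau> a x *\<^sub>R J a y - \<tau> a y *\<^sub>R J a x)"

text \<open>Half of the cross terms of \<open>sp1_casimir\<close>; the squares of the three
  \<open>J a\<close> on three slots make up the -9 in \<open>sp1_casimir_eq\<close>. The same
  expression arises when Nijenhuis tensors are written in terms of the torsion of a connection with
  parallel \<open>J a\<close>, and this links the Casimir operator to the Obata condition.\<close>

definition sp1_defect :: "('a \<Rightarrow> 'a \<Rightarrow> 'a) \<Rightarrow> 'a \<Rightarrow> 'a \<Rightarrow> 'a" where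
  "sp1_defect T x y = (\<Sum>a=1..3. T (J a x) (J a y) - J a (T (J a x) y) - J a (T x (J a y)))"

lemma sp1_casimir_eq:
  assumes "bilinear T"
  shows "sp1_casimir T x y = 2 *\<^sub>R sp1_defect T x y - 9 *\<^sub>R T x y"
proof -
  show ?thesis
    by (rule inner_eqI) (simp add: sp1_casimir_def sp1_defect_def inf_act_def sum_1_3
        bilinear_simps[OF assms] inner_simps)
qed

text \<open>The transpositions of the three factors \<open>H\<close> act by \<open>f12 / 2\<close>, \<open>f13 / 2\<close>, \<open>f23 / 2\<close>; once
  their sum is \<open>3\<close>, each of them is the identity.\<close>

lemma S3_typeI:
  assumes T: "T \<in> torsion_space" and Q: "\<And>x y. sp1_defect T x y = - 3 *\<^sub>R T x y"
  shows "S3_type T"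
proof -
  note [simp] = bilinear_simps[OF torsion_spaceD(1)[OF T]]
  define f12 where "f12 R x y = R x y - (\<Sum>a=1..3. R (J a x) (J a y))"
    for R :: "'a \<Rightarrow> 'a \<Rightarrow> 'a" and x y
  define f13 where "f13 R x y = R x y + (\<Sum>a=1..3. J a (R (J a x) y))"
    for R :: "'a \<Rightarrow> 'a \<Rightarrow> 'a" and x y
  define f23 where "f23 R x y = R x y + (\<Sum>a=1..3. J a (R x (J a y)))"
    for R :: "'a \<Rightarrow> 'a \<Rightarrow> 'a" and x y
  note f_defs = f12_def f13_def f23_def sum_1_3
  have sum: "f23 T x y = 6 *\<^sub>R T x y - f12 T x y - f13 T x y" for x y
  proof -
    have "f12 T x y + f13 T x y + f23 T x y = 3 *\<^sub>R T x y - sp1_defect T x y"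
      by (rule inner_eqI) (simp add: f_defs sp1_defect_def inner_simps)
    also have "\<dots> = 6 *\<^sub>R T x y" by (simp add: Q flip: scaleR_add_left)
    finally show ?thesis by (simp add: algebra_simps)
  qed
  have sq: "f12 (f12 T) x y = 4 *\<^sub>R T x y" "f13 (f13 T) x y = 4 *\<^sub>R T x y" for x y
    by (rule inner_eqI, simp add: f_defs inner_simps)+
  have comp: "f12 (f13 T) x y = f13 (f23 T) x y" "f12 (f23 T) x y = f13 (f12 T) x y" for x y
    by (rule inner_eqI, simp add: f_defs inner_simps)+
  have f23: "f23 T = (\<lambda>x y. 6 *\<^sub>R T x y - f12 T x y - f13 T x y)" using sum by (intro ext)
  have lin: "f12 (\<lambda>x y. 6 *\<^sub>R T x y - R x y - S x y) x y = 6 *\<^sub>R f12 T x y - f12 R x y - f12 S x y"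
    "f13 (\<lambda>x y. 6 *\<^sub>R T x y - R x y - S x y) x y = 6 *\<^sub>R f13 T x y - f13 R x y - f13 S x y"
    for R S x y
    by (rule inner_eqI, simp add: f12_def f13_def sum_1_3 inner_simps)+
  \<comment> \<open>With the squares and \<open>f23\<close> inserted, the two relations in
    \<open>comp\<close> express the anticommutator of \<open>f12\<close> and \<open>f13\<close> as
    \<open>6 f13 - 4\<close> and as \<open>6 f12 - 4\<close>. Once the two maps agree, the
    anticommutator is 8 and \<open>f12\<close> is 2.\<close>
  have eq: "f12 T x y = f13 T x y" for x y
    using comp[of x y] unfolding f23 lin sq
    by (simp add: algebra_simps)
  then have eq': "f13 T = f12 T" by (intro ext) simp
  have "f12 T x y = 2 *\<^sub>R T x y" for x y
  proof -
    have "6 *\<^sub>R f12 T x y = 12 *\<^sub>R T x y"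
      using comp(2)[of x y] sq(2)[of x y] unfolding f23 lin sq eq'
      by (simp add: algebra_simps flip: scaleR_add_left)
    then have "(1/6) *\<^sub>R (6 *\<^sub>R f12 T x y) = (1/6) *\<^sub>R (12 *\<^sub>R T x y)" by simp
    then show ?thesis by simp
  qed
  then show ?thesis
    using eq unfolding S3_type_def f12_def f13_def
    by (simp add: scaleR_2 algebra_simps eq_neg_iff_add_eq_0)
qed

lemma S3_type_right:
  assumes "T \<in> torsion_space" "S3_type T"
  shows "(\<Sum>a=1..3. J a (T x (J a y))) = T x y"
proof -
  have "(\<Sum>a=1..3. J a (T (J a y) x)) = T y x" using assms(2) by (simp add: S3_type_def)
  moreover have sk: "T x u = - T u x" for u by (rule torsion_spaceD(2)[OF assms(1)])
  have "(\<Sum>a=1..3. J a (T x (J a y))) = - (\<Sum>a=1..3. J a (T (J a y) x))"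
    by (simp add: sk sum_1_3)
  ultimately show ?thesis by (simp add: sk)
qed

text \<open>When \<open>S3_type_right\<close> is traced, each of its three terms becomes minus the
  trace t of \<open>T x\<close>, so t = -3 t.\<close>

lemma S3_type_lin_trace:
  assumes "T \<in> torsion_space" "S3_type T"
  shows "lin_trace (T x) = 0"
proof -
  note [simp] = bilinear_simps[OF torsion_spaceD(1)[OF assms(1)]]
  have lin: "linear (T x)" using torsion_spaceD(1)[OF assms(1)] by (simp add: bilinear_def)
  have J: "lin_trace (\<lambda>y. J a (T x (J a y))) = - lin_trace (T x)" if a: "a \<in> {1..3}" for a
    using lin_trace_comm[OF linear_compose[OF lin linear_J[OF a]] linear_J[OF a]]
    by (simp add: J_square[OF a] lin_trace_minus)
  have "lin_trace (\<lambda>y. \<Sum>a=1..3. J a (T x (J a y))) = - 3 * lin_trace (T x)"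
    using J[of 1] J[of 2] J[of 3] by (simp add: sum_1_3 lin_trace_add)
  then show ?thesis by (simp add: S3_type_right[OF assms])
qed

text \<open>The source of the identity \<open>\<Sum> \<tau>\<^sub>a \<circ> J\<^sub>a = 0\<close>.
  Apply \<open>J 1\<close> to the first condition of \<open>S3_type\<close> at \<open>J 1 x\<close>
  and trace: by the quaternion relations the three terms become the trace of \<open>T x\<close>,
  which vanishes, \<open>J_trace T 3 (J 3 x)\<close> and \<open>J_trace T 2 (J 2 x)\<close>.\<close>

lemma S3_type_J_trace_relation:
  assumes "T \<in> torsion_space" "S3_type T"
  shows "J_trace T 1 (J 1 x) + J_trace T 2 (J 2 x) + J_trace T 3 (J 3 x) = 0"
proof -
  note [simp] = bilinear_simps[OF torsion_spaceD(1)[OF assms(1)]]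
  have lin: "linear (T x)" for x using torsion_spaceD(1)[OF assms(1)] by (simp add: bilinear_def)
  have comm: "lin_trace (\<lambda>y. J 1 (T x (J a y))) = lin_trace (\<lambda>y. J a (J 1 (T x y)))"
    if a: "a \<in> {1..3}" for a x
    using lin_trace_comm[OF linear_compose[OF lin linear_J[of 1]] linear_J[OF a]] by simp
  have "lin_trace (\<lambda>y. J 1 (\<Sum>a=1..3. T (J a (J 1 x)) (J a y))) = - J_trace T 1 (J 1 x)"
    using assms(2) by (simp add: S3_type_def J_trace_def lin_trace_minus)
  then have "lin_trace (\<lambda>y. J 1 (T (J 1 (J 1 x)) (J 1 y))) + lin_trace (\<lambda>y. J 1 (T (J 2 (J 1 x)) (J 2 y)))
     + lin_trace (\<lambda>y. J 1 (T (J 3 (J 1 x)) (J 3 y))) = - J_trace T 1 (J 1 x)"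
    by (simp only: sum_1_3 J_linear lin_trace_add)
  then show ?thesis
    unfolding comm[of 1, simplified] comm[of 2, simplified] comm[of 3, simplified]
    using S3_type_lin_trace[OF assms, of x]
    by (simp add: J_trace_def lin_trace_minus)
qed

text \<open>On a threefold tensor product the Casimir operator is the sum of the three single ones
  plus cross terms for the three pairs of slots. The cross terms are contractions evaluated by
  \<open>sum_so_op_dual\<close>; the S^3 type turns products with the \<open>J a\<close> back into
  \<open>T\<close>, and kills the plain trace and the contractions of the two arguments, so that
  besides \<open>T\<close> itself only \<open>J_trace\<close> survives.\<close>

lemma casimir_S3:
  assumes T: "T \<in> torsion_space" and S3: "S3_type T"
  shows "w (casimir T x y) z = 3 * cas_const * w (T x y) z
    + 32 * (w (T x y) z + w (T y z) x + w (T z x) y) - 16 * w (alt_J (J_trace T) x y) z"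
proof -
  note bil = torsion_spaceD(1)[OF T]
  note [simp] = bilinear_simps[OF bil] so_op_linear bilinear_simps[OF bilinear_so_op]
  have lin: "linear (T u)" "linear (\<lambda>v. T v u)" for u using bil by (simp_all add: bilinear_def)
  note T_sum = linear_sum[OF lin(1)] linear_sum[OF lin(2)]
  let ?S = "\<lambda>f. \<Sum>b\<in>Basis. \<Sum>c\<in>Basis. (f b c (dual b) (dual c) :: 'a)"
  let ?A = "\<lambda>L x. ?S (\<lambda>b c u v. so_op b c (L (so_op u v x)))"
  have swapA: "?S (\<lambda>b c u v. so_op u v (L (so_op b c x))) = ?A L x" if L: "linear L" for L x
    by (rule sum_dual_swap2)
      (use L in \<open>auto simp: bilinear_def linear_add linear_scale intro!: linearI\<close>)
  have A: "?A L x = 8 *\<^sub>R (\<Sum>b\<in>Basis. so_op x b (L (dual b)))" if L: "linear L" for L x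
    by (rule sum_so_op_dual)
      (use L so_op_sym so_op_J_J in \<open>auto simp: linear_add linear_scale intro!: linearI\<close>)
  have B: "?S (\<lambda>b c u v. T (so_op b c x) (so_op u v y)) = 8 *\<^sub>R (\<Sum>b\<in>Basis. T (so_op y b x) (dual b))" for x y
    by (rule sum_so_op_dual) (use so_op_sym so_op_J_J in \<open>auto intro!: linearI\<close>)
  have swapB: "?S (\<lambda>b c u v. T (so_op u v x) (so_op b c y)) = ?S (\<lambda>b c u v. T (so_op b c x) (so_op u v y))" for x y
    by (rule sum_dual_swap2) (auto simp: bilinear_def intro!: linearI)
  have C: "?A (\<lambda>x. x) x = cas_const *\<^sub>R x" for x using so_op_so_op_dual by simp
  have C': "?S (\<lambda>b c u v. so_op u v (so_op b c x)) = cas_const *\<^sub>R x" for x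
    using swapA[of "\<lambda>x. x" x] C by (simp add: linear_ident)
  have C2: "?S (\<lambda>b c u v. T x (so_op u v (so_op b c y))) = cas_const *\<^sub>R T x y"
      "?S (\<lambda>b c u v. T (so_op u v (so_op b c x)) y) = cas_const *\<^sub>R T x y" for x y
    using arg_cong[OF C'[of y], of "T x"] arg_cong[OF C'[of x], of "\<lambda>x. T x y"]
    by (simp_all add: T_sum)
  \<comment> \<open>Two derivations on three slots give nine terms: the three diagonal ones yield
    \<open>cas_const\<close> each, the six mixed ones agree in pairs by \<open>swapA\<close> and
    \<open>swapB\<close>.\<close>
  have "casimir T x y = ?A (\<lambda>x. x) (T x y)
      - ?A (\<lambda>u. T u y) x - ?A (T x) y
      - ?S (\<lambda>b c u v. so_op u v (T (so_op b c x) y)) + ?S (\<lambda>b c u v. T (so_op u v (so_op b c x)) y)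
      + ?S (\<lambda>b c u v. T (so_op b c x) (so_op u v y))
      - ?S (\<lambda>b c u v. so_op u v (T x (so_op b c y))) + ?S (\<lambda>b c u v. T (so_op u v x) (so_op b c y))
      + ?S (\<lambda>b c u v. T x (so_op u v (so_op b c y)))"
    unfolding sum.distrib[symmetric] sum_subtractf[symmetric] casimir_def
    by (intro sum.cong refl) (simp add: inf_act_def algebra_simps)
  also have "\<dots> = (3 * cas_const) *\<^sub>R T x y
      - 16 *\<^sub>R (\<Sum>b\<in>Basis. so_op x b (T (dual b) y)) - 16 *\<^sub>R (\<Sum>b\<in>Basis. so_op y b (T x (dual b)))
      + 16 *\<^sub>R (\<Sum>b\<in>Basis. T (so_op y b x) (dual b))"
    unfolding C C2 swapA[OF lin(1)] swapA[OF lin(2)] swapB A[OF lin(1)] A[OF lin(2)] B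
    by (rule inner_eqI) (simp add: inner_simps)
  finally have cas: "w (casimir T x y) z = 3 * cas_const * w (T x y) z
      - 16 * w (\<Sum>b\<in>Basis. so_op x b (T (dual b) y)) z - 16 * w (\<Sum>b\<in>Basis. so_op y b (T x (dual b))) z
      + 16 * w (\<Sum>b\<in>Basis. T (so_op y b x) (dual b)) z"
    by simp
  have skew: "T u v = - T v u" for u v by (rule torsion_spaceD(2)[OF T])
  have trl: "lin_trace (\<lambda>u. J a (T u y)) = - J_trace T a y" if "a \<in> {1..3}" for a
    unfolding J_trace_def using linear_neg[OF linear_J[OF that]]
    by (subst skew) (simp add: lin_trace_minus)
  have tr0: "lin_trace (\<lambda>u. T u y) = 0"
    using S3_type_lin_trace[OF T S3, of y] by (subst skew) (simp add: lin_trace_minus)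
  have m1: "(\<Sum>a=1..3. w (T (J a z) y) (J a x)) = - w (T z y) x"
  proof -
    have "T z y = (\<Sum>a=1..3. J a (T (J a z) y))" using S3 by (simp add: S3_type_def)
    then show ?thesis by (simp add: sum_1_3)
  qed
  have m2: "(\<Sum>a=1..3. w (T x (J a z)) (J a y)) = - w (T x z) y"
  proof -
    have "T x z = (\<Sum>a=1..3. J a (T x (J a z)))" using S3_type_right[OF T S3] by simp
    then show ?thesis by (simp add: sum_1_3)
  qed
  have t1: "w (\<Sum>b\<in>Basis. so_op x b (T (dual b) y)) z = 2 * w (T z y) x - (\<Sum>a=1..3. J_trace T a y * w (J a x) z)"
    unfolding w_sum_so_op_dual[OF lin(2)] m1 tr0 using trl[of 1] trl[of 2] trl[of 3]
    by (simp add: sum_1_3)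
  have t2: "w (\<Sum>b\<in>Basis. so_op y b (T x (dual b))) z = 2 * w (T x z) y + (\<Sum>a=1..3. J_trace T a x * w (J a y) z)"
    unfolding w_sum_so_op_dual[OF lin(1)] m2 S3_type_lin_trace[OF T S3]
    by (simp add: sum_1_3 J_trace_def)
  \<comment> \<open>Invariance of the contraction under \<open>J a\<close>, the skew-symmetry of
    \<open>T\<close> and that of the contraction together turn the sum into its negative.\<close>
  have contr: "(\<Sum>b\<in>Basis. T b (J a (dual b))) = 0" if a: "a \<in> {1..3}" for a
  proof -
    have lJ: "linear (\<lambda>v. T u (J a v))" for u
      using linear_compose[OF linear_J[OF a] lin(1)] by (simp add: o_def)
    have "(\<Sum>b\<in>Basis. T b (J a (dual b))) = (\<Sum>b\<in>Basis. T (J a b) (J a (J a (dual b))))"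
      by (rule sum_dual_J[OF _ a, symmetric]) (use lJ lin in \<open>simp add: bilinear_def\<close>)
    also have "\<dots> = (\<Sum>b\<in>Basis. T (dual b) (J a b))"
      by (subst skew) (simp add: J_square[OF a])
    also have "\<dots> = - (\<Sum>b\<in>Basis. T b (J a (dual b)))"
      by (rule sum_dual_swap) (use lJ lin in \<open>simp add: bilinear_def\<close>)
    finally have "2 *\<^sub>R (\<Sum>b\<in>Basis. T b (J a (dual b))) = 0"
      unfolding scaleR_2 by (rule eq_neg_iff_add_eq_0[THEN iffD1])
    then show ?thesis by simp
  qed
  have contrJ: "(\<Sum>b\<in>Basis. T (J a b) (dual b)) = 0" if a: "a \<in> {1..3}" for a
  proof -
    have lJ: "linear (\<lambda>v. T (J a v) u)" for u
      using linear_compose[OF linear_J[OF a] lin(2)] by (simp add: o_def)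
    have "(\<Sum>b\<in>Basis. T (J a b) (dual b)) = (\<Sum>b\<in>Basis. T (J a (J a b)) (J a (dual b)))"
      by (rule sum_dual_J[OF _ a, symmetric]) (use lJ lin in \<open>simp add: bilinear_def\<close>)
    then show ?thesis by (simp add: J_square[OF a] sum_negf contr[OF a])
  qed
  \<comment> \<open>Here the S^3 type is needed: by invariance its three terms have the same
    contraction, and their sum is minus that contraction.\<close>
  have contr0: "(\<Sum>b\<in>Basis. T b (dual b)) = 0"
  proof -
    have "(\<Sum>a=1..3. T (J a b) (J a (dual b))) = - T b (dual b)" for b
      using S3 by (simp add: S3_type_def)
    then have "- (\<Sum>b\<in>Basis. T b (dual b)) = (\<Sum>a=1..3. \<Sum>b\<in>Basis. T (J a b) (J a (dual b)))"
      by (subst sum.swap) (simp add: sum_negf)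
    also have "\<dots> = (\<Sum>b\<in>Basis. T b (dual b)) + (\<Sum>b\<in>Basis. T b (dual b)) + (\<Sum>b\<in>Basis. T b (dual b))"
      by (simp add: sum_1_3 sum_dual_J[OF bil])
    finally have "(1 + 1 + 1 + 1) *\<^sub>R (\<Sum>b\<in>Basis. T b (dual b)) = 0"
      unfolding scaleR_add_left scaleR_one by (metis add.left_inverse)
    then show ?thesis by simp
  qed
  have wT: "(\<Sum>b\<in>Basis. w b u *\<^sub>R T v (dual b)) = - T v u" for u v
    using arg_cong[OF sum_w_dual[of u], of "T v"]
    by (simp add: T_sum linear_scale[OF lin(1)])
  have "(\<Sum>b\<in>Basis. T (so_op y b x) (dual b)) =
      w y x *\<^sub>R (\<Sum>b\<in>Basis. T b (dual b)) + w (J 1 y) x *\<^sub>R (\<Sum>b\<in>Basis. T (J 1 b) (dual b))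
      + w (J 2 y) x *\<^sub>R (\<Sum>b\<in>Basis. T (J 2 b) (dual b)) + w (J 3 y) x *\<^sub>R (\<Sum>b\<in>Basis. T (J 3 b) (dual b))
      + ((\<Sum>b\<in>Basis. w b x *\<^sub>R T y (dual b)) - (\<Sum>b\<in>Basis. w b (J 1 x) *\<^sub>R T (J 1 y) (dual b))
      - (\<Sum>b\<in>Basis. w b (J 2 x) *\<^sub>R T (J 2 y) (dual b)) - (\<Sum>b\<in>Basis. w b (J 3 x) *\<^sub>R T (J 3 y) (dual b)))"
    unfolding scaleR_sum_right sum.distrib[symmetric] sum_subtractf[symmetric]
    by (rule sum.cong[OF refl]) (simp add: so_op_expand)
  also have "\<dots> = - T y x + (\<Sum>a=1..3. T (J a y) (J a x))"
    unfolding wT contr0 using contrJ[of 1] contrJ[of 2] contrJ[of 3] by (simp add: sum_1_3)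
  also have "\<dots> = 2 *\<^sub>R T x y"
    using S3 skew[of y x] by (simp add: S3_type_def scaleR_2)
  finally have t3: "w (\<Sum>b\<in>Basis. T (so_op y b x) (dual b)) z = 2 * w (T x y) z" by simp
  show ?thesis
    unfolding cas t1 t2 t3 using skew[of z y] skew[of x z]
    by (simp add: alt_J_def sum_1_3 algebra_simps)
qed

end

section \<open>From the groups to their Lie algebras\<close>

text \<open>With an arbitrary target, the same lemmas serve the values of \<open>P\<close> and those
  of \<open>\<Phi>\<close> after \<open>P\<close>. Linearity is asked on
  \<open>torsion_space\<close> only, since \<open>X6_projection\<close> says nothing about
  \<open>P\<close> elsewhere.\<close>

definition torsion_linear :: "(('a::real_vector \<Rightarrow> 'a \<Rightarrow> 'a) \<Rightarrow> 'b::real_vector) \<Rightarrow> bool" where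
  "torsion_linear f \<longleftrightarrow>
     (\<forall>S\<in>torsion_space. \<forall>T\<in>torsion_space. f (\<lambda>x y. S x y + T x y) = f S + f T) \<and>
     (\<forall>r. \<forall>T\<in>torsion_space. f (\<lambda>x y. r *\<^sub>R T x y) = r *\<^sub>R f T)"

lemma torsion_linear_add:
  "torsion_linear f \<Longrightarrow> S \<in> torsion_space \<Longrightarrow> T \<in> torsion_space \<Longrightarrow> f (\<lambda>x y. S x y + T x y) = f S + f T"
  by (simp add: torsion_linear_def)

lemma torsion_linear_scale:
  "torsion_linear f \<Longrightarrow> T \<in> torsion_space \<Longrightarrow> f (\<lambda>x y. r *\<^sub>R T x y) = r *\<^sub>R f T"
  by (simp add: torsion_linear_def)

lemma torsion_linear_zero: "torsion_linear f \<Longrightarrow> f (\<lambda>x y. 0) = 0"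
  using torsion_linear_scale[OF _ torsion_zero, of f 0] by simp

lemma torsion_linear_diff:
  assumes "torsion_linear f" "S \<in> torsion_space" "T \<in> torsion_space"
  shows "f (\<lambda>x y. S x y - T x y) = f S - f T"
  using torsion_linear_add[OF assms(1,2) torsion_scale[OF assms(3), of "-1"]]
    torsion_linear_scale[OF assms(1,3), of "-1"] by simp

lemma torsion_linear_sum:
  assumes "torsion_linear f" "finite I" "\<And>i. i \<in> I \<Longrightarrow> T i \<in> torsion_space"
  shows "f (\<lambda>x y. \<Sum>i\<in>I. T i x y) = (\<Sum>i\<in>I. f (T i))"
  using assms(2,3)
proof (induction I)
  case empty
  then show ?case using torsion_linear_zero[OF assms(1)] by simp
next
  case (insert i I)
  then show ?case
    using torsion_linear_add[OF assms(1), of "T i" "\<lambda>x y. \<Sum>i\<in>I. T i x y"] torsion_sum[of I T]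
    by simp
qed

lemma torsion_linear_sum_list:
  assumes "torsion_linear f" "\<And>r A. (r, A) \<in> set ps \<Longrightarrow> G A \<in> torsion_space"
  shows "(\<lambda>x y. \<Sum>(r, A)\<leftarrow>ps. r *\<^sub>R G A x y) \<in> torsion_space \<and>
    f (\<lambda>x y. \<Sum>(r, A)\<leftarrow>ps. r *\<^sub>R G A x y) = (\<Sum>(r, A)\<leftarrow>ps. r *\<^sub>R f (G A))"
  using assms(2)
proof (induction ps)
  case Nil
  then show ?case using torsion_linear_zero[OF assms(1)] torsion_zero by simp
next
  case (Cons p ps)
  obtain r A where p: "p = (r, A)" by fastforce
  have G: "G A \<in> torsion_space" using Cons.prems p by auto
  have IH: "(\<lambda>x y. \<Sum>(r, A)\<leftarrow>ps. r *\<^sub>R G A x y) \<in> torsion_space"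
     "f (\<lambda>x y. \<Sum>(r, A)\<leftarrow>ps. r *\<^sub>R G A x y) = (\<Sum>(r, A)\<leftarrow>ps. r *\<^sub>R f (G A))"
    using Cons by auto
  show ?case
    using torsion_linear_add[OF assms(1) torsion_scale[OF G] IH(1), of r]
      torsion_linear_scale[OF assms(1) G, of r] torsion_add[OF torsion_scale[OF G] IH(1), of r]
    by (simp add: p IH(2))
qed

section \<open>Rotations in Sp(1) along one quaternion unit\<close>

definition unit_q :: "nat \<Rightarrow> real" where
  "unit_q i = (if i = 0 then 1 else 0)"

definition rot_q :: "nat \<Rightarrow> real \<Rightarrow> real \<Rightarrow> nat \<Rightarrow> real" where
  "rot_q a c s i = (if i = 0 then c else if i = a then s else 0)"

lemma sum_0_3: "(\<Sum>a=0..3. f a) = f 0 + f 1 + f 2 + f (3::nat)"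
proof -
  have "{0..3::nat} = {0, 1, 2, 3}" by auto
  then show ?thesis by (simp add: add.assoc)
qed

lemma rot_q_Sp1: "a \<in> {1..3} \<Longrightarrow> c\<^sup>2 + s\<^sup>2 = 1 \<Longrightarrow> rot_q a c s \<in> Sp1"
proof -
  assume "a \<in> {1..3}" and cs: "c\<^sup>2 + s\<^sup>2 = 1"
  then have "a = 1 \<or> a = 2 \<or> a = 3" by auto
  with cs show ?thesis by (auto simp: Sp1_def rot_q_def sum_0_3)
qed

lemma unit_q_Sp1: "unit_q \<in> Sp1"
  by (simp add: Sp1_def unit_q_def sum_0_3)

lemma Sp1_tangent_unit: "Sp1_tangent J unit_q = id"
  by (auto simp: Sp1_tangent_def unit_q_def sum_1_3)

lemma Sp1_tangent_rot: "a \<in> {1..3} \<Longrightarrow> Sp1_tangent J (rot_q a c s) x = c *\<^sub>R x + s *\<^sub>R J a x"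
proof -
  assume "a \<in> {1..3}"
  then have "a = 1 \<or> a = 2 \<or> a = 3" by auto
  then show ?thesis by (auto simp: Sp1_tangent_def rot_q_def sum_1_3)
qed

text \<open>The infinitesimal action of \<open>\<s>\<p>(1)\<close> on \<open>\<bbbC>\<^sup>2\<close>, with the sign coming from the inverse in
  \<open>act_ES3H\<close>.\<close>

definition rC2 :: "nat \<Rightarrow> complex \<times> complex \<Rightarrow> complex \<times> complex" where
  "rC2 a = Sp1_C2 (rot_q a 0 (-1))"

lemma rC2_simps:
  "rC2 1 h = (- \<i> * fst h, \<i> * snd h)" "rC2 2 h = (- snd h, fst h)"
  "rC2 3 h = (- \<i> * snd h, - \<i> * fst h)"
  by (simp_all add: rC2_def Sp1_C2_def rot_q_def Let_def complex_eq_iff)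

lemma Sp1_C2_unit: "Sp1_C2 unit_q = id"
  by (rule ext) (simp add: Sp1_C2_def unit_q_def Let_def prod_eq_iff complex_eq_iff)

lemma Sp1_C2_rot_inv:
  assumes a: "a \<in> {1..3}" and cs: "c\<^sup>2 + s\<^sup>2 = 1"
  shows "inv (Sp1_C2 (rot_q a c s)) = (\<lambda>h. c *\<^sub>R h + s *\<^sub>R rC2 a h)"
proof (rule inv_equality)
  have a': "a = 1 \<or> a = 2 \<or> a = 3" using a by auto
  have cs': "c * (c * u) + s * (s * u) = u" "s * (s * u) + c * (c * u) = u" for u
    using cs by (simp_all add: power2_eq_square add.commute flip: distrib_right mult.assoc)
  show "c *\<^sub>R Sp1_C2 (rot_q a c s) h + s *\<^sub>R rC2 a (Sp1_C2 (rot_q a c s) h) = h" for h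
    using a'
    by (auto simp: cs' rC2_simps Sp1_C2_def rot_q_def Let_def complex_eq_iff prod_eq_iff algebra_simps)
  show "Sp1_C2 (rot_q a c s) (c *\<^sub>R h + s *\<^sub>R rC2 a h) = h" for h
    using a'
    by (auto simp: cs' rC2_simps Sp1_C2_def rot_q_def Let_def complex_eq_iff prod_eq_iff algebra_simps)
qed

context skew_hermitian
begin

lemma act_torsion_space:
  assumes g: "linear g" and g': "linear g'" "\<And>x. g' (g x) = x" "\<And>x. g (g' x) = x"
    and eq: "g = A \<circ> Sp1_tangent J q" and T: "T \<in> torsion_space"
  shows "act_torsion J A q T = (\<lambda>x y. g (T (g' x) (g' y)))" "act_torsion J A q T \<in> torsion_space"
proof -
  have "inv g = g'" using g'(2,3) by (intro inv_equality)
  then show act: "act_torsion J A q T = (\<lambda>x y. g (T (g' x) (g' y)))"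
    by (simp add: act_torsion_def eq[symmetric] Let_def)
  note [simp] = bilinear_simps[OF torsion_spaceD(1)[OF T]] linear_add[OF g] linear_scale[OF g]
    linear_add[OF g'(1)] linear_scale[OF g'(1)]
  show "act_torsion J A q T \<in> torsion_space"
  proof (rule torsion_spaceI)
    show "bilinear (act_torsion J A q T)"
      unfolding act by (auto simp: bilinear_def intro!: linearI)
    show "act_torsion J A q T x y = - act_torsion J A q T y x" for x y
      unfolding act by (subst torsion_spaceD(2)[OF T]) (simp add: linear_neg[OF g])
  qed
qed

text \<open>The group elements \<open>1 + a D + b D\<^sup>2\<close> with \<open>a\<^sup>2 = 2 b - b\<^sup>2 \<kappa>\<close> act polynomially. The odd part
  in \<open>a\<close>, divided by \<open>a\<close>, is a polynomial of degree 2 in \<open>b\<close> whose constant term is the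
  infinitesimal action; extrapolation from three values of \<open>b\<close> replaces the derivative.\<close>

lemma so_star_combination:
  assumes D: "linear D" and DJ: "\<And>a x. a \<in> {1..3} \<Longrightarrow> D (J a x) = J a (D x)"
    and Dw: "\<And>x y. w (D x) y = - w x (D y)" and D3: "\<And>x. D (D (D x)) = - \<kappa> *\<^sub>R D x" and "\<kappa> \<ge> 0"
  obtains ps where "\<And>r A. (r, A) \<in> set ps \<Longrightarrow> A \<in> SO_star J w"
    "\<And>x. D x = (\<Sum>(r, A)\<leftarrow>ps. r *\<^sub>R A x)"
    "\<And>T x y. T \<in> torsion_space \<Longrightarrow>
      inf_act D T x y = (\<Sum>(r, A)\<leftarrow>ps. r *\<^sub>R act_torsion J A unit_q T x y)"
    "\<And>r A T. (r, A) \<in> set ps \<Longrightarrow> T \<in> torsion_space \<Longrightarrow> act_torsion J A unit_q T \<in> torsion_space"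
proof -
  note [simp] = linear_add[OF D] linear_scale[OF D] linear_diff[OF D] linear_neg[OF D]
  \<comment> \<open>Small enough that \<open>b * \<kappa> < 2\<close> for \<open>b\<close> up to
    \<open>3 * \<beta>\<close>, so that the square roots \<open>\<alpha> b\<close> are real and
    nonzero at the three nodes.\<close>
  define \<beta> where "\<beta> = 1 / (3 * (\<kappa> + 1))"
  have "\<beta> > 0" using \<open>\<kappa> \<ge> 0\<close> by (simp add: \<beta>_def)
  define \<alpha> where "\<alpha> b = sqrt (2 * b - b\<^sup>2 * \<kappa>)" for b
  have pos: "2 * b - b\<^sup>2 * \<kappa> > 0" if "0 < b" "b \<le> 3 * \<beta>" for b
  proof -
    have "b * \<kappa> \<le> 3 * \<beta> * \<kappa>" using that \<open>\<kappa> \<ge> 0\<close> by (intro mult_right_mono)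
    also have "\<dots> < 2" using \<open>\<kappa> \<ge> 0\<close> by (simp add: \<beta>_def divide_simps)
    finally have "b * (2 - b * \<kappa>) > 0" using that by simp
    then show ?thesis by (simp add: power2_eq_square algebra_simps)
  qed
  define A where "A a b x = x + a *\<^sub>R D x + b *\<^sub>R D (D x)" for a b x
  have lin: "linear (A a b)" for a b
    by (auto simp: A_def algebra_simps intro!: linearI)
  have A_inv: "A a b (A (- a) b x) = x" if a: "a\<^sup>2 = 2 * b - b\<^sup>2 * \<kappa>" for a b x
  proof (rule inner_eqI)
    fix u
    have "A a b (A (- a) b x) \<bullet> u = x \<bullet> u + (2 * b - b\<^sup>2 * \<kappa> - a\<^sup>2) * (D (D x) \<bullet> u)"
      by (simp add: A_def D3 inner_simps power2_eq_square algebra_simps)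
    then show "A a b (A (- a) b x) \<bullet> u = x \<bullet> u" using a by simp
  qed
  have SO: "A a b \<in> SO_star J w" if a: "a\<^sup>2 = 2 * b - b\<^sup>2 * \<kappa>" for a b
  proof -
    have "A (- a) b (A a b x) = x" for x using A_inv[of "- a" b x] a by simp
    then have "bij (A a b)" using A_inv[OF a] by (intro o_bij[of "A (- a) b"]) (auto simp: fun_eq_iff)
    moreover have "A a b (J c x) = J c (A a b x)" if c: "c \<in> {1..3}" for c x
      using DJ[OF c] linear_add[OF linear_J[OF c]] linear_scale[OF linear_J[OF c]] by (simp add: A_def)
    moreover have "w (A a b x) y = w x (A (- a) b y)" for x y
      by (simp add: A_def Dw algebra_simps)
    then have "w (A a b x) (A a b y) = w x y" for x y
      using \<open>\<And>x. A (- a) b (A a b x) = x\<close> by simp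
    ultimately show ?thesis using lin by (simp add: SO_star_def)
  qed
  have act: "act_torsion J (A a b) unit_q T = (\<lambda>x y. A a b (T (A (- a) b x) (A (- a) b y)))"
    "act_torsion J (A a b) unit_q T \<in> torsion_space"
    if a: "a\<^sup>2 = 2 * b - b\<^sup>2 * \<kappa>" and T: "T \<in> torsion_space" for a b T
  proof -
    have eq: "A a b = A a b \<circ> Sp1_tangent J unit_q" by (simp add: Sp1_tangent_unit)
    have i: "A (- a) b (A a b x) = x" for x using A_inv[of "- a" b x] a by simp
    note * = act_torsion_space[OF lin lin i A_inv[OF a] eq T]
    show "act_torsion J (A a b) unit_q T = (\<lambda>x y. A a b (T (A (- a) b x) (A (- a) b y)))"
      "act_torsion J (A a b) unit_q T \<in> torsion_space" by (fact *)+
  qed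
  \<comment> \<open>Opposite signs of \<open>\<alpha>\<close> isolate the odd part. The weights 3,
    -3, 1 at \<open>\<beta>\<close>, \<open>2 * \<beta>\<close>, \<open>3 * \<beta>\<close> are
    those of Lagrange extrapolation to 0: they sum to 1 and annihilate \<open>b\<close> and its
    square.\<close>
  define ps where "ps = [(3 / (2 * \<alpha> \<beta>), A (\<alpha> \<beta>) \<beta>), (- (3 / (2 * \<alpha> \<beta>)), A (- \<alpha> \<beta>) \<beta>),
     (- 3 / (2 * \<alpha> (2 * \<beta>)), A (\<alpha> (2 * \<beta>)) (2 * \<beta>)), (- (- 3 / (2 * \<alpha> (2 * \<beta>))), A (- \<alpha> (2 * \<beta>)) (2 * \<beta>)),
     (1 / (2 * \<alpha> (3 * \<beta>)), A (\<alpha> (3 * \<beta>)) (3 * \<beta>)), (- (1 / (2 * \<alpha> (3 * \<beta>))), A (- \<alpha> (3 * \<beta>)) (3 * \<beta>))]"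
  have ps_sum: "(\<Sum>(r, A)\<leftarrow>ps. r *\<^sub>R G A) =
      ((3 / (2 * \<alpha> \<beta>)) *\<^sub>R G (A (\<alpha> \<beta>) \<beta>) + (- (3 / (2 * \<alpha> \<beta>))) *\<^sub>R G (A (- \<alpha> \<beta>) \<beta>))
    + ((- 3 / (2 * \<alpha> (2 * \<beta>))) *\<^sub>R G (A (\<alpha> (2 * \<beta>)) (2 * \<beta>))
      + (- (- 3 / (2 * \<alpha> (2 * \<beta>)))) *\<^sub>R G (A (- \<alpha> (2 * \<beta>)) (2 * \<beta>)))
    + ((1 / (2 * \<alpha> (3 * \<beta>))) *\<^sub>R G (A (\<alpha> (3 * \<beta>)) (3 * \<beta>))
      + (- (1 / (2 * \<alpha> (3 * \<beta>)))) *\<^sub>R G (A (- \<alpha> (3 * \<beta>)) (3 * \<beta>)))" for G :: "_ \<Rightarrow> 'a"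
    by (simp only: ps_def list.map sum_list.Cons sum_list.Nil prod.case add_0_right add.assoc)
  have \<beta>_mem: "\<beta> \<in> {\<beta>, 2 * \<beta>, 3 * \<beta>}" "2 * \<beta> \<in> {\<beta>, 2 * \<beta>, 3 * \<beta>}" "3 * \<beta> \<in> {\<beta>, 2 * \<beta>, 3 * \<beta>}"
    by auto
  have \<alpha>2: "(\<alpha> b)\<^sup>2 = 2 * b - b\<^sup>2 * \<kappa>" and \<alpha>0: "\<alpha> b > 0" if "b \<in> {\<beta>, 2 * \<beta>, 3 * \<beta>}" for b
    using pos[of b] that \<open>\<beta> > 0\<close> by (auto simp: \<alpha>_def)
  have mem: "\<exists>a b. B = A a b \<and> a\<^sup>2 = 2 * b - b\<^sup>2 * \<kappa>" if "(r, B) \<in> set ps" for r B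
  proof -
    have "\<exists>a' b'. A a b = A a' b' \<and> a'\<^sup>2 = 2 * b' - b'\<^sup>2 * \<kappa>" if "a\<^sup>2 = 2 * b - b\<^sup>2 * \<kappa>" for a b
      using that by blast
    note ex = this[of "\<alpha> b" b for b] this[of "- \<alpha> b" b for b]
    show ?thesis
      using that ex[of \<beta>] ex[of "2 * \<beta>"] ex[of "3 * \<beta>"] \<alpha>2[of \<beta>] \<alpha>2[of "2 * \<beta>"] \<alpha>2[of "3 * \<beta>"]
      unfolding ps_def set_simps insert_iff empty_iff prod.inject power2_minus
      by (elim disjE conjE FalseE; simp only:) simp_all
  qed
  show ?thesis
  proof (rule that)
    show "B \<in> SO_star J w" if "(r, B) \<in> set ps" for r B
      using mem[OF that] SO by auto
    show "act_torsion J B unit_q T \<in> torsion_space" if "(r, B) \<in> set ps" "T \<in> torsion_space" for r B T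
      using mem[OF that(1)] act(2) that(2) by auto
    have odd: "(r / (2 * \<alpha> b)) *\<^sub>R A (\<alpha> b) b x + (- (r / (2 * \<alpha> b))) *\<^sub>R A (- \<alpha> b) b x = r *\<^sub>R D x"
      if "b \<in> {\<beta>, 2 * \<beta>, 3 * \<beta>}" for r b x
    proof -
      have "A (\<alpha> b) b x - A (- \<alpha> b) b x = (2 * \<alpha> b) *\<^sub>R D x"
        by (rule inner_eqI) (simp add: A_def inner_simps algebra_simps)
      then have "(r / (2 * \<alpha> b)) *\<^sub>R (A (\<alpha> b) b x - A (- \<alpha> b) b x) = r *\<^sub>R D x"
        using \<alpha>0[OF that] by simp
      then show ?thesis by (simp add: scaleR_diff_right)
    qed
    show "D x = (\<Sum>(r, A)\<leftarrow>ps. r *\<^sub>R A x)" for x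
    proof -
      have "(\<Sum>(r, A)\<leftarrow>ps. r *\<^sub>R A x) = 3 *\<^sub>R D x + (- 3) *\<^sub>R D x + 1 *\<^sub>R D x"
        unfolding ps_sum[of "\<lambda>A. A x"] odd[OF \<beta>_mem(1)] odd[OF \<beta>_mem(2)] odd[OF \<beta>_mem(3)] ..
      then show ?thesis by simp
    qed
    show "inf_act D T x y = (\<Sum>(r, A)\<leftarrow>ps. r *\<^sub>R act_torsion J A unit_q T x y)"
      if T: "T \<in> torsion_space" for T x y
    proof -
      note [simp] = bilinear_simps[OF torsion_spaceD(1)[OF T]]
      \<comment> \<open>\<open>X\<close> and \<open>Y\<close> are the coefficients of
        \<open>b\<close> and its square in the odd part divided by \<open>a\<close>. Replacing
        \<open>a\<^sup>2\<close> by \<open>2 * b - b\<^sup>2 * \<kappa>\<close> in the term cubic in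
        \<open>a\<close> produces their summands with \<open>D (T (D x) (D y))\<close>.\<close>
      define X where "X = D (T (D (D x)) y) + D (T x (D (D y))) - D (D (T (D x) y)) - T (D x) (D (D y))
        - D (D (T x (D y))) - T (D (D x)) (D y) + 2 *\<^sub>R D (T (D x) (D y))"
      define Y where "Y = D (T (D (D x)) (D (D y))) - D (D (T (D x) (D (D y)))) - D (D (T (D (D x)) (D y)))
        - \<kappa> *\<^sub>R D (T (D x) (D y))"
      have odd: "(r / (2 * \<alpha> b)) *\<^sub>R act_torsion J (A (\<alpha> b) b) unit_q T x y
        + (- (r / (2 * \<alpha> b))) *\<^sub>R act_torsion J (A (- \<alpha> b) b) unit_q T x y =
        r *\<^sub>R inf_act D T x y + (r * b) *\<^sub>R X + (r * b\<^sup>2) *\<^sub>R Y"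
        if b: "b \<in> {\<beta>, 2 * \<beta>, 3 * \<beta>}" for r b
      proof (rule inner_eqI)
        fix u
        let ?a = "\<alpha> b"
        have e1: "A a b (T (A (- a) b x) (A (- a) b y)) \<bullet> u - A (- a) b (T (A a b x) (A a b y)) \<bullet> u =
          2 * a * ((inf_act D T x y + b *\<^sub>R X + b\<^sup>2 *\<^sub>R Y) \<bullet> u
             + (a\<^sup>2 - (2 * b - b\<^sup>2 * \<kappa>)) * (D (T (D x) (D y)) \<bullet> u))" for a
          by (simp add: A_def X_def Y_def inf_act_def inner_simps power2_eq_square algebra_simps)
        have a: "?a\<^sup>2 = 2 * b - b\<^sup>2 * \<kappa>" "?a \<noteq> 0" using \<alpha>2[OF b] \<alpha>0[OF b] by auto
        have e2: "A ?a b (T (A (- ?a) b x) (A (- ?a) b y)) \<bullet> u - A (- ?a) b (T (A ?a b x) (A ?a b y)) \<bullet> u =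
          2 * ?a * ((inf_act D T x y + b *\<^sub>R X + b\<^sup>2 *\<^sub>R Y) \<bullet> u)"
          using e1[of ?a] a(1) by simp
        have "((r / (2 * ?a)) *\<^sub>R act_torsion J (A ?a b) unit_q T x y
        + (- (r / (2 * ?a))) *\<^sub>R act_torsion J (A (- ?a) b) unit_q T x y) \<bullet> u =
          (r / (2 * ?a)) * (A ?a b (T (A (- ?a) b x) (A (- ?a) b y)) \<bullet> u - A (- ?a) b (T (A ?a b x) (A ?a b y)) \<bullet> u)"
          using act(1)[OF a(1) T] act(1)[of "- ?a" b, OF _ T] a(1)
          by (simp add: inner_add_left inner_diff_left right_diff_distrib)
        also have "\<dots> = (r *\<^sub>R inf_act D T x y + (r * b) *\<^sub>R X + (r * b\<^sup>2) *\<^sub>R Y) \<bullet> u"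
          unfolding e2 using a(2) by (simp add: inner_simps algebra_simps)
        finally show "((r / (2 * ?a)) *\<^sub>R act_torsion J (A ?a b) unit_q T x y
        + (- (r / (2 * ?a))) *\<^sub>R act_torsion J (A (- ?a) b) unit_q T x y) \<bullet> u =
          (r *\<^sub>R inf_act D T x y + (r * b) *\<^sub>R X + (r * b\<^sup>2) *\<^sub>R Y) \<bullet> u" .
      qed
      have "(\<Sum>(r, A)\<leftarrow>ps. r *\<^sub>R act_torsion J A unit_q T x y) =
        (3 *\<^sub>R inf_act D T x y + (3 * \<beta>) *\<^sub>R X + (3 * \<beta>\<^sup>2) *\<^sub>R Y)
        + ((- 3) *\<^sub>R inf_act D T x y + ((- 3) * (2 * \<beta>)) *\<^sub>R X + ((- 3) * (2 * \<beta>)\<^sup>2) *\<^sub>R Y)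
        + (1 *\<^sub>R inf_act D T x y + (1 * (3 * \<beta>)) *\<^sub>R X + (1 * (3 * \<beta>)\<^sup>2) *\<^sub>R Y)"
        unfolding ps_sum[of "\<lambda>A. act_torsion J A unit_q T x y"]
          odd[OF \<beta>_mem(1)] odd[OF \<beta>_mem(2)] odd[OF \<beta>_mem(3)] ..
      also have "\<dots> = inf_act D T x y"
        by (rule inner_eqI) (simp add: inner_simps power2_eq_square algebra_simps)
      finally show ?thesis by simp
    qed
  qed
qed

end

section \<open>The representation \<open>[E \<otimes> S\<^sup>3H]\<close>\<close>

context skew_hermitian
begin

text \<open>The image of \<open>so_op u u\<close> lies in the quaternionic line through
  \<open>u\<close>. The operator commutes with the \<open>J a\<close> and sends \<open>u\<close> to
  an imaginary quaternion times \<open>u\<close>, so on this line its square is minus the squared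
  norm of that quaternion. This is the cubic relation required by
  \<open>so_star_combination\<close>; the remaining generators follow by polarisation.\<close>

lemma so_op_diag_cube:
  "so_op u u (so_op u u (so_op u u z)) = - (4 * ((w (J 1 u) u)\<^sup>2 + (w (J 2 u) u)\<^sup>2 + (w (J 3 u) u)\<^sup>2)) *\<^sub>R so_op u u z"
    (is "_ = - ?\<kappa> *\<^sub>R _")
proof -
  have wuu: "w u u = 0" using w_skew[of u u] by simp
  have J_so_op: "so_op u u (J 1 z) = J 1 (so_op u u z)" "so_op u u (J 2 z) = J 2 (so_op u u z)"
    "so_op u u (J 3 z) = J 3 (so_op u u z)" for z
    using so_op_J by auto
  have Du: "so_op u u u = 2 *\<^sub>R (w (J 1 u) u *\<^sub>R J 1 u + w (J 2 u) u *\<^sub>R J 2 u + w (J 3 u) u *\<^sub>R J 3 u)"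
    by (rule inner_eqI) (simp add: so_op_expand wuu inner_simps)
  have "so_op u u (so_op u u u) = 2 *\<^sub>R (w (J 1 u) u *\<^sub>R J 1 (so_op u u u) + w (J 2 u) u *\<^sub>R J 2 (so_op u u u)
      + w (J 3 u) u *\<^sub>R J 3 (so_op u u u))"
    using arg_cong[OF Du, of "so_op u u"] by (simp only: so_op_linear J_so_op)
  also have "\<dots> = - ?\<kappa> *\<^sub>R u"
    unfolding Du by (rule inner_eqI) (simp add: inner_simps power2_eq_square algebra_simps)
  finally have DDu: "so_op u u (so_op u u u) = - ?\<kappa> *\<^sub>R u" .
  have z1: "so_op u u z = 2 *\<^sub>R (w u z *\<^sub>R u + w (J 1 u) z *\<^sub>R J 1 u + w (J 2 u) z *\<^sub>R J 2 u + w (J 3 u) z *\<^sub>R J 3 u)"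
    by (rule inner_eqI) (simp add: so_op_expand inner_simps)
  have z2: "so_op u u (so_op u u (2 *\<^sub>R (p *\<^sub>R u + q *\<^sub>R J 1 u + r *\<^sub>R J 2 u + s *\<^sub>R J 3 u))) =
      - ?\<kappa> *\<^sub>R (2 *\<^sub>R (p *\<^sub>R u + q *\<^sub>R J 1 u + r *\<^sub>R J 2 u + s *\<^sub>R J 3 u))" for p q r s
    by (simp only: so_op_linear J_so_op DDu J_linear scaleR_add_right scaleR_left_commute)
  show ?thesis by (simp only: z1 z2)
qed

lemma so_op_diag_combination:
  obtains ps where "\<And>r A. (r, A) \<in> set ps \<Longrightarrow> A \<in> SO_star J w"
    "\<And>x. so_op u u x = (\<Sum>(r, A)\<leftarrow>ps. r *\<^sub>R A x)"
    "\<And>T x y. T \<in> torsion_space \<Longrightarrow>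
      inf_act (so_op u u) T x y = (\<Sum>(r, A)\<leftarrow>ps. r *\<^sub>R act_torsion J A unit_q T x y)"
    "\<And>r A T. (r, A) \<in> set ps \<Longrightarrow> T \<in> torsion_space \<Longrightarrow> act_torsion J A unit_q T \<in> torsion_space"
proof -
  have nonneg: "4 * ((w (J 1 u) u)\<^sup>2 + (w (J 2 u) u)\<^sup>2 + (w (J 3 u) u)\<^sup>2) \<ge> 0"
    by (intro mult_nonneg_nonneg add_nonneg_nonneg) auto
  show ?thesis
  proof (rule so_star_combination[OF linear_so_op _ w_so_op so_op_diag_cube nonneg])
    show "so_op u u (J a x) = J a (so_op u u x)" if "a \<in> {1..3}" for a x by (rule so_op_J[OF that])
  qed (rule that; assumption)
qed

lemma so_op_polarize: "so_op u v x = (1/2) *\<^sub>R (so_op (u + v) (u + v) x - so_op u u x - so_op v v x)"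
proof -
  have "so_op (u + v) (u + v) x - so_op u u x - so_op v v x = 2 *\<^sub>R so_op u v x"
    using so_op_sym[of u v x] by (simp add: bilinear_simps[OF bilinear_so_op] scaleR_2)
  then show ?thesis by simp
qed

lemma inf_act_so_op_polarize:
  assumes "T \<in> torsion_space"
  shows "inf_act (so_op u v) T = (\<lambda>x y. (1/2) *\<^sub>R
    (inf_act (so_op (u + v) (u + v)) T x y - inf_act (so_op u u) T x y - inf_act (so_op v v) T x y))"
proof (rule ext, rule ext, rule inner_eqI)
  note [simp] = bilinear_simps[OF torsion_spaceD(1)[OF assms]]
  fix x y z
  show "inf_act (so_op u v) T x y \<bullet> z = (1/2) *\<^sub>R
    (inf_act (so_op (u + v) (u + v)) T x y - inf_act (so_op u u) T x y - inf_act (so_op v v) T x y) \<bullet> z"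
    unfolding inf_act_def so_op_polarize[of u v]
    by (simp only: bilinear_simps[OF torsion_spaceD(1)[OF assms]] inner_simps) (simp add: field_simps)
qed

lemma torsion_linear_so_op:
  assumes f: "torsion_linear f" and T: "T \<in> torsion_space"
    and diag: "\<And>u. f (inf_act (so_op u u) T) = g u u" and "\<And>u v. g u v = (1/2) *\<^sub>R (g (u + v) (u + v) - g u u - g v v)"
  shows "f (inf_act (so_op u v) T) = g u v"
proof -
  note tor = inf_act_torsion[OF linear_so_op T]
  have diff: "(\<lambda>x y. S x y - S' x y) \<in> torsion_space" if "S \<in> torsion_space" "S' \<in> torsion_space"
    for S S' :: "'a \<Rightarrow> 'a \<Rightarrow> 'a"
    using torsion_add[OF that(1) torsion_scale[OF that(2), of "-1"]] by simp
  show ?thesis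
    unfolding inf_act_so_op_polarize[OF T, of u v] assms(4)[of u v]
    by (simp add: torsion_linear_scale[OF f diff[OF diff[OF tor tor] tor]]
        torsion_linear_diff[OF f diff[OF tor tor] tor] torsion_linear_diff[OF f tor tor] diag)
qed

section \<open>Symmetric trilinear maps as a model of E \<otimes> S^3 H\<close>

lemma C_mult_simps:
  "C_mult J z (x + y) = C_mult J z x + C_mult J z y"
  "C_mult J (z + z') x = C_mult J z x + C_mult J z' x"
  "C_mult J z (C_mult J z' x) = C_mult J (z * z') x"
  "C_mult J 1 x = x" "C_mult J 0 x = 0" "C_mult J z 0 = 0"
  "C_mult J z (- x) = - C_mult J z x" "C_mult J (- z) x = - C_mult J z x"
  "C_mult J z (r *\<^sub>R x) = r *\<^sub>R C_mult J z x"
  "J 2 (C_mult J z x) = C_mult J (cnj z) (J 2 x)"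
  by (rule inner_eqI, simp add: C_mult_def inner_simps algebra_simps)+

lemma ES3H_simps:
  assumes t: "t \<in> ES3H J"
  shows "t (h + h') k l = t h k l + t h' k l" "t h (k + k') l = t h k l + t h k' l"
    "t h k (l + l') = t h k l + t h k l'"
    "t (r *\<^sub>R h) k l = r *\<^sub>R t h k l" "t h (r *\<^sub>R k) l = r *\<^sub>R t h k l" "t h k (r *\<^sub>R l) = r *\<^sub>R t h k l"
    "t (- h) k l = - t h k l" "t h (- k) l = - t h k l" "t h k (- l) = - t h k l"
    "t (z * fst h, z * snd h) k l = C_mult J z (t h k l)"
    "t h (z * fst k, z * snd k) l = C_mult J z (t h k l)"
    "t (h - h') k l = t h k l - t h' k l" "t h (k - k') l = t h k l - t h k' l"
    "t h k (l - l') = t h k l - t h k l'"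
proof -
  have add: "t (h + h') k l = t h k l + t h' k l" and C: "t (z * fst h, z * snd h) k l = C_mult J z (t h k l)"
    and s1: "t h k l = t k h l" and s2: "t h k l = t h l k" for h h' k l z
    using t unfolding ES3H_def by blast+
  have sc: "t (r *\<^sub>R h) k l = r *\<^sub>R t h k l" for r h k l
  proof -
    have "r *\<^sub>R h = (of_real r * fst h, of_real r * snd h)"
      by (simp add: prod_eq_iff scaleR_conv_of_real)
    then show ?thesis using C[of "of_real r" h k l] by (simp add: C_mult_def)
  qed
  show "t (h + h') k l = t h k l + t h' k l" "t (z * fst h, z * snd h) k l = C_mult J z (t h k l)"
    "t (r *\<^sub>R h) k l = r *\<^sub>R t h k l" by (fact add C sc)+
  have add2: "t h (k + k') l = t h k l + t h k' l" for h k k' l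
    using add[of k k' h l] s1[of h k l] s1[of h k' l] s1[of h "k + k'" l] by simp
  then show "t h (k + k') l = t h k l + t h k' l" .
  show "t h (r *\<^sub>R k) l = r *\<^sub>R t h k l"
    using sc[of r k h l] s1[of h k l] s1[of h "r *\<^sub>R k" l] by simp
  show "t h (z * fst k, z * snd k) l = C_mult J z (t h k l)"
    using C[of z k h l] s1[of h k l] s1[of h "(z * fst k, z * snd k)" l] by simp
  have s3: "t h k l = t l k h" for h k l
    using s1[of h k l] s2[of k h l] s1[of k l h] by simp
  have add3: "t h k (l + l') = t h k l + t h k l'" for h k l l'
    using add[of l l' k h] s3[of h k l] s3[of h k l'] s3[of h k "l + l'"] by simp
  then show "t h k (l + l') = t h k l + t h k l'" .
  show "t (h - h') k l = t h k l - t h' k l" using add[of "h - h'" h' k l] by simp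
  show "t h (k - k') l = t h k l - t h k' l" using add2[of h "k - k'" k' l] by simp
  show "t h k (l - l') = t h k l - t h k l'" using add3[of h k "l - l'" l'] by simp
  have sc3: "t h k (r *\<^sub>R l) = r *\<^sub>R t h k l" for h k r l
    using sc[of r l k h] s3[of h k l] s3[of h k "r *\<^sub>R l"] by simp
  then show "t h k (r *\<^sub>R l) = r *\<^sub>R t h k l" .
  show "t (- h) k l = - t h k l" "t h k (- l) = - t h k l"
    using sc[of "-1" h k l] sc3[of h k "-1" l] by simp_all
  show "t h (- k) l = - t h k l"
    using sc[of "-1" k h l] s1[of h k l] s1[of h "- k" l] by simp
qed

lemma ES3H_sym:
  assumes t: "t \<in> ES3H J" shows "t h k l = t k h l" "t h k l = t h l k"
  using t unfolding ES3H_def by blast+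

lemma ES3H_expand:
  assumes t: "t \<in> ES3H J"
  shows "t h k l = C_mult J (fst h * fst k) (t (1, 0) (1, 0) l)
    + C_mult J (fst h * snd k + snd h * fst k) (t (1, 0) (0, 1) l)
    + C_mult J (snd h * snd k) (t (0, 1) (0, 1) l)"
proof -
  have dec: "h = (fst h * fst e1, fst h * snd e1) + (snd h * fst e2, snd h * snd e2)"
    if "e1 = (1, 0)" "e2 = (0, 1)" for h e1 e2 :: "complex \<times> complex" using that by (simp add: prod_eq_iff)
  have 1: "t h k l = C_mult J (fst h) (t (1, 0) k l) + C_mult J (snd h) (t (0, 1) k l)" for h k
    using arg_cong[OF dec[OF refl refl, of h], of "\<lambda>h. t h k l"] by (simp only: ES3H_simps[OF t])
  have 2: "t h k l = C_mult J (fst k) (t h (1, 0) l) + C_mult J (snd k) (t h (0, 1) l)" for h k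
    using arg_cong[OF dec[OF refl refl, of k], of "\<lambda>k. t h k l"] by (simp only: ES3H_simps[OF t])
  show ?thesis
    unfolding 1[of h k] 2[of "(1, 0)" k] 2[of "(0, 1)" k] ES3H_sym(1)[OF t, of "(0, 1)" "(1, 0)"]
    by (simp add: C_mult_simps algebra_simps)
qed

text \<open>The Pauli matrix identity on a symmetric pair of factors H; on a skew pair the value
  would be 3 instead of -1.\<close>

lemma ES3H_pair:
  assumes t: "t \<in> ES3H J"
  shows "t (rC2 1 h) (rC2 1 k) l + t (rC2 2 h) (rC2 2 k) l + t (rC2 3 h) (rC2 3 k) l = - t h k l"
  unfolding ES3H_expand[OF t, of "rC2 _ _"] ES3H_expand[OF t, of h k]
  by (rule inner_eqI)
    (simp add: rC2_simps C_mult_def inner_simps algebra_simps)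

definition sp1_der :: "nat \<Rightarrow> (complex \<times> complex \<Rightarrow> complex \<times> complex \<Rightarrow> complex \<times> complex \<Rightarrow> 'a) \<Rightarrow>
    complex \<times> complex \<Rightarrow> complex \<times> complex \<Rightarrow> complex \<times> complex \<Rightarrow> 'a" where
  "sp1_der a t h k l = t (rC2 a h) k l + t h (rC2 a k) l + t h k (rC2 a l)"

text \<open>The constant is -m (m + 2) for m = 3: the squares contribute -9, and each of the three
  pairs of factors twice the -1 of \<open>ES3H_pair\<close>.\<close>

lemma ES3H_casimir:
  assumes t: "t \<in> ES3H J"
  shows "sp1_der 1 (sp1_der 1 t) h k l + sp1_der 2 (sp1_der 2 t) h k l + sp1_der 3 (sp1_der 3 t) h k l = - 15 *\<^sub>R t h k l"
proof -
  have sq: "rC2 1 (rC2 1 h) = - h" "rC2 2 (rC2 2 h) = - h" "rC2 3 (rC2 3 h) = - h" for h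
    by (simp_all add: rC2_simps prod_eq_iff)
  have rot: "t k l h = t h k l" for h k l
    by (simp only: ES3H_sym(2)[OF t, of k l h] ES3H_sym(1)[OF t, of k h l])
  have p23: "t h (rC2 1 k) (rC2 1 l) + t h (rC2 2 k) (rC2 2 l) + t h (rC2 3 k) (rC2 3 l) = - t h k l"
    using ES3H_pair[OF t, of k l h]
    by (simp only: rot[of "rC2 1 k" "rC2 1 l" h] rot[of "rC2 2 k" "rC2 2 l" h]
        rot[of "rC2 3 k" "rC2 3 l" h] rot[of k l h])
  have p13: "t (rC2 1 h) k (rC2 1 l) + t (rC2 2 h) k (rC2 2 l) + t (rC2 3 h) k (rC2 3 l) = - t h k l"
    using ES3H_pair[OF t, of h l k]
    by (simp only: ES3H_sym(2)[OF t, of "rC2 1 h" "rC2 1 l" k] ES3H_sym(2)[OF t, of "rC2 2 h" "rC2 2 l" k]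
        ES3H_sym(2)[OF t, of "rC2 3 h" "rC2 3 l" k] ES3H_sym(2)[OF t, of h l k])
  have "sp1_der 1 (sp1_der 1 t) h k l + sp1_der 2 (sp1_der 2 t) h k l + sp1_der 3 (sp1_der 3 t) h k l =
    - 9 *\<^sub>R t h k l
    + 2 *\<^sub>R (t (rC2 1 h) (rC2 1 k) l + t (rC2 2 h) (rC2 2 k) l + t (rC2 3 h) (rC2 3 k) l)
    + 2 *\<^sub>R (t h (rC2 1 k) (rC2 1 l) + t h (rC2 2 k) (rC2 2 l) + t h (rC2 3 k) (rC2 3 l))
    + 2 *\<^sub>R (t (rC2 1 h) k (rC2 1 l) + t (rC2 2 h) k (rC2 2 l) + t (rC2 3 h) k (rC2 3 l))"
    by (rule inner_eqI) (simp add: sp1_der_def sq ES3H_simps(7-9)[OF t] inner_simps)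
  also have "\<dots> = - 15 *\<^sub>R t h k l"
    unfolding ES3H_pair[OF t] p23 p13 by (rule inner_eqI) (simp add: inner_simps)
  finally show ?thesis .
qed

text \<open>The action of the rotation (\<open>c\<close>, \<open>s\<close>) is cubic on both
  representations. Its odd part in \<open>s\<close> is \<open>c\<^sup>2 * s\<close> times the
  infinitesimal action plus the cube of \<open>s\<close> times the term where all three slots are
  hit. For \<open>c = s\<close> the two coefficients agree, and the rotation with
  \<open>c = 0\<close>, \<open>s = 1\<close>, which consists of the second term alone, removes
  it.\<close>

lemma sp1_combination:
  assumes a: "a \<in> {1..3}"
  obtains qs where "\<And>r q. (r, q) \<in> set qs \<Longrightarrow> q \<in> Sp1"
    "\<And>T x y. T \<in> torsion_space \<Longrightarrow>
      inf_act (J a) T x y = (\<Sum>(r, q)\<leftarrow>qs. r *\<^sub>R act_torsion J id q T x y)"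
    "\<And>r q T. (r, q) \<in> set qs \<Longrightarrow> T \<in> torsion_space \<Longrightarrow> act_torsion J id q T \<in> torsion_space"
    "\<And>t h k l. t \<in> ES3H J \<Longrightarrow> sp1_der a t h k l = (\<Sum>(r, q)\<leftarrow>qs. r *\<^sub>R act_ES3H id q t h k l)"
proof -
  note J = linear_J[OF a] and J2 = J_square[OF a]
  note [simp] = linear_add[OF J] linear_diff[OF J] linear_scale[OF J] linear_neg[OF J] J2
  define s where "s = sqrt (1/2)"
  have s: "s\<^sup>2 + s\<^sup>2 = 1" "s\<^sup>2 + (- s)\<^sup>2 = 1" "(0::real)\<^sup>2 + 1\<^sup>2 = 1" "s * s = 1/2" "s * (s * u) = u / 2" for u
    by (simp_all add: s_def power2_eq_square flip: mult.assoc)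
  let ?g = "\<lambda>c s x. c *\<^sub>R x + s *\<^sub>R J a x"
  have act: "act_torsion J id (rot_q a c s) T = (\<lambda>x y. ?g c s (T (?g c (- s) x) (?g c (- s) y)))"
    "act_torsion J id (rot_q a c s) T \<in> torsion_space"
    if cs: "c\<^sup>2 + s\<^sup>2 = 1" and T: "T \<in> torsion_space" for c s T
  proof -
    have lin: "linear (?g c s)" for c s
      by (auto simp: algebra_simps intro!: linearI)
    have inv: "?g c s (?g c (- s) x) = x" if "c\<^sup>2 + s\<^sup>2 = 1" for c s x
    proof (rule inner_eqI)
      fix u
      have "?g c s (?g c (- s) x) \<bullet> u = (c\<^sup>2 + s\<^sup>2) * (x \<bullet> u)"
        by (simp add: inner_simps power2_eq_square algebra_simps)
      then show "?g c s (?g c (- s) x) \<bullet> u = x \<bullet> u" using that by simp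
    qed
    have i: "?g c (- s) (?g c s x) = x" for x using inv[of c "- s" x] cs by simp
    have eq: "?g c s = id \<circ> Sp1_tangent J (rot_q a c s)"
      by (simp add: fun_eq_iff Sp1_tangent_rot[OF a])
    note * = act_torsion_space[OF lin lin i inv[OF cs] eq T]
    show "act_torsion J id (rot_q a c s) T = (\<lambda>x y. ?g c s (T (?g c (- s) x) (?g c (- s) y)))"
      "act_torsion J id (rot_q a c s) T \<in> torsion_space" by (fact *)+
  qed
  have act': "act_ES3H id (rot_q a c s) t = (\<lambda>h k l. t (c *\<^sub>R h + s *\<^sub>R rC2 a h)
      (c *\<^sub>R k + s *\<^sub>R rC2 a k) (c *\<^sub>R l + s *\<^sub>R rC2 a l))" if "c\<^sup>2 + s\<^sup>2 = 1" for c s t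
    unfolding act_ES3H_def Let_def Sp1_C2_rot_inv[OF a that] by simp
  define qs where "qs = [(2 * s, rot_q a s s), (- 2 * s, rot_q a s (- s)), (- 1, rot_q a 0 1)]"
  have mem: "\<exists>c s. q = rot_q a c s \<and> c\<^sup>2 + s\<^sup>2 = 1" if "(r, q) \<in> set qs" for r q
    using that s(1-3) unfolding qs_def by force
  show ?thesis
  proof (rule that)
    show "q \<in> Sp1" if "(r, q) \<in> set qs" for r q
      using mem[OF that] rot_q_Sp1[OF a] by auto
    show "act_torsion J id q T \<in> torsion_space" if "(r, q) \<in> set qs" "T \<in> torsion_space" for r q T
      using mem[OF that(1)] act(2) that(2) by auto
    show "inf_act (J a) T x y = (\<Sum>(r, q)\<leftarrow>qs. r *\<^sub>R act_torsion J id q T x y)"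
      if T: "T \<in> torsion_space" for T x y
    proof -
      note [simp] = bilinear_simps[OF torsion_spaceD(1)[OF T]]
      show ?thesis
        unfolding qs_def
        by (rule inner_eqI)
          (simp add: act(1)[OF s(1) T] act(1)[OF s(2) T] act(1)[OF s(3) T] inf_act_def inner_simps
            algebra_simps s(4,5))
    qed
    show "sp1_der a t h k l = (\<Sum>(r, q)\<leftarrow>qs. r *\<^sub>R act_ES3H id q t h k l)"
      if t: "t \<in> ES3H J" for t h k l
      unfolding qs_def
      by (rule inner_eqI)
        (simp add: act'[OF s(1)] act'[OF s(2)] act'[OF s(3)] sp1_der_def ES3H_simps(1-9,12-14)[OF t]
            inner_simps algebra_simps s(4,5))
  qed
qed

end

section \<open>The component \<open>\<X>\<^sub>6\<close>\<close>

context skew_hermitian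
begin

lemma linear_J_trace: "T \<in> torsion_space \<Longrightarrow> a \<in> {1..3} \<Longrightarrow> linear (J_trace T a)"
  unfolding J_trace_def
  by (rule linearI)
    (simp_all add: bilinear_simps[OF torsion_spaceD(1)] linear_add[OF linear_J] linear_scale[OF linear_J]
      lin_trace_add lin_trace_scaleR)

lemma J_trace_add: "a \<in> {1..3} \<Longrightarrow> J_trace (\<lambda>x y. S x y + T x y) a x = J_trace S a x + J_trace T a x"
  by (simp add: J_trace_def linear_add[OF linear_J] lin_trace_add)

lemma J_trace_scale: "a \<in> {1..3} \<Longrightarrow> J_trace (\<lambda>x y. r *\<^sub>R T x y) a x = r * J_trace T a x"
  by (simp add: J_trace_def linear_scale[OF linear_J] lin_trace_scaleR)

lemma alt_J_torsion: "(\<And>a. a \<in> {1..3} \<Longrightarrow> linear (\<tau> a)) \<Longrightarrow> alt_J \<tau> \<in> torsion_space"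
proof (rule torsion_spaceI)
  assume "\<And>a. a \<in> {1..3} \<Longrightarrow> linear (\<tau> a)"
  then have l: "linear (\<tau> 1)" "linear (\<tau> 2)" "linear (\<tau> 3)" by auto
  note [simp] = l[THEN linear_add] l[THEN linear_scale]
  show "bilinear (alt_J \<tau>)"
    by (auto simp: bilinear_def alt_J_def sum_1_3 algebra_simps intro!: linearI)
  show "alt_J \<tau> x y = - alt_J \<tau> y x" for x y
    by (simp add: alt_J_def sum_1_3)
qed

lemma casimir_torsion: "T \<in> torsion_space \<Longrightarrow> casimir T \<in> torsion_space"
  unfolding casimir_def[abs_def] by (intro torsion_sum inf_act_torsion linear_so_op finite_Basis)

lemma sp1_casimir_torsion: "T \<in> torsion_space \<Longrightarrow> sp1_casimir T \<in> torsion_space"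
  unfolding sp1_casimir_def[abs_def] by (intro torsion_sum inf_act_torsion linear_J) auto

text \<open>A polarised binary cubic with values in E: \<open>p\<close> holds its first two
  coefficients, and the real structure forces the other two. This embeds
  \<open>'a \<times> 'a\<close> into \<open>ES3H J\<close> and supplies the lower bound for the
  dimension count.\<close>

definition cubic :: "'a \<times> 'a \<Rightarrow> complex \<times> complex \<Rightarrow> complex \<times> complex \<Rightarrow> complex \<times> complex \<Rightarrow> 'a" where
  "cubic p h k l = C_mult J (fst h * fst k * fst l) (fst p)
     + C_mult J (fst h * fst k * snd l + fst h * snd k * fst l + snd h * fst k * fst l) (snd p)
     - C_mult J (fst h * snd k * snd l + snd h * fst k * snd l + snd h * snd k * fst l) (J 2 (snd p))
     + C_mult J (snd h * snd k * snd l) (J 2 (fst p))"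

lemma cubic_ES3H: "cubic p \<in> ES3H J"
  unfolding ES3H_def mem_Collect_eq
proof (intro conjI allI)
  fix h h' k l :: "complex \<times> complex" and z
  show "cubic p (h + h') k l = cubic p h k l + cubic p h' k l"
    by (rule inner_eqI) (simp add: cubic_def C_mult_def inner_simps algebra_simps)
  show "cubic p (z * fst h, z * snd h) k l = C_mult J z (cubic p h k l)"
    by (rule inner_eqI) (simp add: cubic_def C_mult_def inner_simps algebra_simps)
  show "cubic p h k l = cubic p k h l"
    by (rule inner_eqI) (simp add: cubic_def C_mult_def inner_simps algebra_simps)
  show "cubic p h k l = cubic p h l k"
    by (rule inner_eqI) (simp add: cubic_def C_mult_def inner_simps algebra_simps)
  show "cubic p (jH h) (jH k) (jH l) = J 2 (cubic p h k l)"
    by (rule inner_eqI) (simp add: cubic_def jH_def C_mult_def inner_simps algebra_simps)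
qed

lemma cubic_add: "cubic (p + q) = (\<lambda>h k l. cubic p h k l + cubic q h k l)"
  by (rule ext, rule ext, rule ext) (simp add: cubic_def C_mult_simps)

lemma cubic_scale: "cubic (r *\<^sub>R p) = (\<lambda>h k l. r *\<^sub>R cubic p h k l)"
  by (rule ext, rule ext, rule ext) (simp add: cubic_def C_mult_simps algebra_simps)

lemma cubic_inj: "cubic p = (\<lambda>h k l. 0) \<Longrightarrow> p = 0"
proof -
  assume p: "cubic p = (\<lambda>h k l. 0)"
  have "cubic p (1, 0) (1, 0) (1, 0) = fst p" "cubic p (1, 0) (1, 0) (0, 1) = snd p"
    by (simp_all add: cubic_def C_mult_simps)
  then show ?thesis by (simp add: p prod_eq_iff)
qed

section \<open>An arbitrary equivariant projection with its intertwiner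
  \<open>\<Phi>\<close>\<close>

context
  fixes P :: "('a \<Rightarrow> 'a \<Rightarrow> 'a) \<Rightarrow> ('a \<Rightarrow> 'a \<Rightarrow> 'a)" and \<Phi>
  assumes X6: "X6_projection J w P"
    and bij: "bij_betw \<Phi> (P ` torsion_space) (ES3H J)"
    and \<Phi>_add: "\<And>S T. S \<in> P ` torsion_space \<Longrightarrow> T \<in> P ` torsion_space \<Longrightarrow>
       \<Phi> (\<lambda>x y. S x y + T x y) = (\<lambda>h k l. \<Phi> S h k l + \<Phi> T h k l)"
    and \<Phi>_scale: "\<And>r T. T \<in> P ` torsion_space \<Longrightarrow> \<Phi> (\<lambda>x y. r *\<^sub>R T x y) = (\<lambda>h k l. r *\<^sub>R \<Phi> T h k l)"
    and \<Phi>_act: "\<And>A q T. A \<in> SO_star J w \<Longrightarrow> q \<in> Sp1 \<Longrightarrow> T \<in> P ` torsion_space \<Longrightarrow>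
       \<Phi> (act_torsion J A q T) = act_ES3H A q (\<Phi> T)"
    and DIM: "DIM('a) \<noteq> 2"
begin

lemma P_tor: "T \<in> torsion_space \<Longrightarrow> P T \<in> torsion_space"
  and P_idem: "T \<in> torsion_space \<Longrightarrow> P (P T) = P T"
  and P_add: "S \<in> torsion_space \<Longrightarrow> T \<in> torsion_space \<Longrightarrow> P (\<lambda>x y. S x y + T x y) = (\<lambda>x y. P S x y + P T x y)"
  and P_scale: "T \<in> torsion_space \<Longrightarrow> P (\<lambda>x y. r *\<^sub>R T x y) = (\<lambda>x y. r *\<^sub>R P T x y)"
  and P_act: "A \<in> SO_star J w \<Longrightarrow> q \<in> Sp1 \<Longrightarrow> T \<in> torsion_space \<Longrightarrow>
     P (act_torsion J A q T) = act_torsion J A q (P T)"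
  and P_bianchi: "T \<in> torsion_space \<Longrightarrow> w (P T x y) z + w (P T y z) x + w (P T z x) y = 0"
  and P_skew: "T \<in> torsion_space \<Longrightarrow> (\<And>x y z. w (T x y) z = - w (T x z) y) \<Longrightarrow> P T = (\<lambda>x y. 0)"
  using X6 unfolding X6_projection_def by blast+

lemma P_linear: "torsion_linear (\<lambda>T. P T x y)"
  by (simp add: torsion_linear_def P_add P_scale)

lemma \<Phi>P_linear: "torsion_linear (\<lambda>T. \<Phi> (P T) h k l)"
  by (simp add: torsion_linear_def P_add P_scale \<Phi>_add \<Phi>_scale)

lemma P_eqI:
  assumes "S \<in> torsion_space" "T \<in> torsion_space" "\<And>h k l. \<Phi> (P S) h k l = \<Phi> (P T) h k l"
  shows "P S = P T"
proof (rule inj_onD[OF bij_betw_imp_inj_on[OF bij]])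
  show "\<Phi> (P S) = \<Phi> (P T)" by (rule ext, rule ext, rule ext) (rule assms(3))
qed (rule imageI, fact)+

lemma id_SO_star: "id \<in> SO_star J w"
  by (simp add: SO_star_def linear_id)

lemma P_so_op:
  assumes T: "T \<in> torsion_space"
  shows "P (inf_act (so_op u v) T) x y = inf_act (so_op u v) (P T) x y"
proof (rule torsion_linear_so_op[OF P_linear T])
  note PT = P_tor[OF T]
  show "P (inf_act (so_op u u) T) x y = inf_act (so_op u u) (P T) x y" for u
  proof -
    obtain ps where ps: "\<And>r A. (r, A) \<in> set ps \<Longrightarrow> A \<in> SO_star J w"
      "\<And>x. so_op u u x = (\<Sum>(r, A)\<leftarrow>ps. r *\<^sub>R A x)"
      "\<And>T x y. T \<in> torsion_space \<Longrightarrow>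
        inf_act (so_op u u) T x y = (\<Sum>(r, A)\<leftarrow>ps. r *\<^sub>R act_torsion J A unit_q T x y)"
      "\<And>r A T. (r, A) \<in> set ps \<Longrightarrow> T \<in> torsion_space \<Longrightarrow> act_torsion J A unit_q T \<in> torsion_space"
      by (rule so_op_diag_combination[of u]) (rule that; assumption)
    have "inf_act (so_op u u) T = (\<lambda>x y. \<Sum>(r, A)\<leftarrow>ps. r *\<^sub>R act_torsion J A unit_q T x y)"
      by (rule ext, rule ext) (rule ps(3)[OF T])
    then have "P (inf_act (so_op u u) T) x y = (\<Sum>(r, A)\<leftarrow>ps. r *\<^sub>R P (act_torsion J A unit_q T) x y)"
      using torsion_linear_sum_list[OF P_linear, of ps "\<lambda>A. act_torsion J A unit_q T"] ps(4) T by simp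
    also have "\<dots> = (\<Sum>(r, A)\<leftarrow>ps. r *\<^sub>R act_torsion J A unit_q (P T) x y)"
      using ps(1) by (intro arg_cong[of _ _ sum_list] map_cong) (auto simp: P_act[OF _ unit_q_Sp1 T])
    also have "\<dots> = inf_act (so_op u u) (P T) x y" using ps(3)[OF PT] by simp
    finally show ?thesis .
  qed
  show "inf_act (so_op u v) (P T) x y = (1/2) *\<^sub>R (inf_act (so_op (u + v) (u + v)) (P T) x y
     - inf_act (so_op u u) (P T) x y - inf_act (so_op v v) (P T) x y)" for u v
    using inf_act_so_op_polarize[OF PT, of u v] by simp
qed

lemma \<Phi>P_so_op:
  assumes T: "T \<in> torsion_space"
  shows "\<Phi> (P (inf_act (so_op u v) T)) h k l = so_op u v (\<Phi> (P T) h k l)"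
proof (rule torsion_linear_so_op[OF \<Phi>P_linear T])
  have PT: "P T \<in> P ` torsion_space" using T by blast
  show "\<Phi> (P (inf_act (so_op u u) T)) h k l = so_op u u (\<Phi> (P T) h k l)" for u
  proof -
    obtain ps where ps: "\<And>r A. (r, A) \<in> set ps \<Longrightarrow> A \<in> SO_star J w"
      "\<And>x. so_op u u x = (\<Sum>(r, A)\<leftarrow>ps. r *\<^sub>R A x)"
      "\<And>T x y. T \<in> torsion_space \<Longrightarrow>
        inf_act (so_op u u) T x y = (\<Sum>(r, A)\<leftarrow>ps. r *\<^sub>R act_torsion J A unit_q T x y)"
      "\<And>r A T. (r, A) \<in> set ps \<Longrightarrow> T \<in> torsion_space \<Longrightarrow> act_torsion J A unit_q T \<in> torsion_space"
      by (rule so_op_diag_combination[of u]) (rule that; assumption)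
    have "inf_act (so_op u u) T = (\<lambda>x y. \<Sum>(r, A)\<leftarrow>ps. r *\<^sub>R act_torsion J A unit_q T x y)"
      by (rule ext, rule ext) (rule ps(3)[OF T])
    then have "\<Phi> (P (inf_act (so_op u u) T)) h k l = (\<Sum>(r, A)\<leftarrow>ps. r *\<^sub>R \<Phi> (P (act_torsion J A unit_q T)) h k l)"
      using torsion_linear_sum_list[OF \<Phi>P_linear, of ps "\<lambda>A. act_torsion J A unit_q T"] ps(4) T by simp
    also have "\<dots> = (\<Sum>(r, A)\<leftarrow>ps. r *\<^sub>R A (\<Phi> (P T) h k l))"
      using ps(1)
      by (intro arg_cong[of _ _ sum_list] map_cong)
        (auto simp: P_act[OF _ unit_q_Sp1 T] \<Phi>_act[OF _ unit_q_Sp1 PT] act_ES3H_def Sp1_C2_unit)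
    also have "\<dots> = so_op u u (\<Phi> (P T) h k l)" using ps(2) by simp
    finally show ?thesis .
  qed
qed (rule so_op_polarize)

lemma P_J:
  assumes T: "T \<in> torsion_space" and a: "a \<in> {1..3}"
  shows "P (inf_act (J a) T) x y = inf_act (J a) (P T) x y"
    "\<Phi> (P (inf_act (J a) T)) h k l = sp1_der a (\<Phi> (P T)) h k l"
proof -
  obtain qs where qs: "\<And>r q. (r, q) \<in> set qs \<Longrightarrow> q \<in> Sp1"
    "\<And>T x y. T \<in> torsion_space \<Longrightarrow>
      inf_act (J a) T x y = (\<Sum>(r, q)\<leftarrow>qs. r *\<^sub>R act_torsion J id q T x y)"
    "\<And>r q T. (r, q) \<in> set qs \<Longrightarrow> T \<in> torsion_space \<Longrightarrow> act_torsion J id q T \<in> torsion_space"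
    "\<And>t h k l. t \<in> ES3H J \<Longrightarrow> sp1_der a t h k l = (\<Sum>(r, q)\<leftarrow>qs. r *\<^sub>R act_ES3H id q t h k l)"
    by (rule sp1_combination[OF a]) (rule that; assumption)
  have PT: "P T \<in> P ` torsion_space" using T by blast
  have eq: "inf_act (J a) T = (\<lambda>x y. \<Sum>(r, q)\<leftarrow>qs. r *\<^sub>R act_torsion J id q T x y)"
    by (rule ext, rule ext) (rule qs(2)[OF T])
  then have "P (inf_act (J a) T) x y = (\<Sum>(r, q)\<leftarrow>qs. r *\<^sub>R P (act_torsion J id q T) x y)"
    using torsion_linear_sum_list[OF P_linear, of qs "\<lambda>q. act_torsion J id q T"] qs(3) T by simp
  also have "\<dots> = (\<Sum>(r, q)\<leftarrow>qs. r *\<^sub>R act_torsion J id q (P T) x y)"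
    using qs(1) by (intro arg_cong[of _ _ sum_list] map_cong) (auto simp: P_act[OF id_SO_star _ T])
  also have "\<dots> = inf_act (J a) (P T) x y" using qs(2)[OF P_tor[OF T]] by simp
  finally show "P (inf_act (J a) T) x y = inf_act (J a) (P T) x y" .
  have "\<Phi> (P (inf_act (J a) T)) h k l = (\<Sum>(r, q)\<leftarrow>qs. r *\<^sub>R \<Phi> (P (act_torsion J id q T)) h k l)"
    using torsion_linear_sum_list[OF \<Phi>P_linear, of qs "\<lambda>q. act_torsion J id q T"] qs(3) T eq by simp
  also have "\<dots> = (\<Sum>(r, q)\<leftarrow>qs. r *\<^sub>R act_ES3H id q (\<Phi> (P T)) h k l)"
    using qs(1) by (intro arg_cong[of _ _ sum_list] map_cong)
      (auto simp: P_act[OF id_SO_star _ T] \<Phi>_act[OF id_SO_star _ PT])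
  also have "\<dots> = sp1_der a (\<Phi> (P T)) h k l"
  proof -
    have "\<Phi> (P T) \<in> ES3H J" using bij_betwE[OF bij] PT by blast
    then show ?thesis by (simp add: qs(4))
  qed
  finally show "\<Phi> (P (inf_act (J a) T)) h k l = sp1_der a (\<Phi> (P T)) h k l" .
qed

text \<open>The first equation is equivariance of \<open>P\<close>. For the second,
  \<open>\<Phi>\<close> carries the generators of so*(2n) to operators acting on the factor E alone,
  where \<open>so_op_so_op_dual\<close> applies.\<close>

lemma P_casimir:
  assumes T: "T \<in> torsion_space"
  shows "P (casimir T) x y = casimir (P T) x y" "P (casimir T) x y = cas_const *\<^sub>R P T x y"
proof -
  have tor: "inf_act (so_op b c) T \<in> torsion_space" if "T \<in> torsion_space" for b c T
    using that by (intro inf_act_torsion linear_so_op)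
  have expand: "f (casimir T) = (\<Sum>b\<in>Basis. \<Sum>c\<in>Basis.
      f (inf_act (so_op b c) (inf_act (so_op (dual b) (dual c)) T)))" if f: "torsion_linear f" for f :: "_ \<Rightarrow> 'a"
  proof -
    have "f (casimir T) = (\<Sum>b\<in>Basis. f (\<lambda>x y. \<Sum>c\<in>Basis.
      inf_act (so_op b c) (inf_act (so_op (dual b) (dual c)) T) x y))"
      unfolding casimir_def[abs_def]
      by (rule torsion_linear_sum[OF f finite_Basis]) (intro torsion_sum tor T finite_Basis)
    also have "\<dots> = (\<Sum>b\<in>Basis. \<Sum>c\<in>Basis.
      f (inf_act (so_op b c) (inf_act (so_op (dual b) (dual c)) T)))"
      by (intro sum.cong refl torsion_linear_sum[OF f finite_Basis]) (intro tor T)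
    finally show ?thesis .
  qed
  have Pth: "P (inf_act (so_op b c) S) = inf_act (so_op b c) (P S)" if "S \<in> torsion_space" for b c S
    using P_so_op[OF that] by (intro ext)
  show "P (casimir T) x y = casimir (P T) x y"
    unfolding expand[OF P_linear] casimir_def by (simp add: Pth tor T)
  have "P (casimir T) = P (\<lambda>x y. cas_const *\<^sub>R T x y)"
  proof (rule P_eqI[OF casimir_torsion[OF T] torsion_scale[OF T]])
    show "\<Phi> (P (casimir T)) h k l = \<Phi> (P (\<lambda>x y. cas_const *\<^sub>R T x y)) h k l" for h k l
      unfolding expand[OF \<Phi>P_linear] torsion_linear_scale[OF \<Phi>P_linear T]
      by (simp add: \<Phi>P_so_op tor T so_op_so_op_dual)
  qed
  then show "P (casimir T) x y = cas_const *\<^sub>R P T x y" by (simp add: P_scale[OF T])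
qed

lemma P_sp1_casimir:
  assumes T: "T \<in> torsion_space"
  shows "P (sp1_casimir T) x y = sp1_casimir (P T) x y" "P (sp1_casimir T) x y = - 15 *\<^sub>R P T x y"
proof -
  have tor: "inf_act (J a) T \<in> torsion_space" if "T \<in> torsion_space" "a \<in> {1..3}" for a T
    using that by (intro inf_act_torsion linear_J)
  have expand: "f (sp1_casimir T) = (\<Sum>a=1..3. f (inf_act (J a) (inf_act (J a) T)))"
    if f: "torsion_linear f" for f :: "_ \<Rightarrow> 'a"
    unfolding sp1_casimir_def[abs_def]
  proof (rule torsion_linear_sum[OF f finite_atLeastAtMost])
    show "inf_act (J a) (inf_act (J a) T) \<in> torsion_space" if "a \<in> {1..3}" for a
      by (intro tor T that)
  qed
  have PJ: "P (inf_act (J a) S) = inf_act (J a) (P S)" if "S \<in> torsion_space" "a \<in> {1..3}" for a S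
    using P_J(1)[OF that] by (intro ext)
  have \<Phi>J: "\<Phi> (P (inf_act (J a) S)) = sp1_der a (\<Phi> (P S))" if "S \<in> torsion_space" "a \<in> {1..3}" for a S
    using P_J(2)[OF that] by (intro ext)
  show "P (sp1_casimir T) x y = sp1_casimir (P T) x y"
    unfolding expand[OF P_linear] sp1_casimir_def by (rule sum.cong[OF refl]) (simp add: PJ tor T)
  have ES: "\<Phi> (P T) \<in> ES3H J" using bij_betwE[OF bij] T by blast
  have "P (sp1_casimir T) = P (\<lambda>x y. (- 15) *\<^sub>R T x y)"
  proof (rule P_eqI[OF sp1_casimir_torsion[OF T] torsion_scale[OF T]])
    show "\<Phi> (P (sp1_casimir T)) h k l = \<Phi> (P (\<lambda>x y. (- 15) *\<^sub>R T x y)) h k l" for h k l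
      unfolding expand[OF \<Phi>P_linear] torsion_linear_scale[OF \<Phi>P_linear T] sum_1_3
      using ES3H_casimir[OF ES, of h k l] by (simp add: \<Phi>J tor T)
  qed
  then show "P (sp1_casimir T) x y = - 15 *\<^sub>R P T x y" by (simp only: P_scale[OF T])
qed

text \<open>Eigenvalue 3 of \<open>sp1_defect\<close> means Casimir value 2 * 3 - 9 = -3, that of a
  single factor H. Since \<open>P\<close> turns the Casimir operator into -15, nothing
  survives.\<close>

lemma P_eq_0:
  assumes T: "T \<in> torsion_space" and Q: "\<And>x y. sp1_defect T x y = 3 *\<^sub>R T x y"
  shows "P T x y = 0"
proof -
  have "sp1_casimir T x y = (- 3) *\<^sub>R T x y" for x y
    unfolding sp1_casimir_eq[OF torsion_spaceD(1)[OF T]] Q by (simp flip: scaleR_diff_left)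
  then have "sp1_casimir T = (\<lambda>x y. (- 3) *\<^sub>R T x y)" by (intro ext)
  then have "(- 3) *\<^sub>R P T x y = (- 15) *\<^sub>R P T x y"
    using P_sp1_casimir(2)[OF T, of x y] P_scale[OF T, of "- 3"] by simp
  then show ?thesis by simp
qed

lemma image_S3_type:
  assumes "S \<in> P ` torsion_space" shows "S \<in> torsion_space" "P S = S" "S3_type S"
proof -
  show S: "S \<in> torsion_space" "P S = S" using assms P_tor P_idem by auto
  show "S3_type S"
  proof (rule S3_typeI[OF S(1)])
    fix x y
    have "2 *\<^sub>R sp1_defect S x y - 9 *\<^sub>R S x y = - 15 *\<^sub>R S x y"
      using P_sp1_casimir[OF S(1), of x y] sp1_casimir_eq[OF torsion_spaceD(1)[OF S(1)], of x y] S(2)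
      by simp
    then have "2 *\<^sub>R sp1_defect S x y = 9 *\<^sub>R S x y + - 15 *\<^sub>R S x y"
      by (simp add: algebra_simps)
    also have "\<dots> = (- 6) *\<^sub>R S x y" by (rule inner_eqI) (simp add: inner_simps)
    finally have "(1/2) *\<^sub>R (2 *\<^sub>R sp1_defect S x y) = (1/2) *\<^sub>R ((- 6) *\<^sub>R S x y)" by simp
    then show "sp1_defect S x y = - 3 *\<^sub>R S x y" by simp
  qed
qed

lemma cas_const_nonzero: "cas_const \<noteq> 0"
  using DIM by (simp add: cas_const_def)

text \<open>On the image the cyclic sum vanishes and the Casimir operator is c =
  \<open>cas_const\<close>, so \<open>casimir_S3\<close> reads c S = 3 c S - 16
  \<open>alt_J (J_trace S)\<close>. In particular an element of the image is determined by its
  traces.\<close>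

lemma image_eq_alt_J:
  assumes "S \<in> P ` torsion_space"
  shows "S x y = (8 / cas_const) *\<^sub>R alt_J (J_trace S) x y"
proof (rule w_eqI)
  note S = image_S3_type[OF assms]
  fix z
  have cas: "casimir S x y = cas_const *\<^sub>R S x y"
    using P_casimir[OF S(1), of x y] S(2) by simp
  have bianchi: "w (S x y) z + w (S y z) x + w (S z x) y = 0"
    using P_bianchi[OF S(1), of x y z] S(2) by simp
  have "cas_const * w (S x y) z = 3 * cas_const * w (S x y) z - 16 * w (alt_J (J_trace S) x y) z"
    using casimir_S3[OF S(1,3), of x y z] unfolding bianchi cas by simp
  then show "w (S x y) z = w ((8 / cas_const) *\<^sub>R alt_J (J_trace S) x y) z"
    using cas_const_nonzero by (simp add: field_simps)
qed

text \<open>The tensor \<open>K\<close> isolates the cyclic sum in \<open>casimir_S3\<close>; it is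
  totally skew and thus killed by \<open>P\<close>. In contrast to \<open>image_eq_alt_J\<close>,
  the trace part still stands under \<open>P\<close>, where its value is not yet known.\<close>

lemma P_S3_type:
  assumes T: "T \<in> torsion_space" and S3: "S3_type T"
  shows "P T x y = (8 / cas_const) *\<^sub>R P (alt_J (J_trace T)) x y"
proof -
  let ?c = cas_const
  have d: "alt_J (J_trace T) \<in> torsion_space" by (rule alt_J_torsion) (rule linear_J_trace[OF T])
  define K where "K = (\<lambda>x y. casimir T x y + ((- 3 * ?c) *\<^sub>R T x y + 16 *\<^sub>R alt_J (J_trace T) x y))"
  note tor = casimir_torsion[OF T] torsion_scale[OF T, of "- 3 * ?c"] torsion_scale[OF d, of 16]
  have K: "K \<in> torsion_space"
    unfolding K_def by (intro torsion_add tor)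
  have wK: "w (K x y) z = 32 * (w (T x y) z + w (T y z) x + w (T z x) y)" for x y z
    using casimir_S3[OF T S3, of x y z] by (simp add: K_def)
  have "P K = (\<lambda>x y. 0)"
  proof (rule P_skew[OF K])
    fix x y z
    note sk = torsion_spaceD(2)[OF T]
    show "w (K x y) z = - w (K x z) y"
      unfolding wK using sk[of x z] sk[of z y] sk[of y x] by simp
  qed
  then have "0 = P K x y" by simp
  also have "\<dots> = P (casimir T) x y + ((- 3 * ?c) *\<^sub>R P T x y + 16 *\<^sub>R P (alt_J (J_trace T)) x y)"
    by (simp only: K_def P_add[OF tor(1) torsion_add[OF tor(2,3)]] P_add[OF tor(2,3)]
        P_scale[OF T] P_scale[OF d])
  also have "\<dots> = (- 2 * ?c) *\<^sub>R P T x y + 16 *\<^sub>R P (alt_J (J_trace T)) x y"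
    unfolding P_casimir(2)[OF T] by (rule inner_eqI) (simp add: inner_simps algebra_simps)
  finally have "(2 * ?c) *\<^sub>R P T x y = 16 *\<^sub>R P (alt_J (J_trace T)) x y"
    by (simp add: eq_neg_iff_add_eq_0)
  then have "(1 / (2 * ?c)) *\<^sub>R ((2 * ?c) *\<^sub>R P T x y) = (1 / (2 * ?c)) *\<^sub>R (16 *\<^sub>R P (alt_J (J_trace T)) x y)"
    by simp
  then show ?thesis using cas_const_nonzero by simp
qed

lemma J_trace_3:
  assumes "T \<in> torsion_space" "S3_type T"
  shows "J_trace T 3 x = J_trace T 2 (J 1 x) - J_trace T 1 (J 2 x)"
proof -
  have "linear (J_trace T a)" if "a \<in> {1..3}" for a using linear_J_trace[OF assms(1) that] .
  then have l: "linear (J_trace T 1)" "linear (J_trace T 2)" "linear (J_trace T 3)" by auto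
  show ?thesis
    using S3_type_J_trace_relation[OF assms, of "J 3 x"] by (simp add: linear_neg[OF l(1)] linear_neg[OF l(3)])
qed

text \<open>The image of \<open>P\<close> contains an element with any admissible traces: both sides of the injection
  \<open>E \<times> E \<rightarrow> [E \<otimes> S\<^sup>3H] \<rightarrow> E \<times> E\<close> given by the traces have the same dimension.\<close>

lemma image_traces:
  assumes T: "T \<in> torsion_space" "S3_type T"
  obtains S where "S \<in> P ` torsion_space" "\<And>a x. a \<in> {1..3} \<Longrightarrow> J_trace S a x = J_trace T a x"
proof -
  let ?W = "P ` torsion_space"
  define G where "G = inv_into ?W \<Phi>"
  have G: "G (cubic p) \<in> ?W" "\<Phi> (G (cubic p)) = cubic p" for p
  proof -
    have "cubic p \<in> \<Phi> ` ?W" using bij cubic_ES3H[of p] by (simp add: bij_betw_def)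
    then show "G (cubic p) \<in> ?W" "\<Phi> (G (cubic p)) = cubic p"
      unfolding G_def by (rule inv_into_into, rule f_inv_into_f)
  qed
  have W_add: "(\<lambda>x y. S x y + S' x y) \<in> ?W" if "S \<in> ?W" "S' \<in> ?W" for S S'
  proof (rule image_eqI)
    note S = image_S3_type[OF that(1)] and S' = image_S3_type[OF that(2)]
    show "(\<lambda>x y. S x y + S' x y) = P (\<lambda>x y. S x y + S' x y)"
      by (simp add: P_add[OF S(1) S'(1)] S(2) S'(2))
    show "(\<lambda>x y. S x y + S' x y) \<in> torsion_space" by (rule torsion_add[OF S(1) S'(1)])
  qed
  have W_scale: "(\<lambda>x y. r *\<^sub>R S x y) \<in> ?W" if "S \<in> ?W" for S r
  proof (rule image_eqI)
    note S = image_S3_type[OF that]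
    show "(\<lambda>x y. r *\<^sub>R S x y) = P (\<lambda>x y. r *\<^sub>R S x y)" by (simp add: P_scale[OF S(1)] S(2))
    show "(\<lambda>x y. r *\<^sub>R S x y) \<in> torsion_space" by (rule torsion_scale[OF S(1)])
  qed
  have inj: "S = S'" if "S \<in> ?W" "S' \<in> ?W" "\<Phi> S = \<Phi> S'" for S S'
    using bij that by (auto simp: bij_betw_def inj_on_def)
  have G_add: "G (cubic (p + q)) = (\<lambda>x y. G (cubic p) x y + G (cubic q) x y)" for p q
    by (rule inj[OF G(1) W_add[OF G(1) G(1)]]) (simp only: G(2) \<Phi>_add[OF G(1) G(1)], rule cubic_add)
  have G_scale: "G (cubic (r *\<^sub>R p)) = (\<lambda>x y. r *\<^sub>R G (cubic p) x y)" for r p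
    by (rule inj[OF G(1) W_scale[OF G(1)]]) (simp only: G(2) \<Phi>_scale[OF G(1)], rule cubic_scale)
  have one_two: "(1::nat) \<in> {1..3}" "(2::nat) \<in> {1..3}" by auto
  \<comment> \<open>The third trace is recovered by \<open>J_trace_3\<close>. If the first two
    vanish, then so does the trace part, and \<open>image_eq_alt_J\<close> makes the element zero;
    this gives injectivity.\<close>
  define L where "L p = ((\<Sum>b\<in>Basis. J_trace (G (cubic p)) 1 b *\<^sub>R b), (\<Sum>b\<in>Basis. J_trace (G (cubic p)) 2 b *\<^sub>R b))"
    for p :: "'a \<times> 'a"
  have J_trace_eq: "J_trace S a = J_trace S' a" if "S \<in> torsion_space" "S' \<in> torsion_space" "a \<in> {1..3}"
    "(\<Sum>b\<in>Basis. J_trace S a b *\<^sub>R b) = (\<Sum>b\<in>Basis. J_trace S' a b *\<^sub>R b)" for S S' a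
  proof (rule linear_eq_stdbasis[OF linear_J_trace linear_J_trace])
    show "J_trace S a b = J_trace S' a b" if b: "b \<in> Basis" for b
      using arg_cong[OF \<open>_ = (\<Sum>b\<in>Basis. J_trace S' a b *\<^sub>R b)\<close>, of "\<lambda>u. u \<bullet> b"]
      by (simp only: inner_sum_left_Basis[OF b])
  qed (use that in auto)
  have "linear L"
    by (rule linearI)
      (simp_all add: L_def G_add G_scale J_trace_add J_trace_scale sum.distrib scaleR_add_left scaleR_sum_right)
  moreover have "inj L"
  proof (rule linear_injective_0[THEN iffD2, rule_format], fact)
    fix p assume L0: "L p = 0"
    let ?S = "G (cubic p)"
    note S = image_S3_type[OF G(1)[of p]]
    have tr0: "J_trace (\<lambda>x y. 0) a = (\<lambda>x. 0)" if "a \<in> {1..3}" for a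
      using J_trace_scale[OF that, of 0 "\<lambda>x y. 0"] by auto
    have 12: "J_trace ?S 1 = (\<lambda>x. 0)" "J_trace ?S 2 = (\<lambda>x. 0)"
      using J_trace_eq[OF S(1) torsion_zero one_two(1)] J_trace_eq[OF S(1) torsion_zero one_two(2)] L0
      by (simp_all add: L_def tr0 zero_prod_def)
    then have "alt_J (J_trace ?S) x y = 0" for x y
      using J_trace_3[OF S(1,3)] by (simp add: alt_J_def sum_1_3)
    then have S0: "?S = (\<lambda>x y. 0 *\<^sub>R ?S x y)"
      using image_eq_alt_J[OF G(1)[of p]] by (intro ext) simp
    have "cubic p = \<Phi> (\<lambda>x y. 0 *\<^sub>R ?S x y)" using G(2)[of p] S0 by metis
    also have "\<dots> = (\<lambda>h k l. 0)" by (subst \<Phi>_scale[OF G(1)]) simp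
    finally show "p = 0" by (rule cubic_inj)
  qed
  ultimately have "surj L" by (rule linear_injective_imp_surjective) simp
  then obtain p where p: "((\<Sum>b\<in>Basis. J_trace T 1 b *\<^sub>R b), (\<Sum>b\<in>Basis. J_trace T 2 b *\<^sub>R b)) = L p"
    by (rule surjE)
  note S = image_S3_type[OF G(1)[of p]]
  have 12: "J_trace (G (cubic p)) 1 = J_trace T 1" "J_trace (G (cubic p)) 2 = J_trace T 2"
    using J_trace_eq[OF S(1) T(1) one_two(1)] J_trace_eq[OF S(1) T(1) one_two(2)] p by (simp_all add: L_def)
  have "J_trace (G (cubic p)) a x = J_trace T a x" if "a \<in> {1..3}" for a x
  proof -
    have "a = 1 \<or> a = 2 \<or> a = 3" using that by auto
    then show ?thesis using 12 J_trace_3[OF S(1,3), of x] J_trace_3[OF T, of x] by auto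
  qed
  then show ?thesis using that G(1) by blast
qed

text \<open>\<open>P_S3_type\<close> shows that the projection depends on the traces only. So
  \<open>T\<close> may be replaced by an element of the image with the same traces, which
  \<open>P\<close> fixes and \<open>image_eq_alt_J\<close> computes.\<close>

lemma P_S3_type_eq:
  assumes T: "T \<in> torsion_space" "S3_type T"
  shows "P T x y = (8 / cas_const) *\<^sub>R alt_J (J_trace T) x y"
proof -
  obtain S where S: "S \<in> P ` torsion_space" "\<And>a x. a \<in> {1..3} \<Longrightarrow> J_trace S a x = J_trace T a x"
    using image_traces[OF T] by blast
  have alt_J_eq: "alt_J (J_trace T) = alt_J (J_trace S)"
    by (rule ext, rule ext) (simp add: alt_J_def S(2))
  have "P T x y = (8 / cas_const) *\<^sub>R P (alt_J (J_trace S)) x y"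
    unfolding alt_J_eq[symmetric] by (rule P_S3_type[OF T])
  also have "\<dots> = P S x y" using P_S3_type[OF image_S3_type(1,3)[OF S(1)], of x y] by simp
  also have "\<dots> = (8 / cas_const) *\<^sub>R alt_J (J_trace S) x y"
    using image_S3_type[OF S(1)] image_eq_alt_J[OF S(1)] by simp
  finally show ?thesis by (simp add: alt_J_eq)
qed

end

end

section \<open>The difference of the adapted connections at a point\<close>

context skew_hermitian
begin

text \<open>The second summand is what passing from the Obata to the adapted connection adds to the
  torsion. As \<open>A x\<close> commutes with the \<open>J a\<close>, it has the type of a single
  factor H and falls under \<open>P_eq_0\<close>.\<close>

lemma X6_projection_eq:
  assumes X6: "X6_projection J w P" and DIM: "DIM('a) \<noteq> 2"
    and T: "T \<in> torsion_space" "S3_type T"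
    and A: "bilinear A" "\<And>a x y. a \<in> {1..3} \<Longrightarrow> A x (J a y) = J a (A x y)"
  shows "P (\<lambda>x y. T x y + (A x y - A y x)) x y = (1 / (2 - real DIM('a))) *\<^sub>R alt_J (J_trace T) x y"
proof -
  have "of_type_ES3H J w (P ` torsion_space)"
    using X6 unfolding X6_projection_def by (elim conjE)
  then obtain \<Phi> where \<Phi>: "bij_betw \<Phi> (P ` torsion_space) (ES3H J)"
    "\<forall>S\<in>P ` torsion_space. \<forall>T\<in>P ` torsion_space.
       \<Phi> (\<lambda>x y. S x y + T x y) = (\<lambda>h k l. \<Phi> S h k l + \<Phi> T h k l)"
    "\<forall>r. \<forall>T\<in>P ` torsion_space. \<Phi> (\<lambda>x y. r *\<^sub>R T x y) = (\<lambda>h k l. r *\<^sub>R \<Phi> T h k l)"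
    "\<forall>A\<in>SO_star J w. \<forall>q\<in>Sp1. \<forall>T\<in>P ` torsion_space.
       \<Phi> (act_torsion J A q T) = act_ES3H A q (\<Phi> T)"
    unfolding of_type_ES3H_def by (elim exE conjE)
  note ctx = X6 \<Phi>(1) \<Phi>(2)[THEN bspec, THEN bspec] \<Phi>(3)[THEN spec, THEN bspec]
    \<Phi>(4)[THEN bspec, THEN bspec, THEN bspec] DIM
  have AJ: "A x (J 1 y) = J 1 (A x y)" "A x (J 2 y) = J 2 (A x y)" "A x (J 3 y) = J 3 (A x y)" for x y
    using A(2) by auto
  have tor: "(\<lambda>x y. A x y - A y x) \<in> torsion_space"
    by (rule torsion_spaceI)
      (auto simp: bilinear_def bilinear_simps[OF A(1)] algebra_simps intro!: linearI)
  have "P (\<lambda>x y. A x y - A y x) x y = 0"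
  proof (rule P_eq_0[OF ctx tor])
    show "sp1_defect (\<lambda>x y. A x y - A y x) x y = 3 *\<^sub>R (A x y - A y x)" for x y
      by (rule inner_eqI) (simp add: sp1_defect_def sum_1_3 AJ inner_simps)
  qed
  moreover have "8 / cas_const = 1 / (2 - real DIM('a))"
    unfolding cas_const_def divide_divide_eq_left[symmetric] by simp
  ultimately show ?thesis
    by (simp only: P_add[OF ctx T(1) tor] P_S3_type_eq[OF ctx T] add_0_right)
qed

text \<open>The endomorphism \<open>p x *\<^sub>R J b y + q x *\<^sub>R J c y\<close> of
  \<open>y\<close> squares to minus \<open>(p x)\<^sup>2 + (q x)\<^sup>2\<close>. Were this nonzero,
  the symmetric identity could be solved for \<open>y\<close>, which would put every
  \<open>y\<close> into the span of \<open>x\<close> and \<open>J b (J c x)\<close>.\<close>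

lemma nijenhuis_alt_J_zero:
  assumes DIM: "DIM('a) > 2"
    and bc: "b \<in> {1..3}" "c \<in> {1..3}" "\<And>x. J b (J c x) = - J c (J b x)"
    and eq: "\<And>x y. p x *\<^sub>R J b y + q x *\<^sub>R J c y = p y *\<^sub>R J b x + q y *\<^sub>R J c x"
  shows "p x = 0 \<and> q x = 0"
proof (rule ccontr)
  assume neg: "\<not> ?thesis"
  define N where "N = (p x)\<^sup>2 + (q x)\<^sup>2"
  have pos: "N \<noteq> 0" using neg by (simp add: N_def sum_power2_eq_zero_iff)
  have "dim (span {x, J b (J c x)}) \<le> 2"
    using dim_le_card'[of "{x, J b (J c x)}"] card_insert_le_m1[of 2 "{J b (J c x)}" x] by (simp add: dim_span)
  then obtain y where y: "y \<notin> span {x, J b (J c x)}"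
    using DIM by (metis UNIV_eq_I dim_UNIV not_le)
  note l = linear_J[OF bc(1)] linear_J[OF bc(2)]
  note [simp] = l[THEN linear_add] l[THEN linear_scale] J_square[OF bc(1)] J_square[OF bc(2)]
  have "N *\<^sub>R y =
    - p x *\<^sub>R J b (p x *\<^sub>R J b y + q x *\<^sub>R J c y) - q x *\<^sub>R J c (p x *\<^sub>R J b y + q x *\<^sub>R J c y)"
    by (rule inner_eqI) (simp add: N_def bc(3) inner_simps power2_eq_square algebra_simps)
  also have "\<dots> = - p x *\<^sub>R J b (p y *\<^sub>R J b x + q y *\<^sub>R J c x) - q x *\<^sub>R J c (p y *\<^sub>R J b x + q y *\<^sub>R J c x)"
    unfolding eq[of x y] ..
  also have "\<dots> = (p x * p y + q x * q y) *\<^sub>R x + (q x * p y - p x * q y) *\<^sub>R J b (J c x)"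
    by (rule inner_eqI) (simp add: bc(3) inner_simps algebra_simps)
  also have "\<dots> \<in> span {x, J b (J c x)}"
    by (intro span_add span_scale span_base) auto
  finally have *: "N *\<^sub>R y \<in> span {x, J b (J c x)}" .
  have "(1 / N) *\<^sub>R (N *\<^sub>R y) \<in> span {x, J b (J c x)}"
    by (rule span_scale[OF *])
  then show False using pos y by (simp flip: N_def)
qed

text \<open>The covector of the prolongation. In \<open>difference_tensor\<close> the forms
  \<open>\<mu> a\<close> = \<open>\<gamma> a\<close> / 2 - \<open>\<tau> a\<close> turn out to be
  \<open>xi \<gamma>\<close> composed with \<open>J a\<close>. Composing once more and summing gives
  -3 \<open>xi \<gamma>\<close> on one side and, since the \<open>\<tau> a\<close> drop out, half
  the sum of the \<open>\<gamma> a (J a x)\<close> on the other; hence -1/6.\<close>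

definition xi :: "(nat \<Rightarrow> 'a \<Rightarrow> real) \<Rightarrow> 'a \<Rightarrow> real" where
  "xi \<gamma> x = - (1/6) * (\<Sum>a=1..3. \<gamma> a (J a x))"

lemma linear_xi: "(\<And>a. a \<in> {1..3} \<Longrightarrow> linear (\<gamma> a)) \<Longrightarrow> linear (xi \<gamma>)"
proof -
  assume "\<And>a. a \<in> {1..3} \<Longrightarrow> linear (\<gamma> a)"
  then have l: "linear (\<gamma> 1)" "linear (\<gamma> 2)" "linear (\<gamma> 3)" by auto
  note [simp] = l[THEN linear_add] l[THEN linear_scale]
  show ?thesis by (rule linearI) (simp_all add: xi_def sum_1_3 algebra_simps)
qed

text \<open>\<open>xi\<close> generates the first prolongation of \<open>\<g>\<l>(n, \<bbbH>) \<oplus> \<s>\<p>(1)\<close>, while that of \<open>\<g>\<l>(n, \<bbbH>)\<close>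
  vanishes. Since the other part of \<open>B\<close> commutes with the \<open>J a\<close>, its antisymmetrisation is killed
  by the algebraic Nijenhuis operator of each \<open>J a\<close>.\<close>

lemma difference_tensor:
  assumes B: "bilinear B" and DIM: "DIM('a) > 2"
    and \<gamma>: "\<And>a. a \<in> {1..3} \<Longrightarrow> linear (\<gamma> a)" and \<tau>: "\<And>a. a \<in> {1..3} \<Longrightarrow> linear (\<tau> a)"
    and \<tau>J: "\<And>x. (\<Sum>a=1..3. \<tau> a (J a x)) = 0"
    and BJ: "\<And>x y. B x (J 1 y) - J 1 (B x y) = \<gamma> 2 x *\<^sub>R J 3 y - \<gamma> 3 x *\<^sub>R J 2 y"
      "\<And>x y. B x (J 2 y) - J 2 (B x y) = \<gamma> 3 x *\<^sub>R J 1 y - \<gamma> 1 x *\<^sub>R J 3 y"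
      "\<And>x y. B x (J 3 y) - J 3 (B x y) = \<gamma> 1 x *\<^sub>R J 2 y - \<gamma> 2 x *\<^sub>R J 1 y"
    and skew: "\<And>x y. B x y - B y x = - alt_J \<tau> x y"
  shows "\<And>a x. a \<in> {1..3} \<Longrightarrow> \<gamma> a x = 2 * \<tau> a x + 2 * xi \<gamma> (J a x)"
    and "B x y = xi \<gamma> x *\<^sub>R y + xi \<gamma> y *\<^sub>R x - (\<Sum>a=1..3. xi \<gamma> (J a y) *\<^sub>R J a x)
      - (1/2) *\<^sub>R (\<Sum>a=1..3. \<gamma> a x *\<^sub>R J a y)"
proof -
  have lin: "linear (\<gamma> 1)" "linear (\<gamma> 2)" "linear (\<gamma> 3)" "linear (\<tau> 1)" "linear (\<tau> 2)" "linear (\<tau> 3)"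
    using \<gamma> \<tau> by auto
  have lin_xi: "linear (xi \<gamma>)" by (rule linear_xi) (rule \<gamma>)
  note [simp] = lin[THEN linear_add] lin[THEN linear_scale] lin[THEN linear_neg] bilinear_simps[OF B]
    linear_neg[OF lin_xi]
  \<comment> \<open>The commutators prescribed by \<open>BJ\<close> are those of \<open>- (1/2)
    *\<^sub>R (\<Sum>a=1..3. \<gamma> a x *\<^sub>R J a y)\<close>, so removing this part makes
    \<open>C x\<close> commute with the \<open>J a\<close>.\<close>
  define C where "C x y = B x y + (1/2) *\<^sub>R (\<Sum>a=1..3. \<gamma> a x *\<^sub>R J a y)" for x y
  define \<mu> where "\<mu> a x = (1/2) * \<gamma> a x - \<tau> a x" for a x
  have lin_\<mu>: "linear (\<mu> 1)" "linear (\<mu> 2)" "linear (\<mu> 3)"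
    by (auto simp: \<mu>_def algebra_simps intro!: linearI)
  note \<mu>_linear = lin_\<mu>[THEN linear_add] lin_\<mu>[THEN linear_scale] lin_\<mu>[THEN linear_neg]
  have BJ': "B x (J 1 y) = J 1 (B x y) + \<gamma> 2 x *\<^sub>R J 3 y - \<gamma> 3 x *\<^sub>R J 2 y"
      "B x (J 2 y) = J 2 (B x y) + \<gamma> 3 x *\<^sub>R J 1 y - \<gamma> 1 x *\<^sub>R J 3 y"
      "B x (J 3 y) = J 3 (B x y) + \<gamma> 1 x *\<^sub>R J 2 y - \<gamma> 2 x *\<^sub>R J 1 y" for x y
    using BJ[of x y] by (simp_all add: algebra_simps)
  have CJ: "C x (J 1 y) = J 1 (C x y)" "C x (J 2 y) = J 2 (C x y)" "C x (J 3 y) = J 3 (C x y)" for x y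
    by (rule inner_eqI, simp add: C_def BJ' sum_1_3 inner_simps algebra_simps)+
  have Cskew: "C x y - C y x = alt_J \<mu> x y" for x y
  proof (rule inner_eqI)
    fix u
    have "C x y \<bullet> u - C y x \<bullet> u = (B x y - B y x) \<bullet> u
      + (1/2) * (alt_J \<gamma> x y \<bullet> u)"
      by (simp add: C_def alt_J_def sum_1_3 inner_simps algebra_simps)
    also have "\<dots> = alt_J \<mu> x y \<bullet> u"
      unfolding skew by (simp add: \<mu>_def alt_J_def sum_1_3 inner_simps algebra_simps)
    finally show "(C x y - C y x) \<bullet> u = alt_J \<mu> x y \<bullet> u" by (simp add: inner_diff_left)
  qed
  have nij: "alt_J \<mu> (J a x) (J a y) - J a (alt_J \<mu> (J a x) y) - J a (alt_J \<mu> x (J a y)) - alt_J \<mu> x y = 0"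
    if a: "a \<in> {1..3}" for a x y
  proof -
    have "a = 1 \<or> a = 2 \<or> a = 3" using a by auto
    then show ?thesis
      unfolding Cskew[symmetric] by (auto simp: CJ)
  qed
  \<comment> \<open>For \<open>J 1\<close> the terms with \<open>\<mu> 1\<close> cancel in
    \<open>nij\<close>, and what is left is of the shape required by
    \<open>nijenhuis_alt_J_zero\<close>.\<close>
  have n1: "(\<mu> 3 (J 1 x) - \<mu> 2 x = 0) \<and> (- \<mu> 2 (J 1 x) - \<mu> 3 x = 0)" for x
  proof (rule nijenhuis_alt_J_zero[where b = 2 and c = 3])
    show "(\<mu> 3 (J 1 x) - \<mu> 2 x) *\<^sub>R J 2 y + (- \<mu> 2 (J 1 x) - \<mu> 3 x) *\<^sub>R J 3 y =
      (\<mu> 3 (J 1 y) - \<mu> 2 y) *\<^sub>R J 2 x + (- \<mu> 2 (J 1 y) - \<mu> 3 y) *\<^sub>R J 3 x" for x y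
    proof (rule inner_eqI)
      fix u
      show "((\<mu> 3 (J 1 x) - \<mu> 2 x) *\<^sub>R J 2 y + (- \<mu> 2 (J 1 x) - \<mu> 3 x) *\<^sub>R J 3 y) \<bullet> u =
        ((\<mu> 3 (J 1 y) - \<mu> 2 y) *\<^sub>R J 2 x + (- \<mu> 2 (J 1 y) - \<mu> 3 y) *\<^sub>R J 3 x) \<bullet> u"
        using arg_cong[OF nij[of 1 x y], of "\<lambda>v. v \<bullet> u"]
        by (simp add: alt_J_def sum_1_3 inner_simps \<mu>_linear algebra_simps)
    qed
  qed (use DIM in \<open>auto simp: \<mu>_linear algebra_simps intro!: linearI\<close>)
  have \<mu>1: "\<mu> 3 (J 1 x) = \<mu> 2 x" "\<mu> 2 (J 1 x) = - \<mu> 3 x" for x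
    using conjunct1[OF n1[of x]] conjunct2[OF n1[of x]] by linarith+
  have n2: "(\<mu> 1 (J 2 x) - \<mu> 3 x = 0) \<and> (- \<mu> 3 (J 2 x) - \<mu> 1 x = 0)" for x
  proof (rule nijenhuis_alt_J_zero[where b = 3 and c = 1])
    show "(\<mu> 1 (J 2 x) - \<mu> 3 x) *\<^sub>R J 3 y + (- \<mu> 3 (J 2 x) - \<mu> 1 x) *\<^sub>R J 1 y =
      (\<mu> 1 (J 2 y) - \<mu> 3 y) *\<^sub>R J 3 x + (- \<mu> 3 (J 2 y) - \<mu> 1 y) *\<^sub>R J 1 x" for x y
    proof (rule inner_eqI)
      fix u
      show "((\<mu> 1 (J 2 x) - \<mu> 3 x) *\<^sub>R J 3 y + (- \<mu> 3 (J 2 x) - \<mu> 1 x) *\<^sub>R J 1 y) \<bullet> u =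
        ((\<mu> 1 (J 2 y) - \<mu> 3 y) *\<^sub>R J 3 x + (- \<mu> 3 (J 2 y) - \<mu> 1 y) *\<^sub>R J 1 x) \<bullet> u"
        using arg_cong[OF nij[of 2 x y], of "\<lambda>v. v \<bullet> u"]
        by (simp add: alt_J_def sum_1_3 inner_simps \<mu>_linear algebra_simps)
    qed
  qed (use DIM in \<open>auto simp: \<mu>_linear algebra_simps intro!: linearI\<close>)
  have \<mu>2: "\<mu> 1 (J 2 x) = \<mu> 3 x" "\<mu> 3 (J 2 x) = - \<mu> 1 x" for x
    using conjunct1[OF n2[of x]] conjunct2[OF n2[of x]] by linarith+
  have \<mu>3: "\<mu> 1 (J 3 x) = - \<mu> 2 x" "\<mu> 2 (J 3 x) = \<mu> 1 x" for x
    using \<mu>1[of "J 2 x"] \<mu>1[of x] \<mu>2[of "J 1 x"] \<mu>2[of x] by (simp_all add: \<mu>_linear)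
  have \<xi>: "xi \<gamma> x = - \<mu> 1 (J 1 x)" for x
  proof -
    have "(\<Sum>a=1..3. \<mu> a (J a x)) = (1/2) * (\<Sum>a=1..3. \<gamma> a (J a x)) - (\<Sum>a=1..3. \<tau> a (J a x))"
      by (simp add: \<mu>_def sum_1_3)
    moreover have "\<mu> 2 (J 2 x) = \<mu> 1 (J 1 x)" "\<mu> 3 (J 3 x) = \<mu> 1 (J 1 x)"
      using \<mu>3(2)[of "J 1 x"] \<mu>2(1)[of "J 3 x"] by (simp_all add: \<mu>_linear)
    ultimately show ?thesis by (simp add: \<tau>J xi_def sum_1_3)
  qed
  have \<xi>J: "xi \<gamma> (J a x) = \<mu> a x" if "a \<in> {1..3}" for a x
  proof -
    have "a = 1 \<or> a = 2 \<or> a = 3" using that by auto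
    then show ?thesis using \<mu>2 \<mu>3 by (auto simp: \<xi> \<mu>_linear)
  qed
  then show "\<gamma> a x = 2 * \<tau> a x + 2 * xi \<gamma> (J a x)" if "a \<in> {1..3}" for a x
    using that by (simp add: \<mu>_def)
  define E where "E x y = xi \<gamma> x *\<^sub>R y + xi \<gamma> y *\<^sub>R x - (\<Sum>a=1..3. xi \<gamma> (J a y) *\<^sub>R J a x)" for x y
  have \<xi>J': "xi \<gamma> (J 1 x) = \<mu> 1 x" "xi \<gamma> (J 2 x) = \<mu> 2 x" "xi \<gamma> (J 3 x) = \<mu> 3 x" for x
    using \<xi>J by auto
  have \<mu>\<xi>: "\<mu> 1 (J 1 x) = - xi \<gamma> x" "\<mu> 2 (J 2 x) = - xi \<gamma> x" "\<mu> 3 (J 3 x) = - xi \<gamma> x" for x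
    using \<mu>3(2)[of "J 1 x"] \<mu>2(1)[of "J 3 x"] by (simp_all add: \<mu>_linear \<xi>)
  have EJ: "E x (J 1 y) = J 1 (E x y)" "E x (J 2 y) = J 2 (E x y)" "E x (J 3 y) = J 3 (E x y)" for x y
    by (rule inner_eqI, simp add: E_def sum_1_3 \<xi>J' \<mu>1 \<mu>2 \<mu>3 \<mu>\<xi> inner_simps)+
  have Eskew: "E x y - E y x = alt_J \<mu> x y" for x y
    by (rule inner_eqI) (simp add: E_def alt_J_def sum_1_3 \<xi>J' inner_simps)
  define F where "F x y = C x y - E x y" for x y
  have FJ: "F x (J 1 y) = J 1 (F x y)" "F x (J 2 y) = J 2 (F x y)" for x y
    by (simp_all add: F_def CJ EJ)
  have Fsym: "F x y = F y x" for x y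
    using Cskew[of x y] Eskew[of x y] by (simp add: F_def algebra_simps)
  \<comment> \<open>By symmetry \<open>F\<close> commutes with \<open>J 1\<close> and
    \<open>J 2\<close> in either slot. Taking them out of different slots in both orders makes
    \<open>J 1\<close> and \<open>J 2\<close> commute on the values of \<open>F\<close>, although
    they anticommute.\<close>
  have "F x y = 0"
  proof -
    have "J 3 (F x y) = J 1 (J 2 (F x y))" by simp
    also have "\<dots> = F (J 2 y) (J 1 x)" by (simp only: FJ Fsym[of "J 2 y" x])
    also have "\<dots> = F (J 1 x) (J 2 y)" by (rule Fsym)
    also have "\<dots> = J 2 (J 1 (F x y))" by (simp only: FJ Fsym[of "J 1 x" y] Fsym[of x y])
    also have "\<dots> = - J 3 (F x y)" by simp
    finally have "2 *\<^sub>R J 3 (F x y) = 0"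
      unfolding scaleR_2 by (rule eq_neg_iff_add_eq_0[THEN iffD1])
    then have "J 3 (J 3 (F x y)) = 0" by simp
    then show ?thesis by simp
  qed
  then show "B x y = xi \<gamma> x *\<^sub>R y + xi \<gamma> y *\<^sub>R x - (\<Sum>a=1..3. xi \<gamma> (J a y) *\<^sub>R J a x)
      - (1/2) *\<^sub>R (\<Sum>a=1..3. \<gamma> a x *\<^sub>R J a y)"
    by (simp add: F_def C_def E_def algebra_simps)
qed

lemma pi_S_eq_so_op: "pi_S J w z x y = (1/8) *\<^sub>R so_op z x y"
  by (rule inner_eqI) (simp add: pi_S_def so_op_expand inner_simps)

text \<open>The left side is the part of \<open>B x\<close> that is skew with respect to
  \<open>w\<close>. The multiple of the identity drops out, the \<open>J a\<close> are skew already,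
  and the remaining \<open>xi\<close> terms are halved. Since \<open>w Z\<close> = -6
  \<open>xi \<gamma>\<close> and \<open>pi_S\<close> is an eighth of \<open>so_op\<close>, the
  coefficient is 8 * (1/2) * (-1/6) = -2/3.\<close>

lemma adapted_difference:
  assumes \<gamma>: "\<And>a. a \<in> {1..3} \<Longrightarrow> linear (\<gamma> a)"
    and B: "\<And>x y. B x y = xi \<gamma> x *\<^sub>R y + xi \<gamma> y *\<^sub>R x - (\<Sum>a=1..3. xi \<gamma> (J a y) *\<^sub>R J a x)
      - (1/2) *\<^sub>R (\<Sum>a=1..3. \<gamma> a x *\<^sub>R J a y)"
    and AB: "\<And>x y z. w (AH x y) z = w (AQ x y) z - (1/2) * (w (B x y) z + w y (B x z))"
  shows "B x y + AH x y - AQ x y = - (1/2) *\<^sub>R (\<Sum>a=1..3. \<gamma> a x *\<^sub>R J a y)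
    - (2/3) *\<^sub>R pi_S J w (sharp w (\<lambda>x. \<Sum>a=1..3. \<gamma> a (J a x))) x y"
proof (rule w_eqI)
  fix z
  define Z where "Z = sharp w (\<lambda>x. \<Sum>a=1..3. \<gamma> a (J a x))"
  have lin: "linear (\<gamma> 1)" "linear (\<gamma> 2)" "linear (\<gamma> 3)" using \<gamma> by auto
  note [simp] = lin[THEN linear_add] lin[THEN linear_scale] lin[THEN linear_neg]
  have "linear (\<lambda>x. \<Sum>a=1..3. \<gamma> a (J a x))"
    by (rule linearI) (simp_all add: sum_1_3 algebra_simps)
  then have Z: "w Z y = - 6 * xi \<gamma> y" for y
    by (simp add: Z_def w_sharp xi_def)
  have "w (B x y + AH x y - AQ x y) z = (1/2) * (w (B x y) z - w y (B x z))"
    by (simp add: AB add_divide_distrib algebra_simps)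
  also have "\<dots> = w (- (1/2) *\<^sub>R (\<Sum>a=1..3. \<gamma> a x *\<^sub>R J a y) - (2/3) *\<^sub>R pi_S J w Z x y) z"
    by (simp add: B pi_S_def sum_1_3 Z w_skew[of y x] w_J_sym[of y x] field_simps)
  finally show "w (B x y + AH x y - AQ x y) z =
    w (- (1/2) *\<^sub>R (\<Sum>a=1..3. \<gamma> a x *\<^sub>R J a y) - (2/3) *\<^sub>R pi_S J w (sharp w (\<lambda>x. \<Sum>a=1..3. \<gamma> a (J a x))) x y) z"
    unfolding Z_def .
qed

text \<open>Read off from the comparison formula: the commutators of \<open>B x\<close> cancel
  against those of the \<open>\<gamma>\<close> term, while \<open>AQ x\<close> and
  \<open>pi_S\<close> commute with the \<open>J a\<close>.\<close>

lemma adapted_commutes: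
  assumes \<gamma>_BJ: "\<And>x y. B x (J 1 y) - J 1 (B x y) = \<gamma> 2 x *\<^sub>R J 3 y - \<gamma> 3 x *\<^sub>R J 2 y"
      "\<And>x y. B x (J 2 y) - J 2 (B x y) = \<gamma> 3 x *\<^sub>R J 1 y - \<gamma> 1 x *\<^sub>R J 3 y"
      "\<And>x y. B x (J 3 y) - J 3 (B x y) = \<gamma> 1 x *\<^sub>R J 2 y - \<gamma> 2 x *\<^sub>R J 1 y"
    and AQ: "\<And>a x y. a \<in> {1..3} \<Longrightarrow> AQ x (J a y) = J a (AQ x y)"
    and AH: "\<And>x y. AH x y = AQ x y - B x y - (1/2) *\<^sub>R (\<Sum>a=1..3. \<gamma> a x *\<^sub>R J a y) - (2/3) *\<^sub>R pi_S J w z x y"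
    and a: "a \<in> {1..3}"
  shows "AH x (J a y) = J a (AH x y)"
proof -
  have BJ': "B x (J 1 y) = J 1 (B x y) + \<gamma> 2 x *\<^sub>R J 3 y - \<gamma> 3 x *\<^sub>R J 2 y"
      "B x (J 2 y) = J 2 (B x y) + \<gamma> 3 x *\<^sub>R J 1 y - \<gamma> 1 x *\<^sub>R J 3 y"
      "B x (J 3 y) = J 3 (B x y) + \<gamma> 1 x *\<^sub>R J 2 y - \<gamma> 2 x *\<^sub>R J 1 y" for x y
    using \<gamma>_BJ[of x y] by (simp_all add: algebra_simps)
  have thJ: "so_op z x (J 1 y) = J 1 (so_op z x y)" "so_op z x (J 2 y) = J 2 (so_op z x y)" "so_op z x (J 3 y) = J 3 (so_op z x y)"
    using so_op_J by auto
  have AQJ: "AQ x (J 1 y) = J 1 (AQ x y)" "AQ x (J 2 y) = J 2 (AQ x y)" "AQ x (J 3 y) = J 3 (AQ x y)"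
    using AQ by auto
  have "AH x (J 1 y) = J 1 (AH x y)" "AH x (J 2 y) = J 2 (AH x y)" "AH x (J 3 y) = J 3 (AH x y)"
    by (rule inner_eqI, simp add: AH AQJ BJ' pi_S_eq_so_op thJ sum_1_3 inner_simps algebra_simps)+
  moreover have "a = 1 \<or> a = 2 \<or> a = 3" using a by auto
  ultimately show ?thesis by auto
qed

text \<open>In \<open>\<psi>\<close> the \<open>xi\<close> terms cancel because
  \<open>J c (J a x) = J b x\<close>, which leaves
  \<open>2 * (\<tau> c (J a x) - \<tau> b x)\<close>. Collecting the coefficient of a single
  \<open>J a\<close> and using the relation among the \<open>\<tau> a\<close> gives -6
  \<open>\<tau> a\<close>, which explains the 1/6.\<close>

lemma alt_J_psi:
  assumes \<tau>J: "\<And>x. (\<Sum>a=1..3. \<tau> a (J a x)) = 0" and \<tau>: "\<And>a. a \<in> {1..3} \<Longrightarrow> linear (\<tau> a)"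
    and \<gamma>: "\<And>a. a \<in> {1..3} \<Longrightarrow> linear (\<gamma> a)"
    and eq: "\<And>a x. a \<in> {1..3} \<Longrightarrow> \<gamma> a x = 2 * \<tau> a x + 2 * xi \<gamma> (J a x)"
    and \<psi>: "\<And>a b c x. \<psi> a b c x = \<gamma> c (J a x) - \<gamma> b x"
  shows "(1/6) *\<^sub>R (\<Sum>(a, b, c)\<in>cyclic3. \<psi> a b c x *\<^sub>R J b y + \<psi> a b c (J a x) *\<^sub>R J c y
     - \<psi> a b c y *\<^sub>R J b x - \<psi> a b c (J a y) *\<^sub>R J c x) = - alt_J \<tau> x y"
proof -
  have lin: "linear (\<tau> 1)" "linear (\<tau> 2)" "linear (\<tau> 3)" using \<tau> by auto
  note [simp] = lin[THEN linear_neg]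
  have "linear (xi \<gamma>)" by (rule linear_xi) (rule \<gamma>)
  note [simp] = linear_neg[OF this]
  have eq': "\<gamma> 1 x = 2 * \<tau> 1 x + 2 * xi \<gamma> (J 1 x)" "\<gamma> 2 x = 2 * \<tau> 2 x + 2 * xi \<gamma> (J 2 x)"
    "\<gamma> 3 x = 2 * \<tau> 3 x + 2 * xi \<gamma> (J 3 x)" for x
    using eq by auto
  have t: "\<tau> 2 (J 3 x) = \<tau> 3 (J 2 x) - \<tau> 1 x" "\<tau> 3 (J 1 x) = \<tau> 1 (J 3 x) - \<tau> 2 x"
    "\<tau> 1 (J 2 x) = \<tau> 2 (J 1 x) - \<tau> 3 x" for x
    using \<tau>J[of "J 1 x"] \<tau>J[of "J 2 x"] \<tau>J[of "J 3 x"] by (simp_all add: sum_1_3)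
  show ?thesis
    by (rule inner_eqI)
      (simp add: cyclic3_def \<psi> eq' t alt_J_def sum_1_3 inner_simps algebra_simps)
qed

end

section \<open>The difference of the adapted connections\<close>

lemma is_connection_linear:
  assumes "is_connection M U D" "V \<subseteq> U" "Y \<in> VF M V" "p \<in> V"
  shows "linear (\<lambda>v. D p v Y)"
  using assms(1)[unfolded is_connection_def, THEN conjunct2, THEN spec, THEN mp, OF assms(2),
    THEN bspec, OF assms(3), THEN conjunct1, THEN bspec, OF assms(4)] .

lemma torsion_tensorD:
  assumes "torsion_tensor M U D T"
  shows "p \<in> U \<Longrightarrow> bilinear (T p)"
    and "V \<subseteq> U \<Longrightarrow> X \<in> VF M V \<Longrightarrow> Y \<in> VF M V \<Longrightarrow> p \<in> V \<Longrightarrow>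
      T p (X p) (Y p) = D p (X p) Y - D p (Y p) X - bracket M X Y p"
  using assms unfolding torsion_tensor_def by blast+

lemma bracket_skew: "bracket M X Y p = - bracket M Y X p"
  by (simp add: bracket_def Let_def)

text \<open>The tensoriality of the difference in the field argument comes from that of the torsions, so
  no expansion in a local frame is needed.\<close>

lemma connection_difference:
  assumes M: "smooth_manifold M" and U: "openin (mtop M) U"
    and lin: "\<And>V Y p. V \<subseteq> U \<Longrightarrow> Y \<in> VF M V \<Longrightarrow> p \<in> V \<Longrightarrow> linear (\<lambda>v. D p v Y - D' p v Y)"
    and T: "torsion_tensor M U D T" and T': "torsion_tensor M U D' T'" and p: "p \<in> U"
  obtains B where "bilinear B"
    "\<And>V Y v. V \<subseteq> U \<Longrightarrow> Y \<in> VF M V \<Longrightarrow> p \<in> V \<Longrightarrow> D p v Y - D' p v Y = B v (Y p)"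
    "\<And>v w. B v w - B w v = T p v w - T' p v w"
proof -
  obtain V where V: "V \<subseteq> U" "p \<in> V" "openin (mtop M) V" "\<And>v. \<exists>X\<in>VF M V. X p = v"
    using vector_extends[OF M U p] by metis
  then obtain fld where fld: "\<And>v. fld v \<in> VF M V" "\<And>v. fld v p = v" by metis
  have sym: "D p v Y - D' p v Y = D p (Y p) (fld v) - D' p (Y p) (fld v) + (T p v (Y p) - T' p v (Y p))"
    if W: "W \<subseteq> U" "Y \<in> VF M W" "p \<in> W" for W Y v
  proof -
    have VW: "V \<inter> W \<subseteq> U" "p \<in> V \<inter> W" "openin (mtop M) (V \<inter> W)"
      using V W VF_openin[OF W(2)] by auto
    have X: "fld v \<in> VF M (V \<inter> W)" "Y \<in> VF M (V \<inter> W)"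
      using VF_subset[OF fld(1) _ VW(3)] VF_subset[OF W(2) _ VW(3)] by auto
    show ?thesis
      using torsion_tensorD(2)[OF T VW(1) X VW(2)] torsion_tensorD(2)[OF T' VW(1) X VW(2)]
      by (simp add: fld(2))
  qed
  define B where "B v w = D p v (fld w) - D' p v (fld w)" for v w
  have B: "D p v Y - D' p v Y = B v (Y p)" if W: "W \<subseteq> U" "Y \<in> VF M W" "p \<in> W" for W Y v
    using sym[OF W, of v] sym[OF V(1) fld(1) V(2), of v "Y p"] by (simp add: B_def fld(2))
  have skew: "B v w - B w v = T p v w - T' p v w" for v w
    using sym[OF V(1) fld(1) V(2), of v w] by (simp add: B_def fld(2))
  have lin1: "linear (\<lambda>v. B v w)" for w
    unfolding B_def by (rule lin[OF V(1) fld(1) V(2)])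
  have "linear (\<lambda>w. B w v + (T p v w - T' p v w))" for v
    using lin1[of v] torsion_tensorD(1)[OF T p] torsion_tensorD(1)[OF T' p]
    by (intro linear_compose_add linear_compose_sub) (simp_all add: bilinear_def)
  moreover have "(\<lambda>w. B w v + (T p v w - T' p v w)) = B v" for v
    by (rule ext) (simp flip: skew)
  ultimately have "bilinear B" using lin1 unfolding bilinear_def by metis
  then show ?thesis using that B skew by blast
qed

lemma obata_parallel:
  assumes "obata_connection M U J D T" "V \<subseteq> U" "Y \<in> VF M V" "p \<in> V" "a \<in> {1..3}"
  shows "D p v (\<lambda>q. J a q (Y q)) = J a p (D p v Y)"
proof -
  have "\<forall>V\<subseteq>U. \<forall>Y\<in>VF M V. \<forall>p\<in>V. \<forall>v. \<forall>a\<in>{1..3}. cov_endo D (J a) p v Y = 0"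
    using assms(1) unfolding obata_connection_def by (elim conjE)
  then have "cov_endo D (J a) p v Y = 0" using assms(2-5) by simp
  then show ?thesis by (simp add: cov_endo_def)
qed

text \<open>With parallel \<open>J a\<close> each Nijenhuis tensor is algebraic in \<open>T\<close>,
  and the three sum to 3 T minus the defect expression. The normalisation 1/6 therefore says 6 T = 3
  T - defect, which is the eigenvalue that characterises the S^3 type.\<close>

lemma obata_torsion:
  fixes J :: "nat \<Rightarrow> 'p \<Rightarrow> 'a::euclidean_space \<Rightarrow> 'a"
  assumes M: "smooth_manifold M" and J: "almost_hypercomplex M U J"
    and obata: "obata_connection M U J D T" and p: "p \<in> U"
  shows "T p \<in> torsion_space"
    and "(\<Sum>a=1..3. T p (J a p x) (J a p y) - J a p (T p (J a p x) y) - J a p (T p x (J a p y)))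
      = - 3 *\<^sub>R T p x y"
proof -
  have tor: "torsion_tensor M U D T" using obata by (simp add: obata_connection_def)
  have U: "openin (mtop M) U" using J by (simp add: almost_hypercomplex_def)
  obtain V where V: "V \<subseteq> U" "p \<in> V" "openin (mtop M) V" "\<And>v. \<exists>X\<in>VF M V. X p = v"
    using vector_extends[OF M U p] by metis
  then obtain fld where fld: "\<And>v. fld v \<in> VF M V" "\<And>v. fld v p = v" by metis
  note T = torsion_tensorD(2)[OF tor V(1) _ _ V(2)]
  have "T p x y = - T p y x" for x y
    using T[OF fld(1) fld(1), of x y] T[OF fld(1) fld(1), of y x] bracket_skew[of M "fld x" "fld y" p]
    by (simp add: fld(2))
  then show "T p \<in> torsion_space"
    using torsion_tensorD(1)[OF tor p] by (intro torsion_spaceI)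
  have N: "nijenhuis M (J a) (fld x) (fld y) p = T p x y
      - (T p (J a p x) (J a p y) - J a p (T p (J a p x) y) - J a p (T p x (J a p y)))"
    if a: "a \<in> {1..3}" for a
  proof -
    have Ja: "endo_field M U (J a)" "J a p (J a p v) = - v" for v
      using J a p by (auto simp: almost_hypercomplex_def)
    then have lin: "linear (J a p)" using p by (simp add: endo_field_def)
    have JV: "(\<lambda>q. J a q (fld v q)) \<in> VF M V" for v
      by (rule endo_field_VF[OF Ja(1) V(1) fld(1)])
    have par: "D p u (\<lambda>q. J a q (fld v q)) = J a p (D p u (fld v))" for u v
      by (rule obata_parallel[OF obata V(1) fld(1) V(2) a])
    have br: "bracket M X Y p = D p (X p) Y - D p (Y p) X - T p (X p) (Y p)"
      if "X \<in> VF M V" "Y \<in> VF M V" for X Y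
      using T[OF that] by simp
    show ?thesis
      unfolding nijenhuis_def br[OF JV JV] br[OF JV fld(1)] br[OF fld(1) JV] br[OF fld(1) fld(1)] par fld(2)
      by (simp add: linear_diff[OF lin] linear_add[OF lin] Ja(2) algebra_simps)
  qed
  have "\<forall>V\<subseteq>U. \<forall>X\<in>VF M V. \<forall>Y\<in>VF M V. \<forall>p\<in>V.
      T p (X p) (Y p) = (1/6) *\<^sub>R (\<Sum>a=1..3. nijenhuis M (J a) X Y p)"
    using obata unfolding obata_connection_def by (elim conjE)
  from this[rule_format, OF V(1) fld(1) fld(1) V(2), of x y]
  have "T p x y = (1/6) *\<^sub>R (\<Sum>a=1..3. nijenhuis M (J a) (fld x) (fld y) p)"
    by (simp only: fld(2))
  then have six: "6 *\<^sub>R T p x y = (\<Sum>a=1..3. nijenhuis M (J a) (fld x) (fld y) p)" by simp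
  also have "\<dots> = 3 *\<^sub>R T p x y - (\<Sum>a=1..3. T p (J a p x) (J a p y) - J a p (T p (J a p x) y)
      - J a p (T p x (J a p y)))"
    by (rule inner_eqI) (simp add: N sum_1_3 inner_simps)
  finally have "(\<Sum>a=1..3. T p (J a p x) (J a p y) - J a p (T p (J a p x) y) - J a p (T p x (J a p y)))
      = 3 *\<^sub>R T p x y - 6 *\<^sub>R T p x y" by (simp add: algebra_simps)
  also have "\<dots> = - 3 *\<^sub>R T p x y" by (simp flip: scaleR_diff_left)
  finally show "(\<Sum>a=1..3. T p (J a p x) (J a p y) - J a p (T p (J a p x) y) - J a p (T p x (J a p y)))
      = - 3 *\<^sub>R T p x y" .
qed

lemma skew_hermitian_at:
  assumes "almost_qsH M Q \<omega>" "admissible_basis M Q U J" "p \<in> U"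
  shows "skew_hermitian (\<lambda>a. J a p) (\<omega> p)"
proof (rule skew_hermitian.intro)
  have hyp: "almost_hypercomplex M U J" using assms(2) by (simp add: admissible_basis_def)
  then have U: "openin (mtop M) U" by (simp add: almost_hypercomplex_def)
  then have p: "p \<in> topspace (mtop M)" using assms(3) openin_subset by blast
  have \<omega>: "two_form_field M (topspace (mtop M)) \<omega>"
    "\<And>x. (\<And>y. \<omega> p x y = 0) \<Longrightarrow> x = 0"
    "\<And>a x y. a \<in> {1..3} \<Longrightarrow> \<omega> p (J a p x) (J a p y) = \<omega> p x y"
    using assms p unfolding almost_qsH_def by blast+
  have \<omega>': "bilinear (\<omega> p)" "\<And>x y. \<omega> p x y = - \<omega> p y x"
    using \<omega>(1) p unfolding two_form_field_def by blast+
  show "linear (J a p)" if "a \<in> {1..3}" for a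
    using hyp that assms(3) by (simp add: almost_hypercomplex_def endo_field_def)
  show "J a p (J a p x) = - x" if "a \<in> {1..3}" for a x
    using hyp that assms(3) by (simp add: almost_hypercomplex_def)
  show "J 1 p (J 2 p x) = J 3 p x" "J 2 p (J 1 p x) = - J 3 p x" for x
    using hyp assms(3) by (simp_all add: almost_hypercomplex_def)
  show "bilinear (\<omega> p)" by (fact \<omega>'(1))
  show "\<omega> p x y = - \<omega> p y x" for x y by (fact \<omega>'(2))
  show "x = 0" if "\<And>y. \<omega> p x y = 0" for x using \<omega>(2) that .
  show "\<omega> p (J a p x) (J a p y) = \<omega> p x y" if "a \<in> {1..3}" for a x y using \<omega>(3)[OF that] .
qed

lemma adapted_connectionE:
  assumes "adapted_connection M U \<omega> D D'"
  obtains A where "\<And>p. p \<in> U \<Longrightarrow> bilinear (A p)"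
    "\<And>V Y p v Z. V \<subseteq> U \<Longrightarrow> Y \<in> VF M V \<Longrightarrow> p \<in> V \<Longrightarrow> Z \<in> VF M V \<Longrightarrow>
       \<omega> p (A p v (Y p)) (Z p) = (1/2) * cov_form M D \<omega> p v Y Z"
    "\<And>V Y p v. V \<subseteq> U \<Longrightarrow> Y \<in> VF M V \<Longrightarrow> p \<in> V \<Longrightarrow> D' p v Y = D p v Y + A p v (Y p)"
proof -
  obtain A where A: "\<forall>p\<in>U. bilinear (A p)"
    "\<forall>V\<subseteq>U. \<forall>Y\<in>VF M V. \<forall>p\<in>V. \<forall>v.
       (\<forall>Z\<in>VF M V. \<omega> p (A p v (Y p)) (Z p) = (1/2) * cov_form M D \<omega> p v Y Z) \<and>
       D' p v Y = D p v Y + A p v (Y p)"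
    using assms unfolding adapted_connection_def by (elim exE conjE)
  note A2 = A(2)[THEN spec, THEN mp, THEN bspec, THEN bspec, THEN spec]
  show thesis
    by (rule that[OF A(1)[THEN bspec] A2[THEN conjunct1, THEN bspec] A2[THEN conjunct2]])
qed

theorem theorem1p9:
  fixes M :: "('p, 'a::euclidean_space) manifold"
    and Q :: "'p \<Rightarrow> ('a \<Rightarrow> 'a) set"
    and \<omega> :: "'p \<Rightarrow> 'a \<Rightarrow> 'a \<Rightarrow> real"
    and n :: nat
    and U :: "'p set"
    and J :: "nat \<Rightarrow> 'p \<Rightarrow> 'a \<Rightarrow> 'a"
    and DH DQ DH\<omega> DQ\<omega> :: "('p, 'a) conn"
    and TH TH\<omega> TQ\<omega> :: "'p \<Rightarrow> 'a \<Rightarrow> 'a \<Rightarrow> 'a"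
    and \<gamma> :: "nat \<Rightarrow> 'p \<Rightarrow> 'a \<Rightarrow> real"
  assumes dim: "DIM('a) = 4 * n" "n > 1"
    and qsH: "almost_qsH M Q \<omega>"
    and basis: "admissible_basis M Q U J"
    and obata: "obata_connection M U J DH TH"
    and oproiu: "oproiu_connection n M Q \<omega> DQ"
    and adapted_H: "adapted_connection M U \<omega> DH DH\<omega>"
    and adapted_Q: "adapted_connection M (topspace (mtop M)) \<omega> DQ DQ\<omega>"
    and torsion_H: "torsion_tensor M U DH\<omega> TH\<omega>"
    and torsion_Q: "torsion_tensor M (topspace (mtop M)) DQ\<omega> TQ\<omega>"
    and \<gamma>_form: "\<forall>a\<in>{1..3}. one_form_field M U (\<gamma> a)"
    and \<gamma>: "\<forall>V\<subseteq>U. \<forall>Y\<in>VF M V. \<forall>p\<in>V. \<forall>x. \<forall>(a, b, c)\<in>cyclic3.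
        cov_endo DQ\<omega> (J a) p x Y = \<gamma> c p x *\<^sub>R J b p (Y p) - \<gamma> b p x *\<^sub>R J c p (Y p)"
  defines "Z \<equiv> \<lambda>p. sharp (\<omega> p) (\<lambda>x. \<Sum>a=1..3. \<gamma> a p (J a p x))"
    and "\<Pi>S \<equiv> \<lambda>p. pi_S (\<lambda>a. J a p) (\<omega> p)"
    and "\<psi> \<equiv> \<lambda>a b c p x. \<gamma> c p (J a p x) - \<gamma> b p x"
  shows "(\<forall>V\<subseteq>U. \<forall>Y\<in>VF M V. \<forall>p\<in>V. \<forall>x.
            DH\<omega> p x Y = DQ\<omega> p x Y - (1/2) *\<^sub>R (\<Sum>a=1..3. \<gamma> a p x *\<^sub>R J a p (Y p))
                        - (2/3) *\<^sub>R \<Pi>S p (Z p) x (Y p))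
       \<and> (\<forall>p\<in>U. \<forall>x y.
            TH\<omega> p x y = TQ\<omega> p x y
                        + (1/2) *\<^sub>R (\<Sum>a=1..3. \<gamma> a p y *\<^sub>R J a p x - \<gamma> a p x *\<^sub>R J a p y)
                        - (2/3) *\<^sub>R (\<Pi>S p (Z p) x y - \<Pi>S p (Z p) y x))
       \<and> (\<forall>p\<in>U. \<forall>P. X6_projection (\<lambda>a. J a p) (\<omega> p) P \<longrightarrow>
            P (TH\<omega> p) = (\<lambda>x y. (1/6) *\<^sub>R (\<Sum>(a, b, c)\<in>cyclic3.
               \<psi> a b c p x *\<^sub>R J b p y + \<psi> a b c p (J a p x) *\<^sub>R J c p y
               - \<psi> a b c p y *\<^sub>R J b p x - \<psi> a b c p (J a p y) *\<^sub>R J c p x)))"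
proof -
  let ?M = "topspace (mtop M)"
  have M: "smooth_manifold M" using qsH by (simp add: almost_qsH_def almost_quaternionic_def)
  have hyp: "almost_hypercomplex M U J" using basis by (simp add: admissible_basis_def)
  then have U: "openin (mtop M) U" by (simp add: almost_hypercomplex_def)
  then have UM: "U \<subseteq> ?M" by (rule openin_subset)
  have form: "two_form_field M ?M \<omega>" using qsH by (simp add: almost_qsH_def)
  have connH: "is_connection M U DH" and torH: "torsion_tensor M U DH TH"
    using obata by (auto simp: obata_connection_def)
  have connQ: "is_connection M ?M DQ" and pres: "preserves_bundle M Q DQ"
    using oproiu by (auto simp: oproiu_connection_def)
  have torQ: "torsion_tensor M U DQ
      (\<lambda>p x y. TH p x y + (\<Sum>a=1..3. oproiu_tau n J TH a p x *\<^sub>R J a p y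
                                   - oproiu_tau n J TH a p y *\<^sub>R J a p x))"
    using oproiu basis obata unfolding oproiu_connection_def by blast
  obtain AH where AH: "\<And>p. p \<in> U \<Longrightarrow> bilinear (AH p)"
    "\<And>V Y p v Z. V \<subseteq> U \<Longrightarrow> Y \<in> VF M V \<Longrightarrow> p \<in> V \<Longrightarrow> Z \<in> VF M V \<Longrightarrow>
       \<omega> p (AH p v (Y p)) (Z p) = (1/2) * cov_form M DH \<omega> p v Y Z"
    "\<And>V Y p v. V \<subseteq> U \<Longrightarrow> Y \<in> VF M V \<Longrightarrow> p \<in> V \<Longrightarrow> DH\<omega> p v Y = DH p v Y + AH p v (Y p)"
    by (rule adapted_connectionE[OF adapted_H]) (rule that; assumption)
  obtain AQ where AQ: "\<And>p. p \<in> ?M \<Longrightarrow> bilinear (AQ p)"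
    "\<And>V Y p v Z. V \<subseteq> ?M \<Longrightarrow> Y \<in> VF M V \<Longrightarrow> p \<in> V \<Longrightarrow> Z \<in> VF M V \<Longrightarrow>
       \<omega> p (AQ p v (Y p)) (Z p) = (1/2) * cov_form M DQ \<omega> p v Y Z"
    "\<And>V Y p v. V \<subseteq> ?M \<Longrightarrow> Y \<in> VF M V \<Longrightarrow> p \<in> V \<Longrightarrow> DQ\<omega> p v Y = DQ p v Y + AQ p v (Y p)"
    by (rule adapted_connectionE[OF adapted_Q]) (rule that; assumption)
  \<comment> \<open>The torsion formula is left out here, since it follows by antisymmetrising the
    relation between the connections.\<close>
  have point: "(\<forall>V\<subseteq>U. \<forall>Y\<in>VF M V. p \<in> V \<longrightarrow> (\<forall>x.
            DH\<omega> p x Y = DQ\<omega> p x Y - (1/2) *\<^sub>R (\<Sum>a=1..3. \<gamma> a p x *\<^sub>R J a p (Y p))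
                        - (2/3) *\<^sub>R \<Pi>S p (Z p) x (Y p)))
      \<and> (\<forall>P. X6_projection (\<lambda>a. J a p) (\<omega> p) P \<longrightarrow>
            P (TH\<omega> p) = (\<lambda>x y. (1/6) *\<^sub>R (\<Sum>(a, b, c)\<in>cyclic3.
               \<psi> a b c p x *\<^sub>R J b p y + \<psi> a b c p (J a p x) *\<^sub>R J c p y
               - \<psi> a b c p y *\<^sub>R J b p x - \<psi> a b c p (J a p y) *\<^sub>R J c p x)))"
    if p: "p \<in> U" for p
  proof -
    interpret skew_hermitian "\<lambda>a. J a p" "\<omega> p" by (rule skew_hermitian_at[OF qsH basis p])
    have pM: "p \<in> ?M" using p UM by blast
    obtain V where V: "V \<subseteq> U" "p \<in> V" "openin (mtop M) V" "\<And>v. \<exists>X\<in>VF M V. X p = v"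
      using vector_extends[OF M U p] by metis
    then obtain fld where fld: "\<And>v. fld v \<in> VF M V" "\<And>v. fld v p = v" by metis
    have VM: "V \<subseteq> ?M" using V(1) UM by blast
    let ?\<gamma> = "\<lambda>a. \<gamma> a p" and ?\<tau> = "\<lambda>a. oproiu_tau n J TH a p"
    have lin_\<gamma>: "linear (?\<gamma> a)" if "a \<in> {1..3}" for a
      using \<gamma>_form that p by (simp add: one_form_field_def)
    have TH: "TH p \<in> torsion_space" by (rule obata_torsion(1)[OF M hyp obata p])
    have S3: "S3_type (TH p)"
      by (rule S3_typeI[OF TH]) (simp only: sp1_defect_def obata_torsion(2)[OF M hyp obata p])
    have \<tau>: "?\<tau> a x = (1 / (4 * real n - 2)) * J_trace (TH p) a x" for a x
      by (simp add: oproiu_tau_def J_trace_def)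
    have lin_\<tau>: "linear (?\<tau> a)" if "a \<in> {1..3}" for a
      using linear_J_trace[OF TH that] unfolding \<tau>[abs_def]
      by (intro linearI) (simp_all add: linear_add linear_scale algebra_simps)
    have \<tau>J: "(\<Sum>a=1..3. ?\<tau> a (J a p x)) = 0" for x
      unfolding \<tau> sum_distrib_left[symmetric] using S3_type_J_trace_relation[OF TH S3, of x]
      by (simp add: sum_1_3)
    have lin_diff: "linear (\<lambda>v. DH p v Y - DQ p v Y)" if "W \<subseteq> U" "Y \<in> VF M W" "p \<in> W" for W Y p
      using is_connection_linear[OF connH that] is_connection_linear[OF connQ _ that(2,3)] that(1) UM
      by (intro linear_compose_sub) auto
    obtain B where B: "bilinear B"
      "\<And>W Y v. W \<subseteq> U \<Longrightarrow> Y \<in> VF M W \<Longrightarrow> p \<in> W \<Longrightarrow> DH p v Y - DQ p v Y = B v (Y p)"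
      "\<And>v w. B v w - B w v = TH p v w - (TH p v w + (\<Sum>a=1..3. ?\<tau> a v *\<^sub>R J a p w - ?\<tau> a w *\<^sub>R J a p v))"
      by (rule connection_difference[OF M U _ torH torQ p]) ((rule lin_diff; assumption) | (rule that; assumption))+
    have B_skew: "B v w - B w v = - alt_J ?\<tau> v w" for v w
      unfolding B(3) alt_J_def by simp

    have AQ_skew: "\<omega> p (AQ p v x) y = - \<omega> p (AQ p v y) x" for v x y
    proof -
      have CF: "(\<lambda>q. \<omega> q (fld x q) (fld y q)) \<in> CF M V"
        using form VM fld(1) unfolding two_form_field_def by blast
      have "\<omega> q (fld y q) (fld x q) = - \<omega> q (fld x q) (fld y q)" if "q \<in> V" for q
        using form VM that unfolding two_form_field_def by blast
      then have "dir_deriv M p v (\<lambda>q. \<omega> q (fld y q) (fld x q)) =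
          - dir_deriv M p v (\<lambda>q. \<omega> q (fld x q) (fld y q))"
        by (rule dir_deriv_uminus[OF M CF V(2)])
      then have "cov_form M DQ \<omega> p v (fld x) (fld y) = - cov_form M DQ \<omega> p v (fld y) (fld x)"
        using w_skew[of "DQ p v (fld y)" x] w_skew[of y "DQ p v (fld x)"]
        by (simp add: cov_form_def fld(2))
      then show ?thesis
        using AQ(2)[OF VM fld(1) V(2) fld(1), of v x y] AQ(2)[OF VM fld(1) V(2) fld(1), of v y x]
        by (simp add: fld(2))
    qed
    have JV: "(\<lambda>q. J a q (fld y q)) \<in> VF M V" if "a \<in> {1..3}" for a y
      using hyp that by (intro endo_field_VF[OF _ V(1) fld(1)]) (auto simp: almost_hypercomplex_def)
    have covQ\<omega>: "cov_endo DQ\<omega> (J a) p v (fld y) = cov_endo DQ (J a) p v (fld y)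
        + (AQ p v (J a p y) - J a p (AQ p v y))" if a: "a \<in> {1..3}" for a v y
    proof -
      have 1: "DQ\<omega> p v (\<lambda>q. J a q (fld y q)) = DQ p v (\<lambda>q. J a q (fld y q)) + AQ p v (J a p y)"
        using AQ(3)[OF VM JV[OF a] V(2), of v y] by (simp only: fld(2))
      have 2: "DQ\<omega> p v (fld y) = DQ p v (fld y) + AQ p v y"
        using AQ(3)[OF VM fld(1) V(2), of v y] by (simp only: fld(2))
      have 3: "J a p (u + u') = J a p u + J a p u'" for u u'
        by (rule linear_add[OF linear_J[OF a]])
      show ?thesis unfolding cov_endo_def 1 2 3 by (simp only: add_diff_add)
    qed
    have cov\<gamma>: "cov_endo DQ\<omega> (J a) p v (fld y) = \<gamma> c p v *\<^sub>R J b p y - \<gamma> b p v *\<^sub>R J c p y"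
      if "(a, b, c) \<in> cyclic3" for a b c v y
      using \<gamma>[THEN spec, THEN mp, OF V(1), THEN bspec, OF fld(1)[of y], THEN bspec, OF V(2),
          THEN spec[of _ v], THEN bspec, OF that]
      by (simp add: fld(2))
    \<comment> \<open>The Oproiu connection and its adapted connection both preserve
      \<open>Q\<close>, so the commutator of \<open>AQ p v\<close> with \<open>J a p\<close> lies in
      \<open>Q p\<close> and is skew with respect to \<open>\<omega> p\<close>. But
      \<open>AQ p v\<close> is self-adjoint and \<open>J a p\<close> is skew, so the commutator is
      self-adjoint as well, hence zero.\<close>
    have AQ_J: "AQ p v (J a p y) = J a p (AQ p v y)" if a: "a \<in> {1..3}" for a v y
    proof -
      have "endo_field M U (J a)" using hyp a by (simp add: almost_hypercomplex_def)
      moreover have "\<forall>q\<in>U. J a q \<in> Q q"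
      proof
        fix q assume q: "q \<in> U"
        have "a = 1 \<or> a = 2 \<or> a = 3" using a by auto
        then have Jq: "J a q = (\<lambda>x. \<Sum>b=1..3. (if b = a then 1 else 0) *\<^sub>R J b q x)"
          by (elim disjE) (simp_all add: sum_1_3)
        have Qq: "Q q = {\<lambda>x. \<Sum>a=1..3. r a *\<^sub>R J a q x | r. True}"
          using basis q by (simp add: admissible_basis_def)
        show "J a q \<in> Q q"
          unfolding Qq mem_Collect_eq
          by (rule exI[of _ "\<lambda>b. if b = a then 1 else 0"], rule conjI[OF Jq TrueI])
      qed
      ultimately have "\<exists>K\<in>Q p. \<forall>W\<subseteq>U. p \<in> W \<longrightarrow> (\<forall>Y\<in>VF M W. cov_endo DQ (J a) p v Y = K (Y p))"
        using pres[unfolded preserves_bundle_def, THEN spec, THEN mp, OF UM, THEN mp, OF U,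
            THEN spec[of _ "J a"], THEN mp, OF conjI, THEN bspec, OF _ _ p, THEN spec[of _ v]] by simp
      then obtain K where K: "K \<in> Q p"
        "\<forall>W\<subseteq>U. p \<in> W \<longrightarrow> (\<forall>Y\<in>VF M W. cov_endo DQ (J a) p v Y = K (Y p))"
        by (rule bexE)
      have Qp: "Q p = {\<lambda>x. \<Sum>a=1..3. r a *\<^sub>R J a p x | r. True}"
        using basis p by (simp add: admissible_basis_def)
      obtain r where "K = (\<lambda>x. \<Sum>b=1..3. r b *\<^sub>R J b p x)"
        using K(1)[unfolded Qp mem_Collect_eq] by (elim exE conjE)
      then have r: "cov_endo DQ (J a) p v (fld y) = (\<Sum>b=1..3. r b *\<^sub>R J b p y)" for y
        using K(2)[THEN spec, THEN mp, OF V(1), THEN mp, OF V(2), THEN bspec, OF fld(1)[of y]]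
        by (simp add: fld(2))
      obtain s where s: "cov_endo DQ\<omega> (J a) p v (fld y) = (\<Sum>b=1..3. s b *\<^sub>R J b p y)" for y
      proof -
        have c: "(1, 2, 3) \<in> cyclic3" "(2, 3, 1) \<in> cyclic3" "(3, 1, 2) \<in> cyclic3"
          by (auto simp: cyclic3_def)
        consider "a = 1" | "a = 2" | "a = 3" using a by force
        then show ?thesis
        proof cases
          case 1
          show ?thesis
            by (rule that[of "\<lambda>b. if b = 2 then \<gamma> 3 p v else if b = 3 then - \<gamma> 2 p v else 0"])
              (simp add: 1 cov\<gamma>[OF c(1)] sum_1_3)
        next
          case 2
          show ?thesis
            by (rule that[of "\<lambda>b. if b = 3 then \<gamma> 1 p v else if b = 1 then - \<gamma> 3 p v else 0"])
              (simp add: 2 cov\<gamma>[OF c(2)] sum_1_3)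
        next
          case 3
          show ?thesis
            by (rule that[of "\<lambda>b. if b = 1 then \<gamma> 2 p v else if b = 2 then - \<gamma> 1 p v else 0"])
              (simp add: 3 cov\<gamma>[OF c(3)] sum_1_3)
        qed
      qed
      define G where "G y = AQ p v (J a p y) - J a p (AQ p v y)" for y
      have G: "G y = (\<Sum>b=1..3. (s b - r b) *\<^sub>R J b p y)" for y
        using covQ\<omega>[OF a, of v y] unfolding r s G_def by (simp add: sum_1_3 algebra_simps)
      have "\<omega> p (G y) z = - \<omega> p y (G z)" for y z
        unfolding G by (simp add: sum_1_3)
      moreover have "\<omega> p (G y) z = \<omega> p y (G z)" for y z
      proof -
        have adj: "\<omega> p (AQ p v x) y = \<omega> p x (AQ p v y)" for x y
          using AQ_skew[of v x y] w_skew[of "AQ p v y" x] by simp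
        have "a = 1 \<or> a = 2 \<or> a = 3" using a by auto
        then show ?thesis by (auto simp: G_def adj)
      qed
      ultimately have "\<omega> p (G y) z = 0" for z by (metis neg_equal_zero)
      then show ?thesis using w_nondegenerate[of "G y"] by (simp add: G_def)
    qed
    have covH: "DH p v (\<lambda>q. J a q (fld y q)) = J a p (DH p v (fld y))" if "a \<in> {1..3}" for a v y
      by (rule obata_parallel[OF obata V(1) fld(1) V(2) that])
    have BJ: "B v (J a p y) - J a p (B v y) = \<gamma> b p v *\<^sub>R J c p y - \<gamma> c p v *\<^sub>R J b p y"
      if abc: "(a, b, c) \<in> cyclic3" for a b c v y
    proof -
      have a: "a \<in> {1..3}" using abc by (auto simp: cyclic3_def)
      have cov: "cov_endo DQ (J a) p v (fld y) = \<gamma> c p v *\<^sub>R J b p y - \<gamma> b p v *\<^sub>R J c p y"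
        using covQ\<omega>[OF a, of v y] cov\<gamma>[OF abc] AQ_J[OF a] by simp
      have BJ: "B v (J a p y) = DH p v (\<lambda>q. J a q (fld y q)) - DQ p v (\<lambda>q. J a q (fld y q))"
        using B(2)[OF V(1) JV[OF a] V(2), of v y] by (simp add: fld(2))
      have B': "B v y = DH p v (fld y) - DQ p v (fld y)"
        using B(2)[OF V(1) fld(1) V(2), of v y] by (simp add: fld(2))
      have "B v (J a p y) - J a p (B v y) = - cov_endo DQ (J a) p v (fld y)"
        unfolding BJ B' covH[OF a] cov_endo_def linear_diff[OF linear_J[OF a]] by simp
      then show ?thesis unfolding cov by simp
    qed
    have cyc: "(1, 2, 3) \<in> cyclic3" "(2, 3, 1) \<in> cyclic3" "(3, 1, 2) \<in> cyclic3"
      by (auto simp: cyclic3_def)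
    have DIM: "DIM('a) > 2" "DIM('a) \<noteq> 2" using dim by auto
    note BJ3 = BJ[OF cyc(1)] BJ[OF cyc(2)] BJ[OF cyc(3)]
    have \<gamma>\<tau>: "\<gamma> a p x = 2 * ?\<tau> a x + 2 * xi ?\<gamma> (J a p x)" if "a \<in> {1..3}" for a x
      by (rule difference_tensor(1)[OF B(1) DIM(1) _ _ \<tau>J BJ3 B_skew that]) (rule lin_\<gamma> lin_\<tau>; assumption)+
    have B_eq: "B x y = xi ?\<gamma> x *\<^sub>R y + xi ?\<gamma> y *\<^sub>R x - (\<Sum>a=1..3. xi ?\<gamma> (J a p y) *\<^sub>R J a p x)
      - (1/2) *\<^sub>R (\<Sum>a=1..3. \<gamma> a p x *\<^sub>R J a p y)" for x y
      by (rule difference_tensor(2)[OF B(1) DIM(1) _ _ \<tau>J BJ3 B_skew]) (rule lin_\<gamma> lin_\<tau>; assumption)+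
    \<comment> \<open>The covariant derivatives of \<open>\<omega>\<close> by the two connections
      share the derivative of the function \<open>\<omega>(Y, Z)\<close> and differ by the action of
      \<open>B\<close> alone.\<close>
    have AB: "\<omega> p (AH p x y) z = \<omega> p (AQ p x y) z - (1/2) * (\<omega> p (B x y) z + \<omega> p y (B x z))" for x y z
    proof -
      have "DH p x (fld y) = DQ p x (fld y) + B x y" for y
        using B(2)[OF V(1) fld(1) V(2), of x y] by (simp add: fld(2) algebra_simps)
      then show ?thesis
        using AH(2)[OF V(1) fld(1) V(2) fld(1), of x y z] AQ(2)[OF VM fld(1) V(2) fld(1), of x y z]
        by (simp add: fld(2) cov_form_def algebra_simps)
    qed
    have R: "B x y + AH p x y - AQ p x y = - (1/2) *\<^sub>R (\<Sum>a=1..3. \<gamma> a p x *\<^sub>R J a p y)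
      - (2/3) *\<^sub>R \<Pi>S p (Z p) x y" for x y
      unfolding Z_def \<Pi>S_def by (rule adapted_difference[OF _ B_eq AB]) (rule lin_\<gamma>)
    have "DH\<omega> p x Y = DQ\<omega> p x Y - (1/2) *\<^sub>R (\<Sum>a=1..3. \<gamma> a p x *\<^sub>R J a p (Y p))
                        - (2/3) *\<^sub>R \<Pi>S p (Z p) x (Y p)"
      if W: "W \<subseteq> U" "Y \<in> VF M W" "p \<in> W" for W Y x
      using AH(3)[OF W, of x] AQ(3)[OF _ W(2,3), of x] W(1) UM B(2)[OF W, of x] R[of x "Y p"]
      by (simp add: algebra_simps)
    moreover have "P (TH\<omega> p) = (\<lambda>x y. (1/6) *\<^sub>R (\<Sum>(a, b, c)\<in>cyclic3.
               \<psi> a b c p x *\<^sub>R J b p y + \<psi> a b c p (J a p x) *\<^sub>R J c p y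
               - \<psi> a b c p y *\<^sub>R J b p x - \<psi> a b c p (J a p y) *\<^sub>R J c p x))"
      if P: "X6_projection (\<lambda>a. J a p) (\<omega> p) P" for P
    proof (rule ext, rule ext)
      fix x y
      have AH_J: "AH p x (J a p y) = J a p (AH p x y)" if "a \<in> {1..3}" for a x y
      proof (rule adapted_commutes[OF BJ3 _ _ that])
        show "AQ p x (J a p y) = J a p (AQ p x y)" if "a \<in> {1..3}" for a x y using that by (rule AQ_J)
        show "AH p x y = AQ p x y - B x y - (1/2) *\<^sub>R (\<Sum>a=1..3. \<gamma> a p x *\<^sub>R J a p y)
            - (2/3) *\<^sub>R pi_S (\<lambda>a. J a p) (\<omega> p) (Z p) x y" for x y
          using R[of x y] unfolding \<Pi>S_def by (simp add: algebra_simps)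
      qed
      have "TH\<omega> p = (\<lambda>x y. TH p x y + (AH p x y - AH p y x))"
      proof (rule ext, rule ext)
        fix x y
        show "TH\<omega> p x y = TH p x y + (AH p x y - AH p y x)"
          using torsion_tensorD(2)[OF torsion_H V(1) fld(1) fld(1) V(2), of x y]
            torsion_tensorD(2)[OF torH V(1) fld(1) fld(1) V(2), of x y]
            AH(3)[OF V(1) fld(1) V(2)]
          by (simp add: fld(2))
      qed
      then have "P (TH\<omega> p) x y = (1 / (2 - real DIM('a))) *\<^sub>R alt_J (J_trace (TH p)) x y"
        by (simp only:) (rule X6_projection_eq[OF P DIM(2) TH S3 AH(1)[OF p]], rule AH_J)
      \<comment> \<open>The factor 1 / (2 - 4n) of the projection is minus the normalisation 1 / (4n
        - 2) in \<open>oproiu_tau\<close>.\<close>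
      also have "\<dots> = - alt_J ?\<tau> x y"
      proof -
        have c: "1 / (2 - real DIM('a)) = - (1 / (4 * real n - 2))"
          using minus_divide_right[of 1 "4 * real n - 2"] by (simp add: dim(1))
        have d: "alt_J ?\<tau> x y = (1 / (4 * real n - 2)) *\<^sub>R alt_J (J_trace (TH p)) x y"
          by (simp add: alt_J_def \<tau> sum_1_3 scaleR_add_right scaleR_diff_right)
        show ?thesis unfolding c d by simp
      qed
      also have "\<dots> = (1/6) *\<^sub>R (\<Sum>(a, b, c)\<in>cyclic3.
               \<psi> a b c p x *\<^sub>R J b p y + \<psi> a b c p (J a p x) *\<^sub>R J c p y
               - \<psi> a b c p y *\<^sub>R J b p x - \<psi> a b c p (J a p y) *\<^sub>R J c p x)"
      proof (rule alt_J_psi[of ?\<tau> ?\<gamma> "\<lambda>a b c. \<psi> a b c p", symmetric])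
        show "(\<Sum>a=1..3. ?\<tau> a (J a p x)) = 0" for x by (rule \<tau>J)
        show "linear (?\<tau> a)" "linear (\<gamma> a p)" if "a \<in> {1..3}" for a
          using that by (rule lin_\<tau>, rule lin_\<gamma>)
        show "\<gamma> a p x = 2 * ?\<tau> a x + 2 * xi ?\<gamma> (J a p x)" if "a \<in> {1..3}" for a x
          using that by (rule \<gamma>\<tau>)
        show "\<psi> a b c p x = \<gamma> c p (J a p x) - \<gamma> b p x" for a b c x by (simp add: \<psi>_def)
      qed
      finally show "P (TH\<omega> p) x y = (1/6) *\<^sub>R (\<Sum>(a, b, c)\<in>cyclic3.
               \<psi> a b c p x *\<^sub>R J b p y + \<psi> a b c p (J a p x) *\<^sub>R J c p y
               - \<psi> a b c p y *\<^sub>R J b p x - \<psi> a b c p (J a p y) *\<^sub>R J c p x)" .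
    qed
    ultimately show ?thesis by blast
  qed
  have first: "DH\<omega> p x Y = DQ\<omega> p x Y - (1/2) *\<^sub>R (\<Sum>a=1..3. \<gamma> a p x *\<^sub>R J a p (Y p))
                        - (2/3) *\<^sub>R \<Pi>S p (Z p) x (Y p)"
    if "V \<subseteq> U" "Y \<in> VF M V" "p \<in> V" for V Y p x
    using point[of p] that by blast
  have second: "TH\<omega> p x y = TQ\<omega> p x y
                        + (1/2) *\<^sub>R (\<Sum>a=1..3. \<gamma> a p y *\<^sub>R J a p x - \<gamma> a p x *\<^sub>R J a p y)
                        - (2/3) *\<^sub>R (\<Pi>S p (Z p) x y - \<Pi>S p (Z p) y x)"
    if p: "p \<in> U" for p x y
  proof -
    obtain V where V: "V \<subseteq> U" "p \<in> V" "openin (mtop M) V" "\<And>v. \<exists>X\<in>VF M V. X p = v"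
      using vector_extends[OF M U p] by metis
    then obtain fld where fld: "\<And>v. fld v \<in> VF M V" "\<And>v. fld v p = v" by metis
    have "V \<subseteq> ?M" using V(1) UM by blast
    from torsion_tensorD(2)[OF torsion_H V(1) fld(1) fld(1) V(2), of x y]
      torsion_tensorD(2)[OF torsion_Q this fld(1) fld(1) V(2), of x y]
      first[OF V(1) fld(1) V(2)]
    have "TH\<omega> p x y - TQ\<omega> p x y =
       (- (1/2) *\<^sub>R (\<Sum>a=1..3. \<gamma> a p x *\<^sub>R J a p y) - (2/3) *\<^sub>R \<Pi>S p (Z p) x y)
     - (- (1/2) *\<^sub>R (\<Sum>a=1..3. \<gamma> a p y *\<^sub>R J a p x) - (2/3) *\<^sub>R \<Pi>S p (Z p) y x)"
      by (simp add: fld(2))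
    then show ?thesis
      by (simp add: sum_subtractf scaleR_diff_right algebra_simps)
  qed
  have third: "P (TH\<omega> p) = (\<lambda>x y. (1/6) *\<^sub>R (\<Sum>(a, b, c)\<in>cyclic3.
               \<psi> a b c p x *\<^sub>R J b p y + \<psi> a b c p (J a p x) *\<^sub>R J c p y
               - \<psi> a b c p y *\<^sub>R J b p x - \<psi> a b c p (J a p y) *\<^sub>R J c p x))"
    if "p \<in> U" "X6_projection (\<lambda>a. J a p) (\<omega> p) P" for p P
    by (rule point[OF that(1), THEN conjunct2, THEN spec, THEN mp, OF that(2)])
  show ?thesis
    by (intro conjI allI ballI impI) (erule (2) first, erule second, erule (1) third)
qed

end
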